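(* Let $f\colon M\to M$ be a $C^2$ local diffeomorphism of a compact Riemannian manifold $M$. If for some $\sigma\in(0,1)$ the first $\sigma$-hyperbolic time map $h\colon M\to\mathbb Z^+$ (defined $m$-almost everywhere) is Lebesgue integrable, then there are $\hat\sigma\in(0,1)$ and $\theta>0$ such that Lebesgue almost every $x\in M$ has frequency of $\hat\sigma$-hyperbolic times bigger than $\theta$.
   Context: $m$ denotes the normalized Riemannian volume on $M$, called Lebesgue measure. Given $0<\sigma<1$, $n$ is a $\sigma$-hyperbolic time for $x\in M$ if for all $1\le k\le n$, $$\prod_{j=n-k}^{n-1}\|Df(f^j(x))^{-1}\|\le\sigma^k.$$ The frequency of $\sigma$-hyperbolic times for $x\in M$ is bigger than $\theta>0$ if for all large $n$ there are $n_1<n_2<\dots<n_\ell\le n$ which are $\sigma$-hyperbolic times for $x$, with $\ell\ge\theta n$. The first $\sigma$-hyperbolic time map $h\colon M\to\mathbb Z^+$ is defined when Lebesgue almost every point of $M$ has some $\sigma$-hyperbolic time $n\ge1$; it assigns to ($m$-almost every) $x$ its smallest $\sigma$-hyperbolic time $n\ge1$. *)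

theory Defs
  imports "HOL-Analysis.Analysis"
begin

text \<open>
  A manifold is a subset \<open>M\<close> of a Hausdorff space, with the subspace topology, together with an
  atlas \<open>A\<close> of charts into \<open>real ^ 'n\<close>. A chart is a pair of its domain and its coordinate map;
  the values of the coordinate map outside the domain are irrelevant.
\<close>

type_synonym ('a, 'n) chart = "'a set \<times> ('a \<Rightarrow> real ^ 'n)"

definition chart_inv :: "('a, 'n::finite) chart \<Rightarrow> real ^ 'n \<Rightarrow> 'a" where
  "chart_inv c = inv_into (fst c) (snd c)"

text \<open>
  On an open set of a Euclidean space the following is the usual notion of being \<open>k\<close> times
  continuously differentiable: continuity of the derivative itself is continuity of all
  directional derivatives.
\<close>

primrec Ck_on ::
  "nat \<Rightarrow> 'b set \<Rightarrow> ('b::real_normed_vector \<Rightarrow> 'c::real_normed_vector) \<Rightarrow> bool"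
where
  "Ck_on 0 S F \<longleftrightarrow> continuous_on S F"
| "Ck_on (Suc k) S F \<longleftrightarrow>
     (\<forall>x\<in>S. F differentiable (at x)) \<and> (\<forall>v. Ck_on k S (\<lambda>x. frechet_derivative F (at x) v))"

definition smooth_on :: "'b set \<Rightarrow> ('b::real_normed_vector \<Rightarrow> 'c::real_normed_vector) \<Rightarrow> bool" where
  "smooth_on S F \<longleftrightarrow> (\<forall>k. Ck_on k S F)"

definition smooth_atlas :: "'a::t2_space set \<Rightarrow> ('a, 'n::finite) chart set \<Rightarrow> bool" where
  "smooth_atlas M A \<longleftrightarrow>
     (\<Union>c\<in>A. fst c) = M \<and>
     (\<forall>c\<in>A. openin (top_of_set M) (fst c) \<and> open (snd c ` fst c) \<and>
        homeomorphism (fst c) (snd c ` fst c) (snd c) (chart_inv c)) \<and>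
     (\<forall>c\<in>A. \<forall>d\<in>A. smooth_on (snd c ` (fst c \<inter> fst d)) (snd d \<circ> chart_inv c))"

definition charts_at :: "('a, 'n::finite) chart set \<Rightarrow> 'a \<Rightarrow> ('a, 'n) chart set" where
  "charts_at A x = {c \<in> A. x \<in> fst c}"

text \<open>
  A tangent vector at \<open>x\<close> is the family of its coordinates in all charts around \<open>x\<close>, which
  transform by the derivatives of the changes of coordinates; the value 0 at the other charts
  makes the representation unique. The vector space operations are pointwise.
\<close>

type_synonym ('a, 'n) tangent = "('a, 'n) chart \<Rightarrow> real ^ 'n"

definition tangent_space :: "('a, 'n::finite) chart set \<Rightarrow> 'a \<Rightarrow> ('a, 'n) tangent set" where
  "tangent_space A x =
     {v. (\<forall>c\<in>charts_at A x. \<forall>d\<in>charts_at A x.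
            v d = frechet_derivative (snd d \<circ> chart_inv c) (at (snd c x)) (v c)) \<and>
         (\<forall>c. c \<notin> charts_at A x \<longrightarrow> v c = 0)}"

definition coord_vector :: "('a, 'n::finite) chart set \<Rightarrow> ('a, 'n) chart \<Rightarrow> 'a \<Rightarrow> 'n \<Rightarrow> ('a, 'n) tangent"
where
  "coord_vector A c x i =
     (\<lambda>d. if d \<in> charts_at A x
          then frechet_derivative (snd d \<circ> chart_inv c) (at (snd c x)) (axis i 1) else 0)"

text \<open>
  A metric \<open>g\<close> is an inner product \<open>g x\<close> on the tangent space at each point \<open>x\<close> of \<open>M\<close>. The values
  of \<open>g x\<close> on families that are not tangent vectors at \<open>x\<close> are irrelevant.
\<close>

type_synonym ('a, 'n) metric = "'a \<Rightarrow> ('a, 'n) tangent \<Rightarrow> ('a, 'n) tangent \<Rightarrow> real"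

definition metric_matrix ::
  "('a, 'n::finite) chart set \<Rightarrow> ('a, 'n) metric \<Rightarrow> ('a, 'n) chart \<Rightarrow> 'a \<Rightarrow> real ^ 'n ^ 'n"
where
  "metric_matrix A g c x = (\<chi> i j. g x (coord_vector A c x i) (coord_vector A c x j))"

definition inner_product_on_tangent_space ::
  "('a, 'n::finite) chart set \<Rightarrow> 'a \<Rightarrow> (('a, 'n) tangent \<Rightarrow> ('a, 'n) tangent \<Rightarrow> real) \<Rightarrow> bool"
where
  "inner_product_on_tangent_space A x b \<longleftrightarrow>
     (\<forall>u\<in>tangent_space A x. \<forall>v\<in>tangent_space A x. b u v = b v u) \<and>
     (\<forall>u\<in>tangent_space A x. \<forall>v\<in>tangent_space A x. \<forall>w\<in>tangent_space A x.
        b (\<lambda>c. u c + v c) w = b u w + b v w) \<and>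
     (\<forall>r. \<forall>u\<in>tangent_space A x. \<forall>v\<in>tangent_space A x. b (\<lambda>c. r *\<^sub>R u c) v = r * b u v) \<and>
     (\<forall>u\<in>tangent_space A x. u \<noteq> (\<lambda>_. 0) \<longrightarrow> b u u > 0)"

definition riemannian_metric ::
  "'a set \<Rightarrow> ('a, 'n::finite) chart set \<Rightarrow> ('a, 'n) metric \<Rightarrow> bool"
where
  "riemannian_metric M A g \<longleftrightarrow>
     (\<forall>x\<in>M. inner_product_on_tangent_space A x (g x)) \<and>
     (\<forall>c\<in>A. \<forall>i j. smooth_on (snd c ` fst c) (\<lambda>y. metric_matrix A g c (chart_inv c y) $ i $ j))"

definition compact_riemannian_manifold ::
  "'a::t2_space set \<Rightarrow> ('a, 'n::finite) chart set \<Rightarrow> ('a, 'n) metric \<Rightarrow> bool"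
where
  "compact_riemannian_manifold M A g \<longleftrightarrow>
     compact M \<and> smooth_atlas M A \<and> riemannian_metric M A g"

definition tangent_norm :: "('a, 'n) metric \<Rightarrow> 'a \<Rightarrow> ('a, 'n) tangent \<Rightarrow> real" where
  "tangent_norm g x v = sqrt (g x v v)"

definition chart_volume ::
  "('a, 'n::finite) chart set \<Rightarrow> ('a, 'n) metric \<Rightarrow> ('a, 'n) chart \<Rightarrow> 'a set \<Rightarrow> ennreal"
where
  "chart_volume A g c B =
     (\<integral>\<^sup>+ y. ennreal (sqrt (det (metric_matrix A g c (chart_inv c y)))) * indicator (snd c ` B) y
        \<partial>lborel)"

text \<open>
  The Borel measure on \<open>M\<close> that is given by \<open>chart_volume\<close> on the Borel subsets of chart domains.
  These values agree on overlaps by the change of variables formula, and when \<open>M\<close> is compact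
  finitely many chart domains cover \<open>M\<close>, so that this measure exists, is unique, and its
  sigma-algebra consists of all Borel subsets of \<open>M\<close>.
\<close>

definition riemannian_volume ::
  "'a::t2_space set \<Rightarrow> ('a, 'n::finite) chart set \<Rightarrow> ('a, 'n) metric \<Rightarrow> 'a measure"
where
  "riemannian_volume M A g =
     extend_measure M {(c, B). c \<in> A \<and> B \<in> sets (restrict_space borel (fst c))}
       (\<lambda>(c, B). B) (\<lambda>(c, B). chart_volume A g c B)"

definition normalized_volume ::
  "'a::t2_space set \<Rightarrow> ('a, 'n::finite) chart set \<Rightarrow> ('a, 'n) metric \<Rightarrow> 'a measure"
where
  "normalized_volume M A g = uniform_measure (riemannian_volume M A g) M"

definition Ck_map_on ::
  "('a::t2_space, 'n::finite) chart set \<Rightarrow> nat \<Rightarrow> 'a set \<Rightarrow> ('a \<Rightarrow> 'a) \<Rightarrow> bool"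
where
  "Ck_map_on A k S F \<longleftrightarrow>
     continuous_on S F \<and>
     (\<forall>c\<in>A. \<forall>d\<in>A. Ck_on k (snd c ` (S \<inter> fst c \<inter> F -` fst d)) (snd d \<circ> F \<circ> chart_inv c))"

definition C2_local_diffeomorphism ::
  "'a::t2_space set \<Rightarrow> ('a, 'n::finite) chart set \<Rightarrow> ('a \<Rightarrow> 'a) \<Rightarrow> bool"
where
  "C2_local_diffeomorphism M A f \<longleftrightarrow>
     f ` M \<subseteq> M \<and>
     (\<forall>x\<in>M. \<exists>U. x \<in> U \<and> openin (top_of_set M) U \<and> openin (top_of_set M) (f ` U) \<and> inj_on f U \<and>
        Ck_map_on A 2 U f \<and> Ck_map_on A 2 (f ` U) (inv_into U f))"

text \<open>
  The derivative is computed in an arbitrary chart \<open>c\<close> around \<open>x\<close>; for tangent vectors \<open>v\<close> at \<open>x\<close>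
  the result does not depend on \<open>c\<close>.
\<close>

definition tangent_map ::
  "('a, 'n::finite) chart set \<Rightarrow> ('a \<Rightarrow> 'a) \<Rightarrow> 'a \<Rightarrow> ('a, 'n) tangent \<Rightarrow> ('a, 'n) tangent"
where
  "tangent_map A f x v =
     (let c = (SOME c. c \<in> charts_at A x)
      in (\<lambda>d. if d \<in> charts_at A (f x)
              then frechet_derivative (snd d \<circ> f \<circ> chart_inv c) (at (snd c x)) (v c) else 0))"

definition tangent_map_inv ::
  "('a, 'n::finite) chart set \<Rightarrow> ('a \<Rightarrow> 'a) \<Rightarrow> 'a \<Rightarrow> ('a, 'n) tangent \<Rightarrow> ('a, 'n) tangent"
where
  "tangent_map_inv A f x = inv_into (tangent_space A x) (tangent_map A f x)"

definition tangent_onorm ::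
  "('a, 'n::finite) chart set \<Rightarrow> ('a, 'n) metric \<Rightarrow> 'a \<Rightarrow> 'a \<Rightarrow>
     (('a, 'n) tangent \<Rightarrow> ('a, 'n) tangent) \<Rightarrow> real"
where
  "tangent_onorm A g x y L =
     Sup {tangent_norm g y (L v) | v. v \<in> tangent_space A x \<and> tangent_norm g x v \<le> 1}"

definition inv_derivative_norm ::
  "('a, 'n::finite) chart set \<Rightarrow> ('a, 'n) metric \<Rightarrow> ('a \<Rightarrow> 'a) \<Rightarrow> 'a \<Rightarrow> real"
where
  "inv_derivative_norm A g f x = tangent_onorm A g (f x) x (tangent_map_inv A f x)"

definition hyperbolic_time ::
  "('a, 'n::finite) chart set \<Rightarrow> ('a, 'n) metric \<Rightarrow> ('a \<Rightarrow> 'a) \<Rightarrow> real \<Rightarrow> 'a \<Rightarrow> nat \<Rightarrow> bool"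
where
  "hyperbolic_time A g f \<sigma> x n \<longleftrightarrow>
     (\<forall>k\<in>{1..n}. (\<Prod>j = n - k..<n. inv_derivative_norm A g f ((f ^^ j) x)) \<le> \<sigma> ^ k)"

text \<open>
  At a point without positive hyperbolic times the value is an unspecified constant, the same at
  all such points.
\<close>

definition first_hyperbolic_time ::
  "('a, 'n::finite) chart set \<Rightarrow> ('a, 'n) metric \<Rightarrow> ('a \<Rightarrow> 'a) \<Rightarrow> real \<Rightarrow> 'a \<Rightarrow> nat"
where
  "first_hyperbolic_time A g f \<sigma> x = (LEAST n. n \<ge> 1 \<and> hyperbolic_time A g f \<sigma> x n)"

text \<open>Since 0 is vacuously a hyperbolic time, only positive times are counted.\<close>

definition hyperbolic_frequency_bigger ::
  "('a, 'n::finite) chart set \<Rightarrow> ('a, 'n) metric \<Rightarrow> ('a \<Rightarrow> 'a) \<Rightarrow> real \<Rightarrow> real \<Rightarrow> 'a \<Rightarrow> bool"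
where
  "hyperbolic_frequency_bigger A g f \<sigma> \<theta> x \<longleftrightarrow>
     (\<forall>\<^sub>F n in sequentially.
        \<exists>H\<subseteq>{1..n}. (\<forall>i\<in>H. hyperbolic_time A g f \<sigma> x i) \<and> real (card H) \<ge> \<theta> * real n)"

end

theory Submission
  imports Defs
begin

text \<open>
  Write \<open>\<lambda> x\<close> for the norm of the inverse derivative at \<open>x\<close> and \<open>S n x\<close> for the sum of \<open>ln \<lambda>\<close>
  over the first \<open>n\<close> points of the orbit of \<open>x\<close>. By the lemma of Pliss (\<open>pliss\<close>) it is enough to
  find a constant \<open>\<beta> < 0\<close> such that \<open>S n x \<le> \<beta> * n\<close> for almost all \<open>x\<close> and all large \<open>n\<close>. At a
  \<open>\<sigma>\<close>-hyperbolic time \<open>S n x \<le> ln \<sigma> * n\<close>, and almost every point has such times, one after the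
  other; what is to be excluded is that the gaps between them spoil the averages.

  The geometric input is \<open>hyperbolic_domination\<close>: with a constant \<open>C\<close> that is the same for all
  \<open>n\<close>, the set of points for which \<open>n\<close> is a hyperbolic time and whose \<open>n\<close>-th image lies in \<open>E\<close> has
  measure at most \<open>C * m E\<close>. At such a time \<open>f ^^ n\<close> has a contracting inverse branch on a ball of
  uniform size, and since \<open>f\<close> is \<open>C\<^sup>2\<close> and the contraction is exponential along the orbit, this
  branch distorts volumes by a bounded factor only; different branches over the same ball have
  disjoint images. The branches are composed step by step, and the ball around each point of the
  orbit is an ellipsoid in a chart, measured in the norm that the metric gives at that very point;
  this makes the factors along the orbit equal to the numbers \<open>\<lambda>\<close>, up to a factor as close to 1 as
  desired.

  The measure-theoretic part follows a point to its last hyperbolic time \<open>n \<le> j\<close>. From there on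
  the first hyperbolic time exceeds \<open>j - n\<close>, so that the domination bounds \<open>m (f ^^ j \<in> E)\<close> by a
  constant times the sum over \<open>i\<close> of \<open>m (h > i \<and> f ^^ i \<in> E)\<close>. Because the first hyperbolic time
  \<open>h\<close> is integrable, this sum is a finite measure of \<open>E\<close> that does not depend on \<open>j\<close>, and hence
  sets that decrease to a null set are visited rarely, uniformly in \<open>j\<close>
  (\<open>dominated_imp_uniformly_small\<close>). With this uniformity the elementary proof of the ergodic
  theorem applies to \<open>m\<close> itself: on the invariant set where \<open>S n x - \<beta> * n\<close> is unbounded above in
  \<open>n\<close>, cut a long orbit segment greedily into blocks of slope at most \<open>ln \<sigma>\<close>, and also into blocks
  of slope at least \<open>\<beta> > ln \<sigma>\<close>. Both succeed up to a small proportion of the time, which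
  contradicts positive measure of that set (\<open>birkhoff_upper_bound\<close>). The constants \<open>\<beta>\<close> and hence
  \<open>\<sigma>'\<close> and \<open>\<theta>\<close> do not depend on the point.
\<close>

section \<open>Hyperbolic times of a sequence\<close>

text \<open>
  For a point \<open>x\<close> the sequence \<open>l\<close> is the norm of the inverse derivative along the orbit of \<open>x\<close>,
  and passing to the \<open>n\<close>-th image shifts the sequence.
\<close>

definition hyp_seq :: "real \<Rightarrow> (nat \<Rightarrow> real) \<Rightarrow> nat \<Rightarrow> bool" where
  "hyp_seq s l n \<longleftrightarrow> (\<forall>k\<in>{1..n}. (\<Prod>j = n - k..<n. l j) \<le> s ^ k)"

lemma hyp_seq_tail:
  assumes "hyp_seq s l (n + m)"
  shows "hyp_seq s (\<lambda>j. l (n + j)) m"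
  unfolding hyp_seq_def
proof
  fix k assume k: "k \<in> {1..m}"
  have "(\<Prod>j = m - k..<m. l (n + j)) = (\<Prod>j = (m - k) + n..<m + n. l j)"
    by (subst prod.shift_bounds_nat_ivl) (simp add: add.commute)
  also have "(m - k) + n = n + m - k" using k by auto
  finally show "(\<Prod>j = m - k..<m. l (n + j)) \<le> s ^ k"
    using assms k unfolding hyp_seq_def by (auto simp: add.commute)
qed

lemma hyp_seq_prod:
  assumes "hyp_seq s l n"
  shows "(\<Prod>j<n. l j) \<le> s ^ n"
proof (cases "n = 0")
  case False
  then have "(\<Prod>j = n - n..<n. l j) \<le> s ^ n"
    using assms unfolding hyp_seq_def by (meson atLeastAtMost_iff le_refl less_one not_le)
  then show ?thesis by (simp add: lessThan_atLeast0)
qed simp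

text \<open>
  Together with \<open>hyp_seq_tail\<close> this says that the hyperbolic times of a point form one chain: the
  next one after \<open>n\<close> is \<open>n\<close> plus the first hyperbolic time of the \<open>n\<close>-th image. A product over the
  last \<open>k\<close> factors either stays in the second part, or it splits into all of the second part and a
  final segment of the first.
\<close>

lemma hyp_seq_concat:
  assumes nn: "\<And>j. l j \<ge> 0" and s: "s \<ge> 0"
    and n: "hyp_seq s l n" and m: "hyp_seq s (\<lambda>j. l (n + j)) m"
  shows "hyp_seq s l (n + m)"
  unfolding hyp_seq_def
proof
  fix k assume k: "k \<in> {1..n + m}"
  have shift: "(\<Prod>j = m - k..<m. l (n + j)) = (\<Prod>j = (m - k) + n..<m + n. l j)" for k
    by (subst prod.shift_bounds_nat_ivl) (simp add: add.commute)
  have hm: "(\<Prod>j = (m - k) + n..<m + n. l j) \<le> s ^ k" if "k \<le> m" for k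
    using m that unfolding hyp_seq_def shift by (cases "k = 0") auto
  show "(\<Prod>j = n + m - k..<n + m. l j) \<le> s ^ k"
  proof (cases "k \<le> m")
    case True
    then have "n + m - k = (m - k) + n" by simp
    then show ?thesis using hm[OF True] by (simp add: add.commute)
  next
    case False
    define i where "i = k - m"
    have i: "k = m + i" "i \<in> {1..n}" using False k by (auto simp: i_def)
    have "(\<Prod>j = n + m - k..<n + m. l j) = (\<Prod>j = n - i..<n + m. l j)"
      by (rule prod.cong) (auto simp: i)
    also have "\<dots> = (\<Prod>j = n - i..<n. l j) * (\<Prod>j = n..<n + m. l j)"
      by (rule prod.atLeastLessThan_concat[symmetric]) (use i in auto)
    also have "\<dots> \<le> s ^ i * s ^ m"
    proof (rule mult_mono)
      show "(\<Prod>j = n - i..<n. l j) \<le> s ^ i" using n i unfolding hyp_seq_def by auto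
      show "(\<Prod>j = n..<n + m. l j) \<le> s ^ m" using hm[of m] by (simp add: add.commute)
    qed (use s nn in \<open>auto intro: prod_nonneg\<close>)
    finally show ?thesis by (simp add: i power_add mult.commute)
  qed
qed

text \<open>
  The time 0 is vacuously hyperbolic, so there is always a last hyperbolic time up to \<open>j\<close>; by
  concatenation nothing hyperbolic follows it.
\<close>

lemma last_hyp_seq:
  assumes nn: "\<And>j. l j \<ge> 0" and s: "s \<ge> 0"
  obtains n where "n \<le> j" "hyp_seq s l n" "\<And>i. i \<in> {1..j - n} \<Longrightarrow> \<not> hyp_seq s (\<lambda>k. l (n + k)) i"
proof -
  let ?S = "{n. n \<le> j \<and> hyp_seq s l n}"
  have fin: "finite ?S" by auto
  have "0 \<in> ?S" by (auto simp: hyp_seq_def)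
  then have mx: "Max ?S \<in> ?S" using fin by (intro Max_in) auto
  have "\<not> hyp_seq s (\<lambda>k. l (Max ?S + k)) i" if i: "i \<in> {1..j - Max ?S}" for i
  proof
    assume "hyp_seq s (\<lambda>k. l (Max ?S + k)) i"
    then have "hyp_seq s l (Max ?S + i)" using mx hyp_seq_concat[of l s, OF nn s] by blast
    then have "Max ?S + i \<in> ?S" using i mx by auto
    then have "Max ?S + i \<le> Max ?S" using fin by (intro Max_ge)
    then show False using i by auto
  qed
  then show thesis using mx that by blast
qed

text \<open>
  The running minimum of \<open>t\<close> drops only at the indices counted here, by at most \<open>K\<close> each time.
\<close>

lemma pliss_records:
  fixes t :: "nat \<Rightarrow> real"
  assumes step: "\<And>i. t (Suc i) \<ge> t i - K" and K: "K \<ge> 0"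
  shows "real (card {i\<in>{1..n}. \<forall>j<i. t i \<le> t j}) * K \<ge> t 0 - t n"
proof -
  define R where "R n = {i\<in>{1..n}. \<forall>j<i. t i \<le> t j}" for n
  have "\<exists>j\<le>n. \<forall>i\<le>n. t j \<le> t i \<and> t 0 - t j \<le> real (card (R n)) * K" for n
  proof (induction n)
    case 0
    then show ?case by (auto simp: R_def)
  next
    case (Suc n)
    then obtain j where j: "j \<le> n" "\<And>i. i \<le> n \<Longrightarrow> t j \<le> t i"
      "t 0 - t j \<le> real (card (R n)) * K" by blast
    show ?case
    proof (cases "t (Suc n) \<le> t j")
      case True
      have "\<forall>i<Suc n. t (Suc n) \<le> t i"
        using True order_trans[OF True j(2)] by (auto simp: less_Suc_eq_le)
      then have "i \<in> R (Suc n) \<longleftrightarrow> i \<in> insert (Suc n) (R n)" for i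
        unfolding R_def by (cases "i = Suc n") auto
      then have "R (Suc n) = insert (Suc n) (R n)" by blast
      moreover have "Suc n \<notin> R n" "finite (R n)" by (auto simp: R_def)
      ultimately have "real (card (R (Suc n))) = real (card (R n)) + 1" by simp
      moreover have "t (Suc n) \<ge> t j - K" using step[of n] j(2)[of n] by auto
      ultimately have "t 0 - t (Suc n) \<le> real (card (R (Suc n))) * K"
        using j(3) by (simp only: distrib_right)
      moreover have "\<forall>i\<le>Suc n. t (Suc n) \<le> t i"
        using \<open>\<forall>i<Suc n. t (Suc n) \<le> t i\<close> by (auto simp: le_less)
      ultimately show ?thesis by blast
    next
      case False
      have "card (R n) \<le> card (R (Suc n))" by (rule card_mono) (auto simp: R_def)
      then have "real (card (R n)) * K \<le> real (card (R (Suc n))) * K"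
        using K by (intro mult_right_mono) auto
      moreover have "\<forall>i\<le>Suc n. t j \<le> t i"
        using False j(2) by (auto simp: le_Suc_eq)
      ultimately show ?thesis using j(1,3) by (meson le_SucI order_trans)
    qed
  qed
  then obtain j where "t j \<le> t n" "t 0 - t j \<le> real (card (R n)) * K" by blast
  then show ?thesis unfolding R_def by linarith
qed

text \<open>
  With \<open>t i\<close> the sum of \<open>ln (l j) + c\<close> over \<open>j < i\<close>, an index \<open>i\<close> is a hyperbolic time for the
  rate \<open>exp (- c)\<close> exactly when \<open>t i\<close> is a record minimum. Since \<open>t n \<le> - c * n\<close>, there are many
  records.
\<close>

lemma pliss:
  fixes l :: "nat \<Rightarrow> real"
  assumes pos: "\<And>j. exp (- K) \<le> l j" and K: "K > 0" and c: "c > 0"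
    and small: "(\<Sum>j<n. ln (l j)) \<le> - 2 * c * real n"
  shows "\<exists>H\<subseteq>{1..n}. (\<forall>i\<in>H. hyp_seq (exp (- c)) l i) \<and> real (card H) \<ge> c / K * real n"
proof -
  have lpos: "l j > 0" for j using pos[of j] exp_gt_zero[of "-K"] by linarith
  define t where "t i = (\<Sum>j<i. ln (l j)) + c * real i" for i
  define H where "H = {i\<in>{1..n}. \<forall>j<i. t i \<le> t j}"
  have "ln (l i) \<ge> - K" for i using pos[of i] lpos[of i] by (simp add: ln_ge_iff)
  then have "t (Suc i) \<ge> t i - K" for i
    using c by (smt (verit) t_def sum.lessThan_Suc of_nat_Suc mult_left_mono)
  then have "real (card H) * K \<ge> t 0 - t n" unfolding H_def by (rule pliss_records) (use K in auto)
  also have "t 0 - t n \<ge> c * real n" using small by (simp add: t_def)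
  finally have card: "real (card H) \<ge> c / K * real n" using K by (simp add: field_simps)
  have "hyp_seq (exp (- c)) l i" if i: "i \<in> H" for i
    unfolding hyp_seq_def
  proof
    fix k assume k: "k \<in> {1..i}"
    have "t i \<le> t (i - k)" using i k by (auto simp: H_def)
    moreover have "(\<Sum>j<i. ln (l j)) = (\<Sum>j<i - k. ln (l j)) + (\<Sum>j=i - k..<i. ln (l j))"
      using sum.atLeastLessThan_concat[of 0 "i-k" i "\<lambda>j. ln (l j)"] by (simp add: lessThan_atLeast0)
    ultimately have "(\<Sum>j=i - k..<i. ln (l j)) \<le> - c * real k"
      using k by (simp add: t_def of_nat_diff algebra_simps)
    then have "exp (\<Sum>j=i - k..<i. ln (l j)) \<le> exp (- c * real k)" by simp
    also have "exp (\<Sum>j=i - k..<i. ln (l j)) = (\<Prod>j=i - k..<i. l j)"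
      using lpos by (simp add: exp_sum)
    also have "exp (- c * real k) = exp (- c) ^ k" by (simp add: exp_of_nat_mult[symmetric] mult.commute)
    finally show "(\<Prod>j=i - k..<i. l j) \<le> exp (- c) ^ k" .
  qed
  then show ?thesis using card by (intro exI[of _ H]) (auto simp: H_def)
qed

text \<open>
  Read the sequence from left to right. At an index outside \<open>B\<close> jump over a block of slope at
  most \<open>\<beta>\<close>; at an index in \<open>B\<close> make one step, which costs at most \<open>K + \<bar>\<beta>\<bar>\<close> more than \<open>\<beta>\<close>. The
  last, incomplete block accounts for the term with \<open>L\<close>.
\<close>

lemma block_sum_le:
  fixes a :: "nat \<Rightarrow> real"
  assumes K: "\<And>i. a i \<le> K" "K \<ge> 0"
    and block: "\<And>j. j \<notin> B \<Longrightarrow> \<exists>k\<in>{1..L}. (\<Sum>i=j..<j + k. a i) \<le> \<beta> * real k"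
  shows "(\<Sum>i=s..<s + n. a i) \<le> \<beta> * real n + (K + \<bar>\<beta>\<bar>) * (real (card (B \<inter> {s..<s + n})) + real L)"
proof (induction n arbitrary: s rule: less_induct)
  case (less n)
  let ?C = "K + \<bar>\<beta>\<bar>"
  have C: "?C \<ge> 0" using K by auto
  show ?case
  proof (cases "n \<le> L")
    case True
    have "(\<Sum>i=s..<s + n. a i) \<le> (\<Sum>i=s..<s + n. K)" by (rule sum_mono) (use K in auto)
    also have "\<dots> = K * n" by simp
    also have "\<dots> \<le> \<beta> * real n + ?C * real n"
      using mult_right_mono[of 0 "\<beta> + \<bar>\<beta>\<bar>" "real n"] by (simp add: algebra_simps)
    also have "\<dots> \<le> \<beta> * real n + ?C * (real (card (B \<inter> {s..<s + n})) + real L)"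
      using True C by (intro add_left_mono mult_left_mono) auto
    finally show ?thesis .
  next
    case False
    show ?thesis
    proof (cases "s \<in> B")
      case True
      obtain n' where n': "n = Suc n'" using False by (cases n) auto
      have "B \<inter> {s..<s + n} = insert s (B \<inter> {Suc s..<Suc s + n'})" using True n' by auto
      then have "card (B \<inter> {s..<s + n}) = Suc (card (B \<inter> {Suc s..<Suc s + n'}))" by simp
      moreover have "(\<Sum>i=s..<s + n. a i) = a s + (\<Sum>i=Suc s..<Suc s + n'. a i)"
        using n' by (simp add: sum.atLeast_Suc_lessThan)
      moreover have "(\<Sum>i=Suc s..<Suc s + n'. a i) \<le> \<beta> * real n' + ?C * (real (card (B \<inter> {Suc s..<Suc s + n'})) + real L)"
        by (rule less.IH) (use n' in auto)
      moreover have "a s \<le> \<beta> + ?C" using K(1)[of s] by auto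
      ultimately show ?thesis using n' by (simp add: algebra_simps)
    next
      case nb: False
      then obtain k where k: "k \<in> {1..L}" "(\<Sum>i=s..<s + k. a i) \<le> \<beta> * real k" using block by blast
      define n' where "n' = n - k"
      have n': "n = k + n'" "n' < n" using k False by (auto simp: n'_def)
      have "(\<Sum>i=s..<s + n. a i) = (\<Sum>i=s..<s + k. a i) + (\<Sum>i=s + k..<s + k + n'. a i)"
        using n' sum.atLeastLessThan_concat[of s "s+k" "s+n" a] by (simp add: add.assoc)
      moreover have "(\<Sum>i=s + k..<s + k + n'. a i) \<le> \<beta> * real n' + ?C * (real (card (B \<inter> {s + k..<s + k + n'})) + real L)"
        by (rule less.IH) (use n' in auto)
      moreover have "card (B \<inter> {s + k..<s + k + n'}) \<le> card (B \<inter> {s..<s + n})"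
        by (rule card_mono) (use n' in auto)
      then have "?C * (real (card (B \<inter> {s + k..<s + k + n'})) + real L) \<le> ?C * (real (card (B \<inter> {s..<s + n})) + real L)"
        using C by (intro mult_left_mono) auto
      ultimately show ?thesis using k n' by (simp add: algebra_simps)
    qed
  qed
qed

text \<open>
  The same sum is estimated from above by low blocks and from below by high blocks.
\<close>

lemma block_contradiction:
  fixes a :: "nat \<Rightarrow> real"
  assumes K: "\<And>i. \<bar>a i\<bar> \<le> K" "K \<ge> 0"
    and low: "\<And>j. j \<notin> B \<Longrightarrow> \<exists>k\<in>{1..L}. (\<Sum>i=j..<j + k. a i) \<le> \<gamma> * real k"
    and high: "\<And>j. j \<notin> B' \<Longrightarrow> \<exists>k\<in>{1..L}. (\<Sum>i=j..<j + k. a i) \<ge> \<beta> * real k"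
  shows "(\<beta> - \<gamma>) * real n \<le> (K + \<bar>\<beta>\<bar> + \<bar>\<gamma>\<bar>) * (real (card (B \<inter> {..<n})) + real (card (B' \<inter> {..<n})) + 2 * real L)"
proof -
  have 1: "(\<Sum>i=0..<0 + n. a i) \<le> \<gamma> * real n + (K + \<bar>\<gamma>\<bar>) * (real (card (B \<inter> {0..<0 + n})) + real L)"
    by (rule block_sum_le) (use K low in \<open>auto simp: abs_le_iff\<close>)
  have 2: "(\<Sum>i=0..<0 + n. - a i) \<le> (- \<beta>) * real n + (K + \<bar>- \<beta>\<bar>) * (real (card (B' \<inter> {0..<0 + n})) + real L)"
  proof (rule block_sum_le)
    fix i show "- a i \<le> K" using K(1)[of i] by auto
  next
    fix j assume "j \<notin> B'"
    then show "\<exists>k\<in>{1..L}. (\<Sum>i=j..<j + k. - a i) \<le> (- \<beta>) * real k"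
      using high[of j] by (auto simp: sum_negf)
  qed (use K in auto)
  have 3: "(\<beta> - \<gamma>) * real n \<le> (K + \<bar>\<gamma>\<bar>) * (real (card (B \<inter> {..<n})) + real L) + (K + \<bar>\<beta>\<bar>) * (real (card (B' \<inter> {..<n})) + real L)"
    using 1 2 by (simp add: sum_negf lessThan_atLeast0 algebra_simps)
  have "(K + \<bar>\<gamma>\<bar>) * (real (card (B \<inter> {..<n})) + real L) \<le> (K + \<bar>\<beta>\<bar> + \<bar>\<gamma>\<bar>) * (real (card (B \<inter> {..<n})) + real L)"
    "(K + \<bar>\<beta>\<bar>) * (real (card (B' \<inter> {..<n})) + real L) \<le> (K + \<bar>\<beta>\<bar> + \<bar>\<gamma>\<bar>) * (real (card (B' \<inter> {..<n})) + real L)"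
    by (auto intro!: mult_right_mono)
  with 3 have "(\<beta> - \<gamma>) * real n \<le> (K + \<bar>\<beta>\<bar> + \<bar>\<gamma>\<bar>) * (real (card (B \<inter> {..<n})) + real L)
      + (K + \<bar>\<beta>\<bar> + \<bar>\<gamma>\<bar>) * (real (card (B' \<inter> {..<n})) + real L)" by linarith
  then show ?thesis by (simp add: distrib_left[symmetric] add.assoc add.left_commute add.commute)
qed

section \<open>Birkhoff sums under a uniform domination\<close>

definition preim :: "'a measure \<Rightarrow> ('a \<Rightarrow> 'a) \<Rightarrow> nat \<Rightarrow> 'a set \<Rightarrow> 'a set" where
  "preim m T j E = (T ^^ j) -` E \<inter> space m"

definition birkhoff_sum :: "('a \<Rightarrow> 'a) \<Rightarrow> ('a \<Rightarrow> real) \<Rightarrow> nat \<Rightarrow> 'a \<Rightarrow> real" where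
  "birkhoff_sum T a n x = (\<Sum>i<n. a ((T ^^ i) x))"

lemma measurable_iterate:
  assumes "T \<in> measurable m m"
  shows "(T ^^ j) \<in> measurable m m"
  using assms by (induction j) auto

lemma preim_sets:
  assumes "T \<in> measurable m m" "E \<in> sets m"
  shows "preim m T j E \<in> sets m"
  unfolding preim_def using measurable_sets[OF measurable_iterate[OF assms(1)] assms(2)] .

lemma iterate_space:
  assumes "T \<in> measurable m m" "x \<in> space m"
  shows "(T ^^ j) x \<in> space m"
  using measurable_space[OF measurable_iterate[OF assms(1)] assms(2)] .

lemma birkhoff_sum_iterate:
  "birkhoff_sum T a k ((T ^^ j) x) = (\<Sum>i=j..<j + k. a ((T ^^ i) x))"
proof -
  have "(\<Sum>i=j..<j + k. a ((T ^^ i) x)) = (\<Sum>i=0 + j..<k + j. a ((T ^^ i) x))"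
    by (simp add: add.commute)
  also have "\<dots> = (\<Sum>i=0..<k. a ((T ^^ (i + j)) x))" by (rule sum.shift_bounds_nat_ivl)
  finally show ?thesis by (simp add: birkhoff_sum_def funpow_add lessThan_atLeast0)
qed

text \<open>
  A uniform form of absolute continuity of the images of \<open>m\<close> under all iterates of \<open>T\<close>. In the
  ergodic argument it plays the part that invariance of the measure has in the ergodic theorem.
\<close>

definition uniformly_small_preimages :: "'a measure \<Rightarrow> ('a \<Rightarrow> 'a) \<Rightarrow> bool" where
  "uniformly_small_preimages m T \<longleftrightarrow> (\<forall>E :: nat \<Rightarrow> 'a set.
     (\<forall>L. E L \<in> sets m) \<longrightarrow> decseq E \<longrightarrow> (AE x in m. \<forall>i. (T ^^ i) x \<notin> (\<Inter>L. E L)) \<longrightarrow>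
     (\<forall>\<eta>>0. \<exists>L. \<forall>j. measure m (preim m T j (E L)) \<le> \<eta>))"

text \<open>
  The right hand side of the domination increases to a finite measure of \<open>E\<close>: its tail is bounded
  by the tail of the convergent series of the measures of \<open>G i\<close>, and each of the finitely many
  other terms tends to 0 along the sequence of sets.
\<close>

lemma dominated_imp_uniformly_small:
  assumes fin: "finite_measure m" and T: "T \<in> measurable m m"
    and G: "\<And>i. G i \<in> sets m" and sG: "summable (\<lambda>i. measure m (G i))" and C: "C > 0"
    and dom: "\<And>j E. E \<in> sets m \<Longrightarrow>
      measure m (preim m T j E) \<le> C * (\<Sum>i\<le>j. measure m (G i \<inter> preim m T i E))"
  shows "uniformly_small_preimages m T"
  unfolding uniformly_small_preimages_def
proof (intro allI impI)
  fix E :: "nat \<Rightarrow> 'a set" and \<eta> :: real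
  assume E: "\<forall>L. E L \<in> sets m" and dec: "decseq E"
    and null: "AE x in m. \<forall>i. (T ^^ i) x \<notin> (\<Inter>L. E L)" and \<eta>: "\<eta> > 0"
  interpret finite_measure m by fact
  define \<epsilon> where "\<epsilon> = \<eta> / C / 2"
  have \<epsilon>: "\<epsilon> > 0" using \<eta> C by (simp add: \<epsilon>_def)
  obtain N where N: "\<And>n. n \<ge> N \<Longrightarrow> norm (\<Sum>i. measure m (G (i + n))) < \<epsilon>"
    using suminf_exist_split[OF \<epsilon> sG] by blast
  have lim: "(\<lambda>L. measure m (preim m T i (E L))) \<longlonglongrightarrow> 0" for i
  proof -
    have "(\<lambda>L. measure m (preim m T i (E L))) \<longlonglongrightarrow> measure m (\<Inter>L. preim m T i (E L))"
    proof (rule finite_Lim_measure_decseq)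
      show "range (\<lambda>L. preim m T i (E L)) \<subseteq> sets m" using preim_sets[OF T] E by auto
      show "decseq (\<lambda>L. preim m T i (E L))" using dec unfolding decseq_def preim_def by blast
    qed
    moreover have "AE x in m. x \<notin> (\<Inter>L. preim m T i (E L))"
      using null by eventually_elim (auto simp: preim_def)
    then have "measure m (\<Inter>L. preim m T i (E L)) = 0"
      using preim_sets[OF T] E
      by (subst measure_eq_0_null_sets) (auto simp: AE_iff_null_sets)
    ultimately show ?thesis by simp
  qed
  have "(\<lambda>L. \<Sum>i<N. measure m (preim m T i (E L))) \<longlonglongrightarrow> (\<Sum>i<N. 0)"
    by (intro tendsto_sum lim)
  then have "\<forall>\<^sub>F L in sequentially. (\<Sum>i<N. measure m (preim m T i (E L))) < \<epsilon>"
    using \<epsilon> by (intro order_tendstoD(2)) auto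
  then obtain L where L: "(\<Sum>i<N. measure m (preim m T i (E L))) < \<epsilon>"
    by (auto simp: eventually_sequentially)
  have "measure m (preim m T j (E L)) \<le> \<eta>" for j
  proof -
    have "(\<Sum>i\<le>j. measure m (G i \<inter> preim m T i (E L))) \<le> (\<Sum>i<N + Suc j. measure m (G i \<inter> preim m T i (E L)))"
      by (rule sum_mono2) auto
    also have "\<dots> = (\<Sum>i<N. measure m (G i \<inter> preim m T i (E L))) + (\<Sum>i<Suc j. measure m (G (i + N) \<inter> preim m T (i + N) (E L)))"
      using sum.atLeastLessThan_concat[of 0 N "N + Suc j" "\<lambda>i. measure m (G i \<inter> preim m T i (E L))"]
        sum.shift_bounds_nat_ivl[of "\<lambda>i. measure m (G i \<inter> preim m T i (E L))" 0 N "Suc j"]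
      by (simp add: lessThan_atLeast0 add.commute del: sum.op_ivl_Suc)
    also have "(\<Sum>i<N. measure m (G i \<inter> preim m T i (E L))) \<le> (\<Sum>i<N. measure m (preim m T i (E L)))"
      by (intro sum_mono finite_measure_mono) (use preim_sets[OF T] E in auto)
    also have "(\<Sum>i<Suc j. measure m (G (i + N) \<inter> preim m T (i + N) (E L))) \<le> (\<Sum>i<Suc j. measure m (G (i + N)))"
      by (intro sum_mono finite_measure_mono) (use G in auto)
    also have "\<dots> \<le> (\<Sum>i. measure m (G (i + N)))"
      by (intro sum_le_suminf) (use sG in \<open>auto simp: summable_iff_shift[of "\<lambda>i. measure m (G i)"]\<close>)
    also have "\<dots> \<le> \<epsilon>" using N[of N] by auto
    finally have "(\<Sum>i\<le>j. measure m (G i \<inter> preim m T i (E L))) \<le> 2 * \<epsilon>" using L by simp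
    then have "C * (\<Sum>i\<le>j. measure m (G i \<inter> preim m T i (E L))) \<le> C * (2 * \<epsilon>)"
      using C by (intro mult_left_mono) auto
    moreover have "C * (2 * \<epsilon>) = \<eta>" using C by (simp add: \<epsilon>_def)
    ultimately show ?thesis using dom[of "E L" j] E by auto
  qed
  then show "\<exists>L. \<forall>j. measure m (preim m T j (E L)) \<le> \<eta>" by blast
qed

lemma sum_indicator_iterate:
  "(\<Sum>j<n. indicator E ((T ^^ j) x)) = real (card ({j. (T ^^ j) x \<in> E} \<inter> {..<n}))"
  by (simp add: indicator_def if_distrib sum.If_cases Collect_conj_eq Int_commute)

lemma integral_sum_indicator_iterate:
  assumes fin: "finite_measure m" and T: "T \<in> measurable m m" and E: "E \<in> sets m"
  shows "integrable m (\<lambda>x. \<Sum>j<n. indicator E ((T ^^ j) x) :: real)"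
    and "(\<integral>x. (\<Sum>j<n. indicator E ((T ^^ j) x) :: real) \<partial>m) = (\<Sum>j<n. measure m (preim m T j E))"
proof -
  interpret finite_measure m by fact
  have eq: "indicator E ((T ^^ j) x) = (indicator (preim m T j E) x :: real)" if "x \<in> space m" for j x
    using that by (auto simp: preim_def indicator_def)
  have int: "integrable m (\<lambda>x. indicator E ((T ^^ j) x) :: real)" for j
    by (subst Bochner_Integration.integrable_cong[OF refl eq])
       (use preim_sets[OF T E] in \<open>auto simp: emeasure_eq_measure\<close>)
  show "integrable m (\<lambda>x. \<Sum>j<n. indicator E ((T ^^ j) x) :: real)" using int by auto
  have "(\<integral>x. indicator E ((T ^^ j) x) \<partial>m) = measure m (preim m T j E)" for j
    by (subst Bochner_Integration.integral_cong[OF refl eq]) (use preim_sets[OF T E] in auto)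
  then show "(\<integral>x. (\<Sum>j<n. indicator E ((T ^^ j) x) :: real) \<partial>m) = (\<Sum>j<n. measure m (preim m T j E))"
    using int by (simp add: Bochner_Integration.integral_sum)
qed

text \<open>
  Let \<open>D\<close> be the set where the sums exceed \<open>\<beta> * n\<close> by arbitrarily large amounts. It is mapped
  into itself, and every point of it starts a block of slope at least \<open>\<beta>\<close>, while almost every
  point starts a block of slope at most \<open>\<gamma>\<close>. The sets \<open>E L\<close> and \<open>E' L\<close> of points without such
  blocks of length up to \<open>L\<close> shrink to null sets, so for large \<open>L\<close> orbits visit them with small
  frequency in the mean. Integrating \<open>block_contradiction\<close> over \<open>D\<close> bounds \<open>(\<beta> - \<gamma>) * measure m D\<close>
  by half of itself plus a term of order \<open>1 / n\<close>, so \<open>D\<close> is null.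
\<close>

lemma birkhoff_upper_bound:
  fixes a :: "'a \<Rightarrow> real"
  assumes fin: "finite_measure m" and T: "T \<in> measurable m m"
    and small: "uniformly_small_preimages m T"
    and a: "a \<in> borel_measurable m" and K: "\<And>x. x \<in> space m \<Longrightarrow> \<bar>a x\<bar> \<le> K"
    and low: "AE x in m. \<forall>i. \<exists>k\<ge>1. birkhoff_sum T a k ((T ^^ i) x) \<le> \<gamma> * real k"
    and less: "\<gamma> < \<beta>"
  shows "AE x in m. \<exists>C. \<forall>n. birkhoff_sum T a n x \<le> \<beta> * real n + C"
proof -
  interpret finite_measure m by fact
  let ?S = "birkhoff_sum T a"
  have S[measurable]: "?S n \<in> borel_measurable m" for n
    unfolding birkhoff_sum_def
    by (intro borel_measurable_sum measurable_compose[OF measurable_iterate[OF T] a])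
  define D where "D = {x\<in>space m. \<forall>C::nat. \<exists>n. ?S n x > \<beta> * real n + real C}"
  define E where "E L = {x\<in>space m. \<forall>k\<in>{1..L}. ?S k x > \<gamma> * real k}" for L
  define E' where "E' L = {x\<in>D. \<forall>k\<in>{1..L}. ?S k x < \<beta> * real k}" for L
  have D: "D \<in> sets m" unfolding D_def by measurable
  have E: "E L \<in> sets m" for L unfolding E_def by measurable
  have "E' L = D \<inter> {x\<in>space m. \<forall>k\<in>{1..L}. ?S k x < \<beta> * real k}" for L
    using sets.sets_into_space[OF D] by (auto simp: E'_def)
  moreover have "{x\<in>space m. \<forall>k\<in>{1..L}. ?S k x < \<beta> * real k} \<in> sets m" for L by measurable
  ultimately have E': "E' L \<in> sets m" for L using D by auto
  have invD: "T x \<in> D" if x: "x \<in> D" for x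
  proof -
    have sp: "x \<in> space m" using x by (auto simp: D_def)
    have "\<exists>n. ?S n (T x) > \<beta> * real n + real C" for C :: nat
    proof -
      obtain C' :: nat where C': "real C' \<ge> real C + \<bar>\<beta>\<bar> + K"
        using real_arch_simple by blast
      obtain n where n: "?S n x > \<beta> * real n + real C'" using x by (auto simp: D_def)
      have K0: "K \<ge> 0" using K[OF sp] by linarith
      have "n \<noteq> 0" using n C' K0 by (intro notI) (auto simp: birkhoff_sum_def)
      then obtain n' where n': "n = Suc n'" by (cases n) auto
      have "?S n x = a x + ?S n' (T x)"
        unfolding birkhoff_sum_def n' by (simp add: sum.lessThan_Suc_shift funpow_swap1 del: sum.lessThan_Suc)
      then have "?S n' (T x) > \<beta> * real n + real C' - K" using n K[OF sp] by auto
      moreover have "\<beta> * real n + real C' - K \<ge> \<beta> * real n' + real C"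
        using C' n' by (simp add: algebra_simps)
      ultimately show ?thesis by (intro exI[of _ n']) linarith
    qed
    then show ?thesis using measurable_space[OF T sp] by (auto simp: D_def)
  qed
  have iterD: "(T ^^ j) x \<in> D" if "x \<in> D" for x j
    using that by (induction j) (auto intro: invD)
  have mono: "decseq E" "decseq E'" unfolding decseq_def E_def E'_def by auto
  have nE: "AE x in m. \<forall>i. (T ^^ i) x \<notin> (\<Inter>L. E L)"
    using low
  proof eventually_elim
    case (elim x)
    show ?case
    proof
      fix i
      obtain k where k: "k \<ge> 1" "?S k ((T ^^ i) x) \<le> \<gamma> * real k" using elim by blast
      then have "(T ^^ i) x \<notin> E k" by (auto simp: E_def not_less)
      then show "(T ^^ i) x \<notin> (\<Inter>L. E L)" by blast
    qed
  qed
  have nE': "AE x in m. \<forall>i. (T ^^ i) x \<notin> (\<Inter>L. E' L)"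
  proof (rule AE_I2, rule allI)
    fix x i
    show "(T ^^ i) x \<notin> (\<Inter>L. E' L)"
    proof
      assume in_E': "(T ^^ i) x \<in> (\<Inter>L. E' L)"
      then have "(T ^^ i) x \<in> D" by (auto simp: E'_def)
      then obtain k where k: "?S k ((T ^^ i) x) > \<beta> * real k + real (0::nat)" unfolding D_def by blast
      then have "k \<noteq> 0" by (intro notI) (simp add: birkhoff_sum_def)
      then have "(T ^^ i) x \<notin> E' k" using k by (auto simp: E'_def intro!: bexI[of _ k])
      then show False using in_E' by blast
    qed
  qed
  have "measure m D = 0"
  proof (rule ccontr)
    assume "measure m D \<noteq> 0"
    then have mD: "measure m D > 0" by (simp add: zero_less_measure_iff)
    then have "D \<noteq> {}" by auto
    then have K0: "K \<ge> 0" using K unfolding D_def by fastforce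
    define Q where "Q = K + \<bar>\<beta>\<bar> + \<bar>\<gamma>\<bar>"
    have Q: "Q > 0" using K0 less by (auto simp: Q_def)
    \<comment> \<open>With this choice the bad visits use up half of the left hand side of \<open>bd\<close> below.\<close>
    define \<eta> where "\<eta> = (\<beta> - \<gamma>) * measure m D / (4 * Q)"
    have \<eta>: "\<eta> > 0" using mD less Q by (simp add: \<eta>_def)
    obtain L1 where L1: "\<And>j. measure m (preim m T j (E L1)) \<le> \<eta>"
      using small E mono nE \<eta> unfolding uniformly_small_preimages_def by blast
    obtain L2 where L2: "\<And>j. measure m (preim m T j (E' L2)) \<le> \<eta>"
      using small E' mono nE' \<eta> unfolding uniformly_small_preimages_def by blast
    define L where "L = max L1 L2"
    have bd: "(\<beta> - \<gamma>) * real n * measure m D \<le> Q * (2 * real n * \<eta> + 2 * real L * measure m (space m))" for n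
    proof -
      let ?c = "\<lambda>x. (\<Sum>j<n. indicator (E L1) ((T ^^ j) x)) :: real"
      let ?c' = "\<lambda>x. (\<Sum>j<n. indicator (E' L2) ((T ^^ j) x)) :: real"
      note int = integral_sum_indicator_iterate[OF fin T E[of L1], of n] integral_sum_indicator_iterate[OF fin T E'[of L2], of n]
      have pt: "(\<beta> - \<gamma>) * real n * indicator D x \<le> Q * (?c x + ?c' x + 2 * real L)" if x: "x \<in> space m" for x
      proof (cases "x \<in> D")
        case False
        then show ?thesis using Q by (auto intro!: mult_nonneg_nonneg add_nonneg_nonneg sum_nonneg)
      next
        case True
        have "(\<beta> - \<gamma>) * real n \<le> (K + \<bar>\<beta>\<bar> + \<bar>\<gamma>\<bar>) *
            (real (card ({j. (T ^^ j) x \<in> E L1} \<inter> {..<n})) + real (card ({j. (T ^^ j) x \<in> E' L2} \<inter> {..<n})) + 2 * real L)"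
        proof (rule block_contradiction[where a = "\<lambda>i. a ((T ^^ i) x)"])
          fix j assume "j \<notin> {j. (T ^^ j) x \<in> E L1}"
          then obtain k where "k \<in> {1..L1}" "?S k ((T ^^ j) x) \<le> \<gamma> * real k"
            using iterate_space[OF T x, of j] by (auto simp: E_def not_less)
          then show "\<exists>k\<in>{1..L}. (\<Sum>i=j..<j + k. a ((T ^^ i) x)) \<le> \<gamma> * real k"
            unfolding birkhoff_sum_iterate by (auto simp: L_def intro!: bexI[of _ k])
        next
          fix j assume "j \<notin> {j. (T ^^ j) x \<in> E' L2}"
          then obtain k where "k \<in> {1..L2}" "?S k ((T ^^ j) x) \<ge> \<beta> * real k"
            using iterD[OF True, of j] by (auto simp: E'_def not_less)
          then show "\<exists>k\<in>{1..L}. (\<Sum>i=j..<j + k. a ((T ^^ i) x)) \<ge> \<beta> * real k"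
            unfolding birkhoff_sum_iterate by (auto simp: L_def intro!: bexI[of _ k])
        qed (use K iterate_space[OF T x] K0 in auto)
        then show ?thesis using True by (simp add: Q_def sum_indicator_iterate)
      qed
      have "(\<integral>x. (\<beta> - \<gamma>) * real n * indicator D x \<partial>m) \<le> (\<integral>x. Q * (?c x + ?c' x + 2 * real L) \<partial>m)"
        by (rule integral_mono) (use D int pt in \<open>auto simp: emeasure_eq_measure\<close>)
      also have "\<dots> = Q * ((\<Sum>j<n. measure m (preim m T j (E L1))) + (\<Sum>j<n. measure m (preim m T j (E' L2))) + 2 * real L * measure m (space m))"
        using int by (simp add: Bochner_Integration.integral_add)
      also have "\<dots> \<le> Q * ((\<Sum>j<n. \<eta>) + (\<Sum>j<n. \<eta>) + 2 * real L * measure m (space m))"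
        using Q L1 L2 by (intro mult_left_mono add_mono sum_mono) auto
      finally show ?thesis using D by (simp add: mult.assoc mult.commute[of \<eta>])
    qed
    obtain n :: nat where n: "real n > 4 * Q * real L * measure m (space m) / ((\<beta> - \<gamma>) * measure m D)"
      using reals_Archimedean2 by blast
    have "Q * (2 * real n * \<eta>) = (\<beta> - \<gamma>) * real n * measure m D / 2"
      using Q by (simp add: \<eta>_def)
    then have "(\<beta> - \<gamma>) * real n * measure m D \<le> 4 * Q * real L * measure m (space m)"
      using bd[of n] by (simp add: algebra_simps)
    moreover have "real n * ((\<beta> - \<gamma>) * measure m D) > 4 * Q * real L * measure m (space m)"
      using n mD less by (subst (asm) divide_less_eq) auto
    ultimately show False by (simp add: algebra_simps)
  qed
  then have "D \<in> null_sets m" using D by (simp add: emeasure_eq_measure null_setsI)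
  then have "AE x in m. x \<notin> D" by (rule AE_not_in)
  then show ?thesis
    using AE_space
  proof eventually_elim
    case (elim x)
    then obtain C :: nat where "\<And>n. ?S n x \<le> \<beta> * real n + real C" by (auto simp: D_def not_less)
    then show ?case by blast
  qed
qed

text \<open>
  If the image at every hyperbolic time has a further hyperbolic time, the chain never stops.
\<close>

lemma infinitely_many_hyp_seq:
  assumes nn: "\<And>j. l j \<ge> 0" and s: "s \<ge> 0"
    and next_time: "\<And>n. hyp_seq s l n \<Longrightarrow> \<exists>k\<ge>1. hyp_seq s (\<lambda>j. l (n + j)) k"
  shows "\<exists>n>i. hyp_seq s l n"
proof (induction i)
  case 0
  have "hyp_seq s l 0" by (simp add: hyp_seq_def)
  from next_time[OF this] obtain k where "k \<ge> 1" "hyp_seq s l k" by auto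
  then show ?case by (intro exI[of _ k]) auto
next
  case (Suc i)
  then obtain n where n: "n > i" "hyp_seq s l n" by blast
  from next_time[OF n(2)] obtain k where k: "k \<ge> 1" "hyp_seq s (\<lambda>j. l (n + j)) k" by blast
  have "hyp_seq s l (n + k)" by (rule hyp_seq_concat[OF nn s n(2) k(2)])
  moreover have "n + k > Suc i" using n k by simp
  ultimately show ?case by blast
qed

lemma hyp_seq_iterate:
  "hyp_seq s (\<lambda>j. lam ((T ^^ j) ((T ^^ n) x))) k \<longleftrightarrow> hyp_seq s (\<lambda>j. lam ((T ^^ (n + j)) x)) k"
  by (simp add: funpow_add add.commute)

lemma hyp_seq_sets:
  assumes T: "T \<in> measurable m m" and lam: "lam \<in> borel_measurable m"
  shows "{x\<in>space m. hyp_seq s (\<lambda>j. lam ((T ^^ j) x)) n} \<in> sets m"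
proof -
  have [measurable]: "(\<lambda>x. \<Prod>j = n - k..<n. lam ((T ^^ j) x)) \<in> borel_measurable m" for k
    by (intro borel_measurable_prod measurable_compose[OF measurable_iterate[OF T] lam])
  show ?thesis unfolding hyp_seq_def by measurable
qed

text \<open>
  The measure-theoretic half of the proof, for any function \<open>lam\<close> in place of the norm of the
  inverse derivative. The hypothesis \<open>dom\<close> is what the smooth dynamics has to supply. It also
  makes null sets harmless: the points that arrive, at a hyperbolic time, in the null set of
  points without hyperbolic times form a null set.
\<close>

theorem positive_frequency_of_hyperbolic_times:
  fixes lam :: "'a \<Rightarrow> real" and T :: "'a \<Rightarrow> 'a"
  defines "hyp \<equiv> \<lambda>s x n. hyp_seq s (\<lambda>j. lam ((T ^^ j) x)) n"
  assumes fin: "finite_measure m" and T: "T \<in> measurable m m"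
    and lam: "lam \<in> borel_measurable m"
    and c: "0 < c1" "\<And>x. x \<in> space m \<Longrightarrow> c1 \<le> lam x" "\<And>x. x \<in> space m \<Longrightarrow> lam x \<le> c2"
    and \<sigma>: "0 < \<sigma>" "\<sigma> < 1"
    and dom: "\<And>n E. n \<ge> 1 \<Longrightarrow> E \<in> sets m \<Longrightarrow>
        measure m {x\<in>space m. hyp \<sigma> x n \<and> (T ^^ n) x \<in> E} \<le> C * measure m E"
    and ex: "AE x in m. \<exists>n\<ge>1. hyp \<sigma> x n"
    and int: "integrable m (\<lambda>x. real (LEAST n. n \<ge> 1 \<and> hyp \<sigma> x n))"
  shows "\<exists>\<sigma>' \<theta>. 0 < \<sigma>' \<and> \<sigma>' < 1 \<and> 0 < \<theta> \<and>
           (AE x in m. \<forall>\<^sub>F n in sequentially.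
              \<exists>H\<subseteq>{1..n}. (\<forall>i\<in>H. hyp \<sigma>' x i) \<and> real (card H) \<ge> \<theta> * real n)"
proof -
  interpret finite_measure m by fact
  have sp: "(T ^^ j) x \<in> space m" if "x \<in> space m" for j x by (rule iterate_space[OF T that])
  have pos: "lam ((T ^^ j) x) > 0" if "x \<in> space m" for j x using c(1) c(2)[OF sp[OF that]] by (rule less_le_trans)
  have nn: "lam ((T ^^ j) x) \<ge> 0" if "x \<in> space m" for j x using pos[OF that] by (rule less_imp_le)
  have H[measurable]: "{x\<in>space m. hyp \<sigma> x n} \<in> sets m" for n
    unfolding hyp_def by (rule hyp_seq_sets[OF T lam])
  have shift: "hyp \<sigma> ((T ^^ n) x) k \<longleftrightarrow> hyp_seq \<sigma> (\<lambda>j. lam ((T ^^ (n + j)) x)) k" for n x k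
    unfolding hyp_def by (rule hyp_seq_iterate)
  \<comment> \<open>Up to a null set \<open>G i\<close> is the set where the first hyperbolic time exceeds \<open>i\<close>, so that
    the sum of the measures is the integral of the first hyperbolic time.\<close>
  define G where "G i = {x\<in>space m. \<forall>n\<in>{1..i}. \<not> hyp \<sigma> x n}" for i
  have G: "G i \<in> sets m" for i unfolding G_def by measurable
  define C' where "C' = max C 1"
  have C': "C' > 0" by (simp add: C'_def)
  have dom0: "measure m {x\<in>space m. hyp \<sigma> x n \<and> (T ^^ n) x \<in> E} \<le> C' * measure m E" if E: "E \<in> sets m" for n E
  proof (cases "n = 0")
    case True
    then have "{x\<in>space m. hyp \<sigma> x n \<and> (T ^^ n) x \<in> E} = E"
      using sets.sets_into_space[OF E] by (auto simp: hyp_def hyp_seq_def)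
    moreover have "1 * measure m E \<le> C' * measure m E" by (rule mult_right_mono) (auto simp: C'_def)
    ultimately show ?thesis by simp
  next
    case False
    then have "measure m {x\<in>space m. hyp \<sigma> x n \<and> (T ^^ n) x \<in> E} \<le> C * measure m E"
      using dom E by simp
    also have "\<dots> \<le> C' * measure m E" by (rule mult_right_mono) (auto simp: C'_def)
    finally show ?thesis .
  qed
  have small: "uniformly_small_preimages m T"
  proof (rule dominated_imp_uniformly_small[OF fin T G _ C'])
    show "summable (\<lambda>i. measure m (G i))"
    proof (rule summableI_nonneg_bounded)
      fix N
      let ?h = "\<lambda>x. real (LEAST n. n \<ge> 1 \<and> hyp \<sigma> x n)"
      have "(\<Sum>i<N. measure m (G i)) = (\<integral>x. (\<Sum>i<N. indicator (G i) x) \<partial>m)"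
        using G by (simp add: Bochner_Integration.integral_sum emeasure_eq_measure)
      also have "\<dots> \<le> (\<integral>x. ?h x \<partial>m)"
      proof (rule integral_mono_AE)
        show "integrable m (\<lambda>x. \<Sum>i<N. indicator (G i) x :: real)"
          using G by (auto simp: emeasure_eq_measure)
        show "AE x in m. (\<Sum>i<N. indicator (G i) x) \<le> ?h x"
          using ex
        proof eventually_elim
          case (elim x)
          then have L: "(LEAST n. n \<ge> 1 \<and> hyp \<sigma> x n) \<ge> 1 \<and> hyp \<sigma> x (LEAST n. n \<ge> 1 \<and> hyp \<sigma> x n)"
            by (metis (mono_tags, lifting) LeastI)
          have "(\<Sum>i<N. indicator (G i) x) = real (card ({i. x \<in> G i} \<inter> {..<N}))"
            by (simp add: indicator_def if_distrib sum.If_cases Int_commute)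
          also have "card ({i. x \<in> G i} \<inter> {..<N}) \<le> card {..<LEAST n. n \<ge> 1 \<and> hyp \<sigma> x n}"
          proof (rule card_mono)
            show "{i. x \<in> G i} \<inter> {..<N} \<subseteq> {..<LEAST n. n \<ge> 1 \<and> hyp \<sigma> x n}"
              using L by (auto simp: G_def not_le[symmetric])
          qed auto
          finally show ?case by simp
        qed
      qed (rule int)
      finally show "(\<Sum>i<N. measure m (G i)) \<le> (\<integral>x. ?h x \<partial>m)" .
    qed auto
  next
    fix j E assume E: "E \<in> sets m"
    let ?F = "\<lambda>i. G i \<inter> preim m T i E"
    let ?X = "\<lambda>n. {x\<in>space m. hyp \<sigma> x n \<and> (T ^^ n) x \<in> ?F (j - n)}"
    have F: "?F i \<in> sets m" for i using G preim_sets[OF T E] by auto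
    have X: "?X n \<in> sets m" for n
    proof -
      have "?X n = {x\<in>space m. hyp \<sigma> x n} \<inter> preim m T n (?F (j - n))" by (auto simp: preim_def)
      then show ?thesis using H preim_sets[OF T F] by auto
    qed
    \<comment> \<open>Sort the points by their last hyperbolic time \<open>n\<close> up to \<open>j\<close>.\<close>
    have "preim m T j E \<subseteq> (\<Union>n\<in>{..j}. ?X n)"
    proof
      fix x assume x: "x \<in> preim m T j E"
      then have xs: "x \<in> space m" by (auto simp: preim_def)
      obtain n where n: "n \<le> j" "hyp_seq \<sigma> (\<lambda>j. lam ((T ^^ j) x)) n"
        "\<And>i. i \<in> {1..j - n} \<Longrightarrow> \<not> hyp_seq \<sigma> (\<lambda>k. lam ((T ^^ (n + k)) x)) i"
        using last_hyp_seq[of "\<lambda>j. lam ((T ^^ j) x)" \<sigma> j] nn[OF xs] \<sigma> by (metis less_imp_le)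
      have "(T ^^ (j - n)) ((T ^^ n) x) = (T ^^ j) x"
        using n(1) by (metis comp_apply funpow_add le_add_diff_inverse2)
      then have "(T ^^ n) x \<in> ?F (j - n)"
        using n(3) x sp[OF xs, of n] by (auto simp: G_def preim_def shift)
      then have "x \<in> ?X n" using n xs by (auto simp: hyp_def)
      then show "x \<in> (\<Union>n\<in>{..j}. ?X n)" using n by blast
    qed
    then have "measure m (preim m T j E) \<le> measure m (\<Union>n\<in>{..j}. ?X n)"
      using X by (intro finite_measure_mono) auto
    also have "\<dots> \<le> (\<Sum>n\<le>j. measure m (?X n))"
      using X by (intro measure_UNION_le) auto
    also have "\<dots> \<le> (\<Sum>n\<le>j. C' * measure m (?F (j - n)))"
      by (intro sum_mono dom0 F)
    also have "\<dots> = C' * (\<Sum>i\<le>j. measure m (?F i))"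
      unfolding sum_distrib_left
      by (rule sum.reindex_bij_witness[of _ "\<lambda>i. j - i" "\<lambda>i. j - i"]) auto
    finally show "measure m (preim m T j E) \<le> C' * (\<Sum>i\<le>j. measure m (?F i))" .
  qed
  have return: "AE x in m. \<forall>i. \<exists>k\<ge>1. hyp \<sigma> ((T ^^ i) x) k"
  proof -
    define Z where "Z = {x\<in>space m. \<not> (\<exists>n\<ge>1. hyp \<sigma> x n)}"
    have "Z = space m - (\<Union>n\<in>{1..}. {x\<in>space m. hyp \<sigma> x n})" by (auto simp: Z_def)
    then have Z: "Z \<in> sets m" using H by auto
    have "AE x in m. x \<notin> Z" using ex by eventually_elim (auto simp: Z_def)
    then have mZ: "measure m Z = 0" using Z by (simp add: AE_iff_null_sets measure_eq_0_null_sets)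
    have "AE x in m. \<forall>n. \<not> (hyp \<sigma> x n \<and> (T ^^ n) x \<in> Z)"
      unfolding AE_all_countable
    proof
      fix n
      let ?X = "{x\<in>space m. hyp \<sigma> x n \<and> (T ^^ n) x \<in> Z}"
      have "?X = {x\<in>space m. hyp \<sigma> x n} \<inter> preim m T n Z" by (auto simp: preim_def)
      then have X: "?X \<in> sets m" using H preim_sets[OF T Z] by auto
      have "measure m ?X \<le> 0" using dom0[OF Z, of n] mZ by simp
      then have "?X \<in> null_sets m" using X by (intro null_setsI) (auto simp: emeasure_eq_measure measure_le_0_iff)
      then have "AE x in m. x \<notin> ?X" by (rule AE_not_in)
      with AE_space show "AE x in m. \<not> (hyp \<sigma> x n \<and> (T ^^ n) x \<in> Z)" by eventually_elim auto
    qed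
    with AE_space show ?thesis
    proof eventually_elim
      case (elim x)
      show ?case
      proof
        fix i
        have "\<exists>n>i. hyp_seq \<sigma> (\<lambda>j. lam ((T ^^ j) x)) n"
        proof (rule infinitely_many_hyp_seq)
          fix n assume "hyp_seq \<sigma> (\<lambda>j. lam ((T ^^ j) x)) n"
          then have "(T ^^ n) x \<notin> Z" using elim by (auto simp: hyp_def)
          then show "\<exists>k\<ge>1. hyp_seq \<sigma> (\<lambda>j. lam ((T ^^ (n + j)) x)) k"
            using sp[of x n] elim by (auto simp: Z_def shift)
        qed (use nn elim \<sigma> in auto)
        then obtain n where n: "n > i" "hyp_seq \<sigma> (\<lambda>j. lam ((T ^^ j) x)) n" by blast
        then have "hyp \<sigma> ((T ^^ i) x) (n - i)" unfolding shift
          by (intro hyp_seq_tail[of _ "\<lambda>j. lam ((T ^^ j) x)"]) simp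
        then show "\<exists>k\<ge>1. hyp \<sigma> ((T ^^ i) x) k" using n(1) by (intro exI[of _ "n - i"]) auto
      qed
    qed
  qed
  define a where "a x = ln (lam x)" for x
  have a: "a \<in> borel_measurable m" unfolding a_def using lam by measurable
  have abound: "\<bar>a x\<bar> \<le> \<bar>ln c1\<bar> + \<bar>ln c2\<bar>" if x: "x \<in> space m" for x
  proof -
    have "ln c1 \<le> a x" "a x \<le> ln c2"
      unfolding a_def using c(1) c(2,3)[OF x] by (subst ln_le_cancel_iff; linarith)+
    then show ?thesis by linarith
  qed
  have ls: "ln \<sigma> < 0" using \<sigma> by simp
  have "AE x in m. \<exists>B. \<forall>n. birkhoff_sum T a n x \<le> ln \<sigma> / 2 * real n + B"
  proof (rule birkhoff_upper_bound[OF fin T small a abound])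
    show "AE x in m. \<forall>i. \<exists>k\<ge>1. birkhoff_sum T a k ((T ^^ i) x) \<le> ln \<sigma> * real k"
      using return AE_space
    proof eventually_elim
      case (elim x)
      show ?case
      proof
        fix i
        obtain k where k: "k \<ge> 1" "hyp \<sigma> ((T ^^ i) x) k" using elim by blast
        let ?y = "(T ^^ i) x"
        have y: "?y \<in> space m" using elim sp by auto
        have "(\<Prod>j<k. lam ((T ^^ j) ?y)) \<le> \<sigma> ^ k" using k(2) unfolding hyp_def by (rule hyp_seq_prod)
        then have "ln (\<Prod>j<k. lam ((T ^^ j) ?y)) \<le> ln (\<sigma> ^ k)"
          using pos[OF y] \<sigma> by (subst ln_le_cancel_iff) (auto intro: prod_pos)
        moreover have "ln (\<Prod>j<k. lam ((T ^^ j) ?y)) = birkhoff_sum T a k ?y"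
          unfolding birkhoff_sum_def a_def using pos[OF y] by (subst ln_prod) (auto simp: less_imp_neq[symmetric])
        ultimately have "birkhoff_sum T a k ?y \<le> ln \<sigma> * real k" using \<sigma> by (simp add: ln_realpow mult.commute)
        then show "\<exists>k\<ge>1. birkhoff_sum T a k ?y \<le> ln \<sigma> * real k" using k by blast
      qed
    qed
  qed (use ls in auto)
  \<comment> \<open>The slope \<open>ln \<sigma> / 2\<close> is given up to \<open>ln \<sigma> / 4 = - 2 * c\<close> to absorb the additive constant; the
    other half of that is the price of the lemma of Pliss.\<close>
  define c where "c = - ln \<sigma> / 8"
  define K where "K = max 1 (- ln c1)"
  have cK: "c > 0" "K > 0" using ls by (auto simp: c_def K_def)
  have expK: "exp (- K) \<le> lam x" if "x \<in> space m" for x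
  proof -
    have "exp (- K) \<le> exp (ln c1)" unfolding exp_le_cancel_iff K_def by auto
    then show ?thesis using c(1) c(2)[OF that] by simp
  qed
  have "AE x in m. \<forall>\<^sub>F n in sequentially.
      \<exists>H\<subseteq>{1..n}. (\<forall>i\<in>H. hyp (exp (- c)) x i) \<and> real (card H) \<ge> c / K * real n"
    using \<open>AE x in m. \<exists>B. \<forall>n. birkhoff_sum T a n x \<le> ln \<sigma> / 2 * real n + B\<close> AE_space
  proof eventually_elim
    case (elim x)
    then obtain B where B: "\<And>n. birkhoff_sum T a n x \<le> ln \<sigma> / 2 * real n + B" by blast
    obtain N :: nat where N: "real N \<ge> B / (2 * c)" using real_arch_simple by blast
    show ?case
      unfolding eventually_sequentially
    proof (intro exI[of _ N] allI impI)
      fix n assume "N \<le> n"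
      then have "real n \<ge> B / (2 * c)" using N by linarith
      then have "B \<le> real n * (2 * c)" using cK by (simp add: pos_divide_le_eq)
      then have "birkhoff_sum T a n x \<le> - 2 * c * real n" using B[of n] by (simp add: c_def algebra_simps)
      then show "\<exists>H\<subseteq>{1..n}. (\<forall>i\<in>H. hyp (exp (- c)) x i) \<and> real (card H) \<ge> c / K * real n"
        unfolding hyp_def birkhoff_sum_def a_def
        by (intro pliss cK expK) (use sp elim in auto)
    qed
  qed
  then show ?thesis using cK by (intro exI[of _ "exp (- c)"] exI[of _ "c / K"]) auto
qed

section \<open>Jacobians over an arbitrary finite index type\<close>

text \<open>
  The change of variables theorem is about \<open>real ^ 'n\<close> for a well-ordered index type \<open>'n\<close>. A copy
  of \<open>'n\<close> with an arbitrary well-order makes it applicable to every finite index type: relabelling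
  the coordinates preserves Lebesgue measure.
\<close>

typedef 'n wo = "UNIV :: 'n set" morphisms of_wo to_wo by auto

lemma bij_to_wo: "bij to_wo" "bij of_wo"
  using to_wo_inject of_wo_inject to_wo_inverse of_wo_inverse
  by (metis UNIV_I bij_def injI surj_def)+

instance wo :: (finite) finite
proof
  have "finite (range (to_wo :: 'a \<Rightarrow> 'a wo))" by simp
  moreover have "range (to_wo :: 'a \<Rightarrow> 'a wo) = UNIV" using bij_to_wo(1) by (rule bij_is_surj)
  ultimately show "finite (UNIV :: 'a wo set)" by simp
qed

instantiation wo :: (finite) wellorder
begin

definition wo_rank :: "'a wo \<Rightarrow> nat" where "wo_rank = (SOME r. inj r)"

definition less_eq_wo :: "'a wo \<Rightarrow> 'a wo \<Rightarrow> bool" where "x \<le> y \<longleftrightarrow> wo_rank x \<le> wo_rank y"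

definition less_wo :: "'a wo \<Rightarrow> 'a wo \<Rightarrow> bool" where "x < y \<longleftrightarrow> wo_rank x < wo_rank y"

lemma inj_wo_rank: "inj (wo_rank :: 'a wo \<Rightarrow> nat)"
proof -
  obtain r :: "'a wo \<Rightarrow> nat" where "inj r"
    using finite_imp_inj_to_nat_seg[OF finite_class.finite_UNIV] by blast
  then show ?thesis unfolding wo_rank_def by (rule someI[where P = inj])
qed

instance
proof
  fix P :: "'a wo \<Rightarrow> bool" and a
  assume step: "\<And>x. (\<And>y. y < x \<Longrightarrow> P y) \<Longrightarrow> P x"
  show "P a"
    by (induction a rule: measure_induct_rule[of wo_rank]) (use step less_wo_def in blast)
qed (auto simp: less_eq_wo_def less_wo_def inj_eq[OF inj_wo_rank])

end

definition to_wo_vec :: "real ^ 'n::finite \<Rightarrow> real ^ 'n wo" where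
  "to_wo_vec x = (\<chi> i. x $ of_wo i)"

definition of_wo_vec :: "real ^ ('n::finite) wo \<Rightarrow> real ^ 'n" where
  "of_wo_vec x = (\<chi> i. x $ to_wo i)"

lemma wo_vec_inverse [simp]: "of_wo_vec (to_wo_vec x) = x" "to_wo_vec (of_wo_vec y) = y"
  by (auto simp: to_wo_vec_def of_wo_vec_def vec_eq_iff to_wo_inverse of_wo_inverse)

lemma linear_wo_vec: "linear to_wo_vec" "linear of_wo_vec"
  by (auto simp: to_wo_vec_def of_wo_vec_def vec_eq_iff intro!: linearI)

lemma bounded_linear_wo_vec: "bounded_linear to_wo_vec" "bounded_linear of_wo_vec"
  using linear_wo_vec linear_conv_bounded_linear by blast+

lemma continuous_wo_vec: "continuous_on S to_wo_vec" "continuous_on S' of_wo_vec"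
  using bounded_linear_wo_vec linear_continuous_on by blast+

lemma measurable_wo_vec [measurable]:
  "to_wo_vec \<in> borel_measurable borel" "of_wo_vec \<in> borel_measurable borel"
  using continuous_wo_vec by (auto intro: borel_measurable_continuous_onI)

text \<open>
  A box goes to the box with relabelled sides, and boxes determine Lebesgue measure.
\<close>

lemma distr_to_wo_vec: "distr lborel borel to_wo_vec = (lborel :: (real ^ ('n::finite) wo) measure)"
proof (rule lborel_eqI[symmetric])
  fix l u :: "real ^ 'n wo" assume le: "\<And>b. b \<in> Basis \<Longrightarrow> l \<bullet> b \<le> u \<bullet> b"
  have leq: "l $ i \<le> u $ i" for i using le[of "axis i 1"] by (simp add: inner_axis axis_in_Basis_iff)
  have "to_wo_vec -` box l u = box (of_wo_vec l) (of_wo_vec u)"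
    by (auto simp: mem_box_cart to_wo_vec_def of_wo_vec_def) (metis UNIV_I of_wo_inverse to_wo_inverse)+
  then have "emeasure (distr lborel borel to_wo_vec) (box l u) = emeasure lborel (box (of_wo_vec l) (of_wo_vec u))"
    by (subst emeasure_distr) auto
  also have "\<dots> = (\<Prod>b\<in>Basis. (of_wo_vec u - of_wo_vec l) \<bullet> b)"
    by (rule emeasure_lborel_box) (auto simp: Basis_vec_def inner_axis of_wo_vec_def leq)
  also have "(\<Prod>b\<in>Basis. (of_wo_vec u - of_wo_vec l) \<bullet> b) = (\<Prod>i\<in>UNIV. (of_wo_vec u - of_wo_vec l) $ i)"
    by (rule prod.reindex_bij_witness[of _ "\<lambda>i. axis i 1" "\<lambda>b. THE i. b = axis i 1"])
       (auto simp: Basis_vec_def inner_axis axis_eq_axis)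
  also have "\<dots> = (\<Prod>i\<in>UNIV. (u - l) $ i)"
    by (rule prod.reindex_bij_witness[of _ of_wo to_wo])
       (auto simp: of_wo_vec_def to_wo_inverse of_wo_inverse)
  also have "\<dots> = (\<Prod>b\<in>Basis. (u - l) \<bullet> b)"
    by (rule prod.reindex_bij_witness[of _ "\<lambda>b. THE i. b = axis i 1" "\<lambda>i. axis i 1"])
       (auto simp: Basis_vec_def inner_axis axis_eq_axis)
  finally show "emeasure (distr lborel borel to_wo_vec) (box l u) = (\<Prod>b\<in>Basis. (u - l) \<bullet> b)" .
qed auto

text \<open>
  The absolute value of the determinant of \<open>L\<close>. It is computed in the relabelled coordinates,
  where the change of variables theorem applies.
\<close>

definition jac :: "(real ^ 'n::finite \<Rightarrow> real ^ 'n) \<Rightarrow> real" where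
  "jac L = \<bar>det (matrix (to_wo_vec \<circ> L \<circ> of_wo_vec))\<bar>"

lemma emeasure_to_wo_vec_image:
  assumes "S \<in> sets borel"
  shows "to_wo_vec ` S \<in> sets borel" "emeasure lborel (to_wo_vec ` S) = emeasure lborel S"
proof -
  have eq: "to_wo_vec ` S = of_wo_vec -` S" by (auto simp: image_iff) (metis wo_vec_inverse(2))
  then show b: "to_wo_vec ` S \<in> sets borel"
    using measurable_sets[OF measurable_wo_vec(2) assms] by simp
  have "emeasure (distr lborel borel to_wo_vec) (to_wo_vec ` S) = emeasure lborel (to_wo_vec -` to_wo_vec ` S)"
    using b by (subst emeasure_distr) auto
  also have "to_wo_vec -` to_wo_vec ` S = S" by auto (metis wo_vec_inverse(1))
  finally show "emeasure lborel (to_wo_vec ` S) = emeasure lborel S" by (simp add: distr_to_wo_vec)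
qed

lemma measure_image_jac_bounds_wo:
  fixes F :: "real ^ 'n::{finite,wellorder} \<Rightarrow> real ^ 'n::_"
  assumes S: "S \<in> lmeasurable" and FS: "F ` S \<in> lmeasurable" and inj: "inj_on F S"
    and der: "\<And>x. x \<in> S \<Longrightarrow> (F has_derivative F' x) (at x)"
    and bd: "\<And>x. x \<in> S \<Longrightarrow> l \<le> \<bar>det (matrix (F' x))\<bar>" "\<And>x. x \<in> S \<Longrightarrow> \<bar>det (matrix (F' x))\<bar> \<le> u"
  shows "l * measure lebesgue S \<le> measure lebesgue (F ` S)" "measure lebesgue (F ` S) \<le> u * measure lebesgue S"
proof -
  have der': "\<And>x. x \<in> S \<Longrightarrow> (F has_derivative F' x) (at x within S)"
    using der has_derivative_at_withinI by blast
  have "((\<lambda>x. \<bar>det (matrix (F' x))\<bar>) has_integral measure lebesgue (F ` S)) S"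
    using has_measure_differentiable_image[OF _ der' inj] S FS by blast
  moreover have one: "((\<lambda>x. 1::real) has_integral measure lebesgue S) S"
    using S by (simp add: has_integral_iff lmeasure_integral lmeasurable_iff_integrable_on)
  moreover have "((\<lambda>x. l) has_integral l * measure lebesgue S) S" "((\<lambda>x. u) has_integral u * measure lebesgue S) S"
    using has_integral_mult_right[of "\<lambda>_. 1" "measure lebesgue S" S l] has_integral_mult_right[of "\<lambda>_. 1" "measure lebesgue S" S u]
      one by simp_all
  ultimately show "l * measure lebesgue S \<le> measure lebesgue (F ` S)" "measure lebesgue (F ` S) \<le> u * measure lebesgue S"
    using bd by (auto intro: has_integral_le)
qed

text \<open>
  Transport to the well-ordered copy of the index type.
\<close>

lemma measure_image_jac_bounds:
  fixes F :: "real ^ 'n::finite \<Rightarrow> real ^ 'n"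
  assumes S: "S \<in> sets borel" "bounded S" and FS: "F ` S \<in> sets borel" "bounded (F ` S)" and inj: "inj_on F S"
    and der: "\<And>x. x \<in> S \<Longrightarrow> (F has_derivative F' x) (at x)"
    and bd: "\<And>x. x \<in> S \<Longrightarrow> l \<le> jac (F' x)" "\<And>x. x \<in> S \<Longrightarrow> jac (F' x) \<le> u"
  shows "l * measure lborel S \<le> measure lborel (F ` S)" "measure lborel (F ` S) \<le> u * measure lborel S"
proof -
  let ?F = "to_wo_vec \<circ> F \<circ> of_wo_vec"
  let ?S = "to_wo_vec ` S"
  have img: "?F ` ?S = to_wo_vec ` (F ` S)" by (auto simp: image_iff)
  have bdd: "bounded ?S" "bounded (?F ` ?S)"
    unfolding img using S(2) FS(2) bounded_linear_wo_vec(1) bounded_linear_image by blast+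
  have meas: "?S \<in> sets borel" "?F ` ?S \<in> sets borel"
    unfolding img using emeasure_to_wo_vec_image S FS by blast+
  have lm: "?S \<in> lmeasurable" "?F ` ?S \<in> lmeasurable"
    using bdd meas by (auto intro!: bounded_set_imp_lmeasurable)
  have eq: "measure lebesgue ?S = measure lborel S" "measure lebesgue (?F ` ?S) = measure lborel (F ` S)"
    using meas emeasure_to_wo_vec_image(2)[OF S(1)] emeasure_to_wo_vec_image(2)[OF FS(1)]
    unfolding img by (auto simp: measure_def)
  have inj': "inj_on ?F ?S" using inj unfolding inj_on_def by (auto) (metis wo_vec_inverse(1))
  have der': "(?F has_derivative (to_wo_vec \<circ> F' (of_wo_vec x) \<circ> of_wo_vec)) (at x)" if "x \<in> ?S" for x
  proof -
    have "of_wo_vec x \<in> S" using that by auto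
    from der[OF this] have d: "(F has_derivative F' (of_wo_vec x)) (at (of_wo_vec x))" .
    show ?thesis
      by (intro diff_chain_at bounded_linear_imp_has_derivative bounded_linear_wo_vec d)
  qed
  have bd': "l \<le> \<bar>det (matrix (to_wo_vec \<circ> F' (of_wo_vec x) \<circ> of_wo_vec))\<bar>"
     "\<bar>det (matrix (to_wo_vec \<circ> F' (of_wo_vec x) \<circ> of_wo_vec))\<bar> \<le> u" if "x \<in> ?S" for x
    using that bd unfolding jac_def by auto
  show "l * measure lborel S \<le> measure lborel (F ` S)" "measure lborel (F ` S) \<le> u * measure lborel S"
    using measure_image_jac_bounds_wo[OF lm inj' der' bd'] unfolding eq by auto
qed

lemma jac_compose:
  assumes "linear K" "linear L"
  shows "jac (K \<circ> L) = jac K * jac L"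
proof -
  have eq: "to_wo_vec \<circ> (K \<circ> L) \<circ> of_wo_vec = (to_wo_vec \<circ> K \<circ> of_wo_vec) \<circ> (to_wo_vec \<circ> L \<circ> of_wo_vec)"
    by auto
  have "linear (to_wo_vec \<circ> K \<circ> of_wo_vec)" "linear (to_wo_vec \<circ> L \<circ> of_wo_vec)"
    using assms by (auto intro!: linear_compose linear_wo_vec)
  then show ?thesis unfolding jac_def eq by (simp add: matrix_compose det_mul abs_mult)
qed

lemma jac_id: "jac (\<lambda>x. x) = 1"
  by (simp add: jac_def o_def matrix_id_mat_1 flip: id_def)

section \<open>Tangent vectors and the metric in charts\<close>

definition local_rep :: "('a \<Rightarrow> 'a) \<Rightarrow> ('a, 'n::finite) chart \<Rightarrow> ('a, 'n) chart \<Rightarrow> real ^ 'n \<Rightarrow> real ^ 'n" where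
  "local_rep F c d = snd d \<circ> F \<circ> chart_inv c"

text \<open>
  The tangent vector at \<open>x\<close> with coordinates \<open>u\<close> in the chart \<open>c\<close>.
\<close>

definition tangent_of :: "('a, 'n::finite) chart set \<Rightarrow> ('a, 'n) chart \<Rightarrow> 'a \<Rightarrow> real ^ 'n \<Rightarrow> ('a, 'n) tangent" where
  "tangent_of A c x u =
     (\<lambda>d. if d \<in> charts_at A x then frechet_derivative (snd d \<circ> chart_inv c) (at (snd c x)) u else 0)"

locale smooth_manifold =
  fixes M :: "'a::t2_space set" and A :: "('a, 'n::finite) chart set"
  assumes atlas: "smooth_atlas M A"
begin

lemma chart_cover: "x \<in> M \<Longrightarrow> \<exists>c\<in>A. x \<in> fst c"
  using atlas by (auto simp: smooth_atlas_def)

lemma chart_facts: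
  assumes "c \<in> A"
  shows "openin (top_of_set M) (fst c)" "fst c \<subseteq> M" "open (snd c ` fst c)"
    "continuous_on (fst c) (snd c)" "continuous_on (snd c ` fst c) (chart_inv c)"
    "chart_inv c ` snd c ` fst c = fst c"
    "homeomorphism (fst c) (snd c ` fst c) (snd c) (chart_inv c)"
  using assms atlas unfolding smooth_atlas_def homeomorphism_def by auto

lemma chart_inv_snd [simp]: "c \<in> A \<Longrightarrow> x \<in> fst c \<Longrightarrow> chart_inv c (snd c x) = x"
  using chart_facts(7)[of c] by (auto simp: homeomorphism_def)

lemma snd_chart_inv:
  "c \<in> A \<Longrightarrow> y \<in> snd c ` fst c \<Longrightarrow> snd c (chart_inv c y) = y"
  "c \<in> A \<Longrightarrow> y \<in> snd c ` fst c \<Longrightarrow> chart_inv c y \<in> fst c"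
  using chart_facts(7)[of c] by (auto simp: homeomorphism_def)

lemma chart_image_open:
  assumes c: "c \<in> A" and W: "openin (top_of_set M) W" "W \<subseteq> fst c"
  shows "open (snd c ` W)"
proof -
  have "openin (top_of_set (fst c)) W"
    using W chart_facts(2)[OF c] by (meson openin_subset_trans)
  then have "openin (top_of_set (snd c ` fst c)) (snd c ` W)"
    using chart_facts(7)[OF c] homeomorphism_imp_open_map by blast
  then show ?thesis using chart_facts(3)[OF c] openin_open_trans by blast
qed

lemma chart_inv_image_openin:
  assumes c: "c \<in> A" and V: "open V" "V \<subseteq> snd c ` fst c"
  shows "openin (top_of_set M) (chart_inv c ` V)"
proof -
  have "openin (top_of_set (snd c ` fst c)) V" using V by (simp add: open_subset)
  then have "openin (top_of_set (fst c)) (chart_inv c ` V)"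
    using chart_facts(7)[OF c] homeomorphism_imp_open_map homeomorphism_symD by blast
  then show ?thesis using chart_facts(1)[OF c] openin_trans by blast
qed

text \<open>
  Changes of charts are local representations of the identity map, so that this chain rule covers
  them as well.
\<close>

lemma local_rep_chain:
  assumes c: "c \<in> A" "x \<in> fst c" and d: "d \<in> A" "F x \<in> fst d"
    and W: "openin (top_of_set M) W" "x \<in> W" and F: "continuous_on W F" "F ` W \<subseteq> M"
    and dF: "(local_rep F c d has_derivative F') (at (snd c x))"
    and dG: "(local_rep G d e has_derivative G') (at (snd d (F x)))"
  shows "(local_rep (G \<circ> F) c e has_derivative (G' \<circ> F')) (at (snd c x))"
proof -
  let ?V = "snd c ` (fst c \<inter> (W \<inter> F -` fst d))"
  have "openin (top_of_set W) (W \<inter> F -` fst d)"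
    using F chart_facts(1)[OF d(1)] continuous_openin_preimage by blast
  then have "openin (top_of_set M) (W \<inter> F -` fst d)" using W openin_trans by blast
  then have V: "open ?V" using chart_facts(1)[OF c(1)] by (intro chart_image_open c(1)) auto
  have x: "local_rep F c d (snd c x) = snd d (F x)" using c by (simp add: local_rep_def)
  have "(local_rep G d e \<circ> local_rep F c d has_derivative (G' \<circ> F')) (at (snd c x))"
    using dF dG x by (intro diff_chain_at) auto
  moreover have "(local_rep G d e \<circ> local_rep F c d) y = local_rep (G \<circ> F) c e y" if "y \<in> ?V" for y
    using that c d by (auto simp: local_rep_def)
  ultimately show ?thesis
    using has_derivative_transform_within_open[OF _ V] c d W by blast
qed

lemma trans_differentiable:
  assumes "c \<in> charts_at A x" "d \<in> charts_at A x"
  shows "(local_rep id c d has_derivative frechet_derivative (snd d \<circ> chart_inv c) (at (snd c x))) (at (snd c x))"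
proof -
  have "smooth_on (snd c ` (fst c \<inter> fst d)) (snd d \<circ> chart_inv c)"
    using assms atlas by (auto simp: smooth_atlas_def charts_at_def)
  then have "Ck_on (Suc 0) (snd c ` (fst c \<inter> fst d)) (snd d \<circ> chart_inv c)"
    unfolding smooth_on_def by blast
  then have "(snd d \<circ> chart_inv c) differentiable (at (snd c x))"
    using assms by (auto simp: charts_at_def)
  then show ?thesis unfolding local_rep_def by (simp add: frechet_derivative_works)
qed

lemma local_rep_change:
  assumes c: "c \<in> charts_at A x" "c' \<in> charts_at A x" and d: "d \<in> charts_at A (F x)" "d' \<in> charts_at A (F x)"
    and W: "openin (top_of_set M) W" "x \<in> W" and F: "continuous_on W F" "F ` W \<subseteq> M"
    and dF: "(local_rep F c d has_derivative F') (at (snd c x))"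
  shows "(local_rep F c' d has_derivative F' \<circ> frechet_derivative (snd c \<circ> chart_inv c') (at (snd c' x))) (at (snd c' x))"
    and "(local_rep F c d' has_derivative frechet_derivative (snd d' \<circ> chart_inv d) (at (snd d (F x))) \<circ> F') (at (snd c x))"
proof -
  have "(local_rep (F \<circ> id) c' d has_derivative F' \<circ> frechet_derivative (snd c \<circ> chart_inv c') (at (snd c' x))) (at (snd c' x))"
    by (rule local_rep_chain[where W = M and d = c])
       (use c dF trans_differentiable[OF c(2,1)] W openin_imp_subset[OF W(1)] in \<open>auto simp: charts_at_def\<close>)
  then show "(local_rep F c' d has_derivative F' \<circ> frechet_derivative (snd c \<circ> chart_inv c') (at (snd c' x))) (at (snd c' x))"
    by simp
  have "(local_rep (id \<circ> F) c d' has_derivative frechet_derivative (snd d' \<circ> chart_inv d) (at (snd d (F x))) \<circ> F') (at (snd c x))"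
    by (rule local_rep_chain[where W = W and d = d])
       (use c d dF trans_differentiable[OF d] W F in \<open>auto simp: charts_at_def\<close>)
  then show "(local_rep F c d' has_derivative frechet_derivative (snd d' \<circ> chart_inv d) (at (snd d (F x))) \<circ> F') (at (snd c x))"
    by simp
qed

lemma charts_at_M: "c \<in> charts_at A x \<Longrightarrow> x \<in> M"
  unfolding charts_at_def using chart_facts(2) by blast

lemma trans_chain:
  assumes "c \<in> charts_at A x" "d \<in> charts_at A x" "e \<in> charts_at A x"
  shows "frechet_derivative (snd e \<circ> chart_inv d) (at (snd d x)) (frechet_derivative (snd d \<circ> chart_inv c) (at (snd c x)) u) =
    frechet_derivative (snd e \<circ> chart_inv c) (at (snd c x)) u"
proof -
  have "(local_rep id c e has_derivative frechet_derivative (snd e \<circ> chart_inv d) (at (snd d (id x))) \<circ>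
     frechet_derivative (snd d \<circ> chart_inv c) (at (snd c x))) (at (snd c x))"
    by (rule local_rep_change(2)[where W = M])
       (use assms trans_differentiable[OF assms(1,2)] charts_at_M in auto)
  then show ?thesis
    using has_derivative_unique[OF _ trans_differentiable[OF assms(1,3)]] by (metis comp_apply id_apply)
qed

lemma trans_self:
  assumes "c \<in> charts_at A x"
  shows "frechet_derivative (snd c \<circ> chart_inv c) (at (snd c x)) u = u"
proof -
  have c: "c \<in> A" "x \<in> fst c" using assms by (auto simp: charts_at_def)
  have "(local_rep id c c has_derivative (\<lambda>u. u)) (at (snd c x))"
    by (rule has_derivative_transform_within_open[OF has_derivative_ident chart_facts(3)[OF c(1)]])
       (use c snd_chart_inv in \<open>auto simp: local_rep_def\<close>)
  then show ?thesis
    using has_derivative_unique[OF _ trans_differentiable[OF assms assms]] by metis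
qed

lemma tangent_of_in: "c \<in> charts_at A x \<Longrightarrow> tangent_of A c x u \<in> tangent_space A x"
  unfolding tangent_space_def tangent_of_def mem_Collect_eq
  by (intro conjI ballI allI impI) (simp_all only: if_True if_False trans_chain)

lemma tangent_of_apply [simp]: "c \<in> charts_at A x \<Longrightarrow> tangent_of A c x u c = u"
  unfolding tangent_of_def by (simp add: trans_self)

lemma tangent_of_coordinate:
  "v \<in> tangent_space A x \<Longrightarrow> c \<in> charts_at A x \<Longrightarrow> tangent_of A c x (v c) = v"
  unfolding tangent_space_def tangent_of_def mem_Collect_eq by (rule ext) metis

lemma linear_trans:
  assumes "c \<in> charts_at A x" "d \<in> charts_at A x"
  shows "linear (frechet_derivative (snd d \<circ> chart_inv c) (at (snd c x)))"
  using has_derivative_linear[OF trans_differentiable[OF assms]] .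

lemma tangent_of_add:
  "c \<in> charts_at A x \<Longrightarrow> tangent_of A c x (u + w) = (\<lambda>d. tangent_of A c x u d + tangent_of A c x w d)"
  unfolding tangent_of_def by (rule ext) (simp add: linear_add[OF linear_trans])

lemma tangent_of_scaleR:
  "c \<in> charts_at A x \<Longrightarrow> tangent_of A c x (r *\<^sub>R u) = (\<lambda>d. r *\<^sub>R tangent_of A c x u d)"
  unfolding tangent_of_def by (rule ext) (simp add: linear_scale[OF linear_trans])

lemma coord_vector_eq: "coord_vector A c x i = tangent_of A c x (axis i 1)"
  unfolding coord_vector_def tangent_of_def by simp

end

locale riemannian_manifold = smooth_manifold M A
  for M :: "'a::t2_space set" and A :: "('a, 'n::finite) chart set" +
  fixes g :: "('a, 'n) metric"
  assumes metric: "riemannian_metric M A g"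
begin

text \<open>
  The metric at \<open>x\<close> and its norm as functions of coordinates in the chart \<open>c\<close>. All estimates are
  made with these, on a fixed Euclidean space.
\<close>

definition form :: "('a, 'n) chart \<Rightarrow> 'a \<Rightarrow> real ^ 'n \<Rightarrow> real ^ 'n \<Rightarrow> real" where
  "form c x u w = g x (tangent_of A c x u) (tangent_of A c x w)"

definition cnorm :: "('a, 'n) chart \<Rightarrow> 'a \<Rightarrow> real ^ 'n \<Rightarrow> real" where
  "cnorm c x u = tangent_norm g x (tangent_of A c x u)"

lemma form_facts:
  assumes c: "c \<in> charts_at A x"
  shows "form c x u w = form c x w u"
    "form c x (u + u') w = form c x u w + form c x u' w"
    "form c x (r *\<^sub>R u) w = r * form c x u w"
    "u \<noteq> 0 \<Longrightarrow> form c x u u > 0"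
proof -
  have ip: "inner_product_on_tangent_space A x (g x)"
    using metric charts_at_M[OF c] by (auto simp: riemannian_metric_def)
  note t = tangent_of_in[OF c]
  show "form c x u w = form c x w u" "form c x (u + u') w = form c x u w + form c x u' w"
    "form c x (r *\<^sub>R u) w = r * form c x u w"
    using ip t unfolding form_def tangent_of_add[OF c] tangent_of_scaleR[OF c] inner_product_on_tangent_space_def by blast+
  assume "u \<noteq> 0"
  then have "tangent_of A c x u \<noteq> (\<lambda>_. 0)" using tangent_of_apply[OF c, of u] by metis
  then show "form c x u u > 0" using ip t unfolding form_def inner_product_on_tangent_space_def by blast
qed

lemma form_facts2:
  assumes c: "c \<in> charts_at A x"
  shows "form c x w (u + u') = form c x w u + form c x w u'"
    "form c x w (r *\<^sub>R u) = r * form c x w u"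
    "form c x 0 w = 0" "form c x u u \<ge> 0"
proof -
  show "form c x w (u + u') = form c x w u + form c x w u'" "form c x w (r *\<^sub>R u) = r * form c x w u"
    using form_facts(1-3)[OF c] by metis+
  show z: "form c x 0 w = 0" for w using form_facts(3)[OF c, of 0 0 w] by simp
  show "form c x u u \<ge> 0" using form_facts(4)[OF c, of u] z[of u] by (cases "u = 0") auto
qed

lemma form_matrix:
  assumes c: "c \<in> charts_at A x"
  shows "form c x u w = (\<Sum>i\<in>UNIV. \<Sum>j\<in>UNIV. u $ i * w $ j * metric_matrix A g c x $ i $ j)"
proof -
  have sum1: "form c x (\<Sum>i\<in>I. h i) w = (\<Sum>i\<in>I. form c x (h i) w)" if "finite I" for I :: "'n set" and h w
    using that by (induction I) (simp_all add: form_facts(2)[OF c] form_facts2(3)[OF c])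
  have sum2: "form c x w (\<Sum>i\<in>I. h i) = (\<Sum>i\<in>I. form c x w (h i))" if "finite I" for I :: "'n set" and h w
    unfolding form_facts(1)[OF c, of w] by (rule sum1[OF that])
  have u: "u = (\<Sum>i\<in>UNIV. u $ i *\<^sub>R axis i 1)" for u :: "real ^ 'n"
    by (simp only: scalar_mult_eq_scaleR[symmetric] basis_expansion)
  have "form c x u w = form c x (\<Sum>i\<in>UNIV. u $ i *\<^sub>R axis i 1) (\<Sum>j\<in>UNIV. w $ j *\<^sub>R axis j 1)"
    by (rule arg_cong2[where f = "form c x"]) (rule u)+
  also have "\<dots> = (\<Sum>i\<in>UNIV. \<Sum>j\<in>UNIV. u $ i * (w $ j * form c x (axis i 1) (axis j 1)))"
    unfolding sum1[OF finite_class.finite_UNIV] form_facts(3)[OF c]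
    unfolding sum2[OF finite_class.finite_UNIV] form_facts2(2)[OF c] sum_distrib_left ..
  finally show ?thesis by (simp add: form_def metric_matrix_def coord_vector_eq mult.assoc)
qed

lemma cnorm_eq: "cnorm c x u = sqrt (form c x u u)"
  by (simp add: cnorm_def tangent_norm_def form_def)

lemma cnorm_facts:
  assumes c: "c \<in> charts_at A x"
  shows "cnorm c x u \<ge> 0" "u \<noteq> 0 \<Longrightarrow> cnorm c x u > 0" "cnorm c x 0 = 0"
    "cnorm c x (r *\<^sub>R u) = \<bar>r\<bar> * cnorm c x u"
  using form_facts[OF c] form_facts2[OF c]
  by (auto simp: cnorm_eq real_sqrt_mult mult.assoc[symmetric] simp flip: power2_eq_square)

text \<open>
  The Cauchy-Schwarz inequality for the form gives the triangle inequality; it is obtained from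
  the nonnegative value of the form at \<open>u + t w\<close> for the minimizing \<open>t\<close>.
\<close>

lemma cnorm_triangle:
  assumes c: "c \<in> charts_at A x"
  shows "cnorm c x (u + w) \<le> cnorm c x u + cnorm c x w"
proof -
  let ?Q = "form c x"
  have cs: "?Q u w \<le> cnorm c x u * cnorm c x w"
  proof (cases "w = 0")
    case True
    then show ?thesis using form_facts(1)[OF c, of u 0] by (simp add: form_facts2[OF c] cnorm_facts[OF c])
  next
    case False
    then have pos: "?Q w w > 0" by (rule form_facts(4)[OF c])
    define t where "t = - ?Q u w / ?Q w w"
    have "0 \<le> ?Q (u + t *\<^sub>R w) (u + t *\<^sub>R w)" by (rule form_facts2(4)[OF c])
    also have "\<dots> = ?Q u u + 2 * t * ?Q u w + t * t * ?Q w w"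
      using form_facts(1)[OF c, of w u] by (simp add: form_facts(2,3)[OF c] form_facts2(1,2)[OF c] algebra_simps)
    also have "\<dots> = ?Q u u - (?Q u w)\<^sup>2 / ?Q w w"
      using pos by (simp add: t_def field_simps power2_eq_square)
    finally have "(?Q u w)\<^sup>2 \<le> ?Q u u * ?Q w w" using pos by (simp add: field_simps)
    then have "sqrt ((?Q u w)\<^sup>2) \<le> sqrt (?Q u u * ?Q w w)" by (rule real_sqrt_le_mono)
    then show ?thesis by (simp add: real_sqrt_mult cnorm_eq)
  qed
  have "?Q (u + w) (u + w) = ?Q u u + 2 * ?Q u w + ?Q w w"
    using form_facts(1)[OF c, of w u] by (simp add: form_facts(2)[OF c] form_facts2(1)[OF c])
  also have "\<dots> \<le> (cnorm c x u + cnorm c x w)\<^sup>2"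
    using cs form_facts2(4)[OF c] by (simp add: power2_sum cnorm_eq)
  finally have "sqrt (?Q (u + w) (u + w)) \<le> sqrt ((cnorm c x u + cnorm c x w)\<^sup>2)" by (rule real_sqrt_le_mono)
  then show ?thesis using cnorm_facts(1)[OF c] by (simp add: cnorm_eq)
qed

lemma charts_at_chart_inv: "c \<in> A \<Longrightarrow> y \<in> snd c ` fst c \<Longrightarrow> c \<in> charts_at A (chart_inv c y)"
  using snd_chart_inv by (auto simp: charts_at_def)

lemma metric_matrix_continuous:
  assumes "c \<in> A"
  shows "continuous_on (snd c ` fst c) (\<lambda>y. metric_matrix A g c (chart_inv c y) $ i $ j)"
proof -
  have "smooth_on (snd c ` fst c) (\<lambda>y. metric_matrix A g c (chart_inv c y) $ i $ j)"
    using metric assms by (auto simp: riemannian_metric_def)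
  then have "Ck_on 0 (snd c ` fst c) (\<lambda>y. metric_matrix A g c (chart_inv c y) $ i $ j)"
    unfolding smooth_on_def by blast
  then show ?thesis by simp
qed

lemma form_continuous:
  assumes c: "c \<in> A"
  shows "continuous_on ((snd c ` fst c) \<times> UNIV) (\<lambda>(y, u). form c (chart_inv c y) u u)"
proof -
  have "continuous_on ((snd c ` fst c) \<times> UNIV) (\<lambda>p. \<Sum>i\<in>UNIV. \<Sum>j\<in>UNIV. snd p $ i * snd p $ j * metric_matrix A g c (chart_inv c (fst p)) $ i $ j)"
    by (intro continuous_intros continuous_on_compose2[OF metric_matrix_continuous[OF c]]) auto
  then show ?thesis
    by (rule continuous_on_eq) (auto simp: form_matrix[OF charts_at_chart_inv[OF c]])
qed

text \<open>
  The form is continuous in the point and the vector together, so that its root attains a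
  positive minimum and a maximum over the piece and the unit sphere.
\<close>

lemma cnorm_equivalent:
  assumes c: "c \<in> A" and K: "compact K" "K \<subseteq> snd c ` fst c"
  shows "\<exists>a b. 0 < a \<and> 0 < b \<and> (\<forall>y\<in>K. \<forall>u. a * norm u \<le> cnorm c (chart_inv c y) u \<and> cnorm c (chart_inv c y) u \<le> b * norm u)"
proof (cases "K = {}")
  case True
  then show ?thesis by (intro exI[of _ 1]) auto
next
  case False
  let ?S = "K \<times> sphere 0 1 :: ((real ^ 'n) \<times> (real ^ 'n)) set"
  let ?h = "\<lambda>p. case p of (y, u) \<Rightarrow> cnorm c (chart_inv c y) u"
  have comp: "compact ?S" using K by (intro compact_Times) auto
  have "axis undefined 1 \<in> sphere (0 :: real ^ 'n) 1" by simp
  then have ne: "?S \<noteq> {}" using False by blast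
  have "continuous_on ?S (\<lambda>p. sqrt (case p of (y, u) \<Rightarrow> form c (chart_inv c y) u u))"
    by (intro continuous_on_real_sqrt continuous_on_subset[OF form_continuous[OF c]]) (use K in auto)
  then have cont: "continuous_on ?S ?h" by (rule continuous_on_eq) (auto simp: cnorm_eq)
  obtain p where p: "p \<in> ?S" "\<And>q. q \<in> ?S \<Longrightarrow> ?h p \<le> ?h q" using continuous_attains_inf[OF comp ne cont] by blast
  obtain r where r: "r \<in> ?S" "\<And>q. q \<in> ?S \<Longrightarrow> ?h q \<le> ?h r" using continuous_attains_sup[OF comp ne cont] by blast
  have ch: "c \<in> charts_at A (chart_inv c y)" if "y \<in> K" for y using charts_at_chart_inv[OF c] that K by auto
  have pos: "?h p > 0" using p(1) ch cnorm_facts(2) by (auto intro!: cnorm_facts(2))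
  have "?h p * norm u \<le> cnorm c (chart_inv c y) u \<and> cnorm c (chart_inv c y) u \<le> ?h r * norm u" if y: "y \<in> K" for y u
  proof (cases "u = 0")
    case True
    then show ?thesis using cnorm_facts(3)[OF ch[OF y]] by simp
  next
    case False
    define w where "w = u /\<^sub>R norm u"
    have w: "w \<in> sphere 0 1" "u = norm u *\<^sub>R w" using False by (auto simp: w_def)
    have "cnorm c (chart_inv c y) u = norm u * cnorm c (chart_inv c y) w"
      using w(2) cnorm_facts(4)[OF ch[OF y], of "norm u" w] by simp
    moreover have "?h p \<le> cnorm c (chart_inv c y) w" "cnorm c (chart_inv c y) w \<le> ?h r"
      using p(2)[of "(y, w)"] r(2)[of "(y, w)"] y w by auto
    ultimately show ?thesis by (simp add: mult.commute mult_left_mono)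
  qed
  moreover have "?h r > 0" using pos r(2)[OF p(1)] by linarith
  ultimately show ?thesis using pos by blast
qed

text \<open>
  On the segment from the identity matrix to the metric matrix all matrices are positive
  definite, hence invertible, so the determinant cannot change sign along it.
\<close>

lemma det_metric_pos:
  assumes c: "c \<in> charts_at A x"
  shows "det (metric_matrix A g c x) > 0"
proof -
  let ?G = "metric_matrix A g c x"
  define P where "P t = (\<chi> i j. t * ?G $ i $ j + (1 - t) * mat 1 $ i $ j)" for t :: real
  have nz: "det (P t) \<noteq> 0" if t: "t \<in> {0..1}" for t
  proof
    assume "det (P t) = 0"
    then have "\<not> invertible (P t)" by (simp add: invertible_det_nz)
    then obtain u where u: "u \<noteq> 0" "P t *v u = 0"
      by (metis invertible_def matrix_left_invertible_ker matrix_left_right_inverse)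
    have "u \<bullet> (P t *v u) = t * form c x u u + (1 - t) * (u \<bullet> u)"
    proof -
      have "u \<bullet> (P t *v u) = (\<Sum>i\<in>UNIV. u $ i * (\<Sum>j\<in>UNIV. (t * ?G $ i $ j + (1 - t) * mat 1 $ i $ j) * u $ j))"
        by (simp add: inner_vec_def matrix_vector_mult_def P_def)
      also have "\<dots> = (\<Sum>i\<in>UNIV. t * (\<Sum>j\<in>UNIV. u $ i * u $ j * ?G $ i $ j) + (1 - t) * (u $ i * (mat 1 *v u) $ i))"
        by (rule sum.cong) (auto simp: matrix_vector_mult_def sum_distrib_left sum.distrib[symmetric] algebra_simps)
      also have "\<dots> = t * form c x u u + (1 - t) * (u \<bullet> u)"
        by (simp add: sum.distrib sum_distrib_left[symmetric] form_matrix[OF c] inner_vec_def)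
      finally show ?thesis .
    qed
    moreover have "t * form c x u u + (1 - t) * (u \<bullet> u) > 0"
    proof (cases "t = 0")
      case False
      then have "t * form c x u u > 0" using t form_facts(4)[OF c u(1)] by auto
      moreover have "(1 - t) * (u \<bullet> u) \<ge> 0" using t by auto
      ultimately show ?thesis by linarith
    qed (use u in auto)
    ultimately show False using u(2) by simp
  qed
  have cont: "continuous_on {0..1} (\<lambda>t. det (P t))"
    unfolding det_def P_def by (auto intro!: continuous_intros)
  have "P 0 = mat 1" "P 1 = ?G" by (auto simp: P_def vec_eq_iff)
  then have P01: "det (P 0) = 1" "det (P 1) = det ?G" by auto
  show ?thesis
  proof (rule ccontr)
    assume "\<not> det ?G > 0"
    then obtain t where "0 \<le> t" "t \<le> 1" "det (P t) = 0"
      using IVT2'[of "\<lambda>t. det (P t)" 1 0 0] cont P01 by auto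
    then show False using nz by auto
  qed
qed

end

section \<open>The norm of the inverse derivative\<close>

locale riemannian_local_diffeo = riemannian_manifold M A g
  for M :: "'a::t2_space set" and A :: "('a, 'n::finite) chart set" and g :: "('a, 'n) metric" +
  fixes f :: "'a \<Rightarrow> 'a"
  assumes diffeo: "C2_local_diffeomorphism M A f" and compact_M: "compact M"
begin

abbreviation lam :: "'a \<Rightarrow> real" where "lam \<equiv> inv_derivative_norm A g f"

abbreviation hyp :: "real \<Rightarrow> 'a \<Rightarrow> nat \<Rightarrow> bool" where
  "hyp s x n \<equiv> hyp_seq s (\<lambda>j. lam ((f ^^ j) x)) n"

definition coord_deriv :: "('a, 'n) chart \<Rightarrow> ('a, 'n) chart \<Rightarrow> 'a \<Rightarrow> real ^ 'n \<Rightarrow> real ^ 'n" where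
  "coord_deriv c d x = frechet_derivative (local_rep f c d) (at (snd c x))"

lemma f_M: "x \<in> M \<Longrightarrow> f x \<in> M"
  using diffeo by (auto simp: C2_local_diffeomorphism_def)

lemma continuous_f: "continuous_on M f"
  unfolding continuous_on_eq_continuous_within
proof
  fix x assume "x \<in> M"
  then obtain U where U: "x \<in> U" "openin (top_of_set M) U" "continuous_on U f"
    using diffeo unfolding C2_local_diffeomorphism_def Ck_map_on_def by blast
  then obtain O' where O': "open O'" "U = M \<inter> O'" by (meson openin_open)
  have "continuous (at x within U) f" using U by (auto simp: continuous_on_eq_continuous_within)
  moreover have "at x within U = at x within M"
    by (rule at_within_nhd[of x O']) (use O' U in auto)
  ultimately show "continuous (at x within M) f" by simp
qed

lemma preimage_openin: "openin (top_of_set M) O' \<Longrightarrow> openin (top_of_set M) (M \<inter> f -` O')"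
  by (rule continuous_openin_preimage[OF continuous_f]) (use f_M in auto)

text \<open>
  A neighbourhood on which \<open>f\<close> has a \<open>C\<^sup>2\<close> inverse, shrunk so that one chart \<open>c\<close> covers it and
  one chart \<open>d\<close> covers its image; \<open>\<Psi>\<close> is the inverse in these coordinates.
\<close>

lemma local_inverse:
  assumes x0: "x0 \<in> M" and c: "c \<in> charts_at A x0" and d: "d \<in> charts_at A (f x0)"
  obtains W S \<Psi> where "openin (top_of_set M) W" "x0 \<in> W" "W \<subseteq> fst c" "f ` W \<subseteq> fst d"
    "open S" "S = snd d ` f ` W" "inj_on f W"
    "Ck_on 2 (snd c ` W) (local_rep f c d)" "Ck_on 2 S \<Psi>"
    "\<And>x. x \<in> W \<Longrightarrow> \<Psi> (snd d (f x)) = snd c x"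
proof -
  obtain U where U: "x0 \<in> U" "openin (top_of_set M) U" "openin (top_of_set M) (f ` U)" "inj_on f U"
    "Ck_map_on A 2 U f" "Ck_map_on A 2 (f ` U) (inv_into U f)"
    using diffeo x0 unfolding C2_local_diffeomorphism_def by blast
  have cA: "c \<in> A" "x0 \<in> fst c" and dA: "d \<in> A" "f x0 \<in> fst d" using c d by (auto simp: charts_at_def)
  define W where "W = U \<inter> fst c \<inter> f -` fst d"
  define \<Psi> where "\<Psi> = snd c \<circ> inv_into U f \<circ> chart_inv d"
  have UM: "U \<subseteq> M" using U(2) by (rule openin_imp_subset)
  have "W = (U \<inter> fst c) \<inter> (M \<inter> f -` fst d)" using UM by (auto simp: W_def)
  then have W: "openin (top_of_set M) W"
    using U(2) chart_facts(1)[OF cA(1)] preimage_openin[OF chart_facts(1)[OF dA(1)]] by (simp add: openin_Int)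
  have inv: "inv_into U f (f x) = x" if "x \<in> W" for x using that U(4) by (auto simp: W_def)
  let ?V = "f ` U \<inter> fst d \<inter> inv_into U f -` fst c"
  have fW: "f ` W = ?V"
  proof
    show "f ` W \<subseteq> ?V" using inv by (auto simp: W_def)
    show "?V \<subseteq> f ` W"
    proof
      fix y assume y: "y \<in> ?V"
      then have "f (inv_into U f y) = y" "inv_into U f y \<in> U"
        by (auto intro: f_inv_into_f inv_into_into)
      then show "y \<in> f ` W" using y by (intro image_eqI[of _ _ "inv_into U f y"]) (auto simp: W_def)
    qed
  qed
  have "continuous_on (f ` U) (inv_into U f)" using U(6) by (simp add: Ck_map_on_def)
  moreover have "inv_into U f \<in> f ` U \<rightarrow> M" using U(4) UM by auto
  ultimately have "openin (top_of_set (f ` U)) (f ` U \<inter> inv_into U f -` fst c)"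
    by (rule continuous_openin_preimage) (rule chart_facts(1)[OF cA(1)])
  then have "openin (top_of_set M) (f ` U \<inter> inv_into U f -` fst c)" using U(3) openin_trans by blast
  then have "openin (top_of_set M) ((f ` U \<inter> inv_into U f -` fst c) \<inter> fst d)"
    using chart_facts(1)[OF dA(1)] by (rule openin_Int)
  moreover have "(f ` U \<inter> inv_into U f -` fst c) \<inter> fst d = f ` W" using fW by auto
  ultimately have ofW: "openin (top_of_set M) (f ` W)" by simp
  have fWd: "f ` W \<subseteq> fst d" by (auto simp: W_def)
  have S: "open (snd d ` f ` W)" by (rule chart_image_open[OF dA(1) ofW fWd])
  have CkF: "Ck_on 2 (snd c ` W) (local_rep f c d)"
    using U(5) cA dA unfolding Ck_map_on_def W_def local_rep_def by blast
  have CkP: "Ck_on 2 (snd d ` f ` W) \<Psi>"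
    using U(6) cA dA unfolding Ck_map_on_def fW \<Psi>_def by blast
  have P: "\<Psi> (snd d (f x)) = snd c x" if x: "x \<in> W" for x
  proof -
    have "chart_inv d (snd d (f x)) = f x" using x dA by (auto simp: W_def)
    then show ?thesis using inv[OF x] by (simp add: \<Psi>_def)
  qed
  have inj: "inj_on f W" by (rule inj_on_subset[OF U(4)]) (auto simp: W_def)
  have x0W: "x0 \<in> W" "W \<subseteq> fst c" using U(1) cA dA by (auto simp: W_def)
  show thesis
    by (rule that[OF W x0W fWd S refl inj CkF CkP P])
qed

lemma coord_deriv_works:
  assumes x: "x \<in> M" and c: "c \<in> charts_at A x" and d: "d \<in> charts_at A (f x)"
  shows "(local_rep f c d has_derivative coord_deriv c d x) (at (snd c x))" "linear (coord_deriv c d x)" "bij (coord_deriv c d x)"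
proof -
  obtain W S \<Psi> where W: "openin (top_of_set M) W" "x \<in> W" "W \<subseteq> fst c" "f ` W \<subseteq> fst d"
    "open S" "S = snd d ` f ` W" "Ck_on 2 (snd c ` W) (local_rep f c d)" "Ck_on 2 S \<Psi>"
    "\<And>x. x \<in> W \<Longrightarrow> \<Psi> (snd d (f x)) = snd c x"
    using local_inverse[OF assms] by metis
  have cA: "c \<in> A" "x \<in> fst c" and dA: "d \<in> A" "f x \<in> fst d" using c d by (auto simp: charts_at_def)
  have "local_rep f c d differentiable (at (snd c x))"
    using W(2,7) by (simp add: numeral_2_eq_2)
  then show D: "(local_rep f c d has_derivative coord_deriv c d x) (at (snd c x))"
    unfolding coord_deriv_def by (simp add: frechet_derivative_works)
  then show lin: "linear (coord_deriv c d x)" by (rule has_derivative_linear)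
  have "\<Psi> differentiable (at (snd d (f x)))" using W(2,6,8) by (simp add: numeral_2_eq_2)
  then obtain P where P: "(\<Psi> has_derivative P) (at (snd d (f x)))" by (auto simp: differentiable_def)
  have loc: "local_rep f c d (snd c y) = snd d (f y)" if "y \<in> W" for y
    using that W(3) cA by (auto simp: local_rep_def)
  have "(\<Psi> \<circ> local_rep f c d has_derivative P \<circ> coord_deriv c d x) (at (snd c x))"
    using D P loc[OF W(2)] by (intro diff_chain_at) auto
  moreover have "((\<lambda>y. y) has_derivative P \<circ> coord_deriv c d x) (at (snd c x))"
    by (rule has_derivative_transform_within_open[OF calculation chart_image_open[OF cA(1) W(1,3)]])
       (use W loc in auto)
  ultimately have PD: "P \<circ> coord_deriv c d x = (\<lambda>u. u)"
    using has_derivative_unique has_derivative_ident by blast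
  then have "inj (coord_deriv c d x)" by (metis comp_apply injI)
  then show "bij (coord_deriv c d x)" using lin linear_injective_imp_surjective by (auto simp: bij_def)
qed

lemma tangent_map_coordinates:
  assumes x: "x \<in> M" and c: "c \<in> charts_at A x" and d: "d \<in> charts_at A (f x)"
  shows "tangent_map A f x (tangent_of A c x u) = tangent_of A d (f x) (coord_deriv c d x u)"
proof
  fix e
  define b where "b = (SOME c. c \<in> charts_at A x)"
  have b: "b \<in> charts_at A x" unfolding b_def using c by (rule someI)
  show "tangent_map A f x (tangent_of A c x u) e = tangent_of A d (f x) (coord_deriv c d x u) e"
  proof (cases "e \<in> charts_at A (f x)")
    case False
    then show ?thesis by (simp add: tangent_map_def tangent_of_def Let_def)
  next
    case e: True
    have sub: "f ` M \<subseteq> M" using f_M by auto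
    have "(local_rep f c e has_derivative coord_deriv b e x \<circ> frechet_derivative (snd b \<circ> chart_inv c) (at (snd c x))) (at (snd c x))"
      by (rule local_rep_change(1)[OF b c e e _ x continuous_f sub coord_deriv_works(1)[OF x b e]]) simp
    moreover have "(local_rep f c e has_derivative frechet_derivative (snd e \<circ> chart_inv d) (at (snd d (f x))) \<circ> coord_deriv c d x) (at (snd c x))"
      by (rule local_rep_change(2)[OF c c d e _ x continuous_f sub coord_deriv_works(1)[OF x c d]]) simp
    ultimately have "coord_deriv b e x \<circ> frechet_derivative (snd b \<circ> chart_inv c) (at (snd c x)) =
       frechet_derivative (snd e \<circ> chart_inv d) (at (snd d (f x))) \<circ> coord_deriv c d x"
      by (rule has_derivative_unique)
    then have "coord_deriv b e x (frechet_derivative (snd b \<circ> chart_inv c) (at (snd c x)) u) =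
       frechet_derivative (snd e \<circ> chart_inv d) (at (snd d (f x))) (coord_deriv c d x u)"
      by (metis comp_apply)
    then show ?thesis using e b
      by (simp add: tangent_map_def Let_def b_def[symmetric] tangent_of_def coord_deriv_def local_rep_def)
  qed
qed

lemma tangent_map_inv_coordinates:
  assumes x: "x \<in> M" and c: "c \<in> charts_at A x" and d: "d \<in> charts_at A (f x)"
  shows "tangent_map_inv A f x (tangent_of A d (f x) (coord_deriv c d x u)) = tangent_of A c x u"
proof -
  have inj: "inj_on (tangent_map A f x) (tangent_space A x)"
  proof
    fix v w assume v: "v \<in> tangent_space A x" "w \<in> tangent_space A x" and eq: "tangent_map A f x v = tangent_map A f x w"
    have "tangent_of A d (f x) (coord_deriv c d x (v c)) = tangent_of A d (f x) (coord_deriv c d x (w c))"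
      using eq tangent_map_coordinates[OF assms] tangent_of_coordinate[OF _ c] v by metis
    then have "coord_deriv c d x (v c) = coord_deriv c d x (w c)" using tangent_of_apply[OF d] by metis
    then have "v c = w c" using coord_deriv_works(3)[OF assms] by (auto simp: bij_def inj_eq)
    then show "v = w" using tangent_of_coordinate[OF _ c] v by metis
  qed
  show ?thesis
    unfolding tangent_map_inv_def tangent_map_coordinates[OF assms, symmetric]
    by (rule inv_into_f_f[OF inj tangent_of_in[OF c]])
qed

text \<open>
  Every tangent vector at \<open>f x\<close> is the image of exactly one tangent vector at \<open>x\<close>, so the
  supremum may run over coordinates at \<open>x\<close> instead.
\<close>

lemma lam_eq_Sup:
  assumes x: "x \<in> M" and c: "c \<in> charts_at A x" and d: "d \<in> charts_at A (f x)"
  shows "lam x = Sup {cnorm c x u | u. cnorm d (f x) (coord_deriv c d x u) \<le> 1}"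
proof -
  have "{tangent_norm g x (tangent_map_inv A f x v) | v. v \<in> tangent_space A (f x) \<and> tangent_norm g (f x) v \<le> 1}
     = {cnorm c x u | u. cnorm d (f x) (coord_deriv c d x u) \<le> 1}" (is "?L = ?R")
  proof
    show "?R \<subseteq> ?L"
    proof clarify
      fix u assume "cnorm d (f x) (coord_deriv c d x u) \<le> 1"
      then show "\<exists>v. cnorm c x u = tangent_norm g x (tangent_map_inv A f x v) \<and> v \<in> tangent_space A (f x) \<and> tangent_norm g (f x) v \<le> 1"
        using tangent_map_inv_coordinates[OF assms, of u] tangent_of_in[OF d]
        by (intro exI[of _ "tangent_of A d (f x) (coord_deriv c d x u)"]) (simp add: cnorm_def)
    qed
    show "?L \<subseteq> ?R"
    proof clarify
      fix v assume v: "v \<in> tangent_space A (f x)" "tangent_norm g (f x) v \<le> 1"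
      obtain u where u: "coord_deriv c d x u = v d" using coord_deriv_works(3)[OF assms] by (metis bij_pointE)
      have "v = tangent_of A d (f x) (coord_deriv c d x u)" using tangent_of_coordinate[OF v(1) d] u by simp
      then show "\<exists>u. tangent_norm g x (tangent_map_inv A f x v) = cnorm c x u \<and> cnorm d (f x) (coord_deriv c d x u) \<le> 1"
        using tangent_map_inv_coordinates[OF assms, of u] v by (intro exI[of _ u]) (simp add: cnorm_def)
    qed
  qed
  then show ?thesis by (simp add: inv_derivative_norm_def tangent_onorm_def)
qed

lemma cnorm_bounds_at:
  assumes c: "c \<in> charts_at A x"
  obtains a b where "0 < a" "0 < b" "\<And>u. a * norm u \<le> cnorm c x u" "\<And>u. cnorm c x u \<le> b * norm u"
proof -
  have cA: "c \<in> A" "x \<in> fst c" using c by (auto simp: charts_at_def)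
  show thesis
    using cnorm_equivalent[OF cA(1), of "{snd c x}"] that cA by auto
qed

text \<open>
  This carries the content of the operator norm. Since the derivative is injective and the norms
  are equivalent to the Euclidean norm, the supremum is over a bounded set.
\<close>

lemma lam_ge:
  assumes x: "x \<in> M" and c: "c \<in> charts_at A x" and d: "d \<in> charts_at A (f x)"
  shows "cnorm c x u \<le> lam x * cnorm d (f x) (coord_deriv c d x u)"
proof (cases "u = 0")
  case True
  then show ?thesis using cnorm_facts(3)[OF c] cnorm_facts(3)[OF d] linear_0[OF coord_deriv_works(2)[OF assms]] by simp
next
  case False
  let ?D = "coord_deriv c d x"
  let ?X = "{cnorm c x u | u. cnorm d (f x) (?D u) \<le> 1}"
  obtain b where b: "0 < b" "\<And>u. cnorm c x u \<le> b * norm u" using cnorm_bounds_at[OF c] by metis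
  obtain a where a: "0 < a" "\<And>u. a * norm u \<le> cnorm d (f x) u" using cnorm_bounds_at[OF d] by metis
  have inj: "inj ?D" using coord_deriv_works(3)[OF assms] by (simp add: bij_def)
  obtain k where k: "k > 0" "\<And>u. k * norm u \<le> norm (?D u)"
    using linear_inj_bounded_below_pos[OF coord_deriv_works(2)[OF assms] inj] by metis
  have "bdd_above ?X"
  proof (rule bdd_aboveI)
    fix r assume "r \<in> ?X"
    then obtain u where u: "r = cnorm c x u" "cnorm d (f x) (?D u) \<le> 1" by blast
    have "a * (k * norm u) \<le> a * norm (?D u)" using k a by (intro mult_left_mono) auto
    also have "\<dots> \<le> 1" using a(2)[of "?D u"] u(2) by linarith
    finally have "norm u \<le> 1 / (a * k)" using a k by (simp add: field_simps)
    then have "b * norm u \<le> b * (1 / (a * k))" using b by (intro mult_left_mono) auto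
    then show "r \<le> b * (1 / (a * k))" using b(2)[of u] u by linarith
  qed
  define t where "t = cnorm d (f x) (?D u)"
  have "?D u \<noteq> 0" using False inj linear_0[OF coord_deriv_works(2)[OF assms]] by (metis injD)
  then have t: "t > 0" unfolding t_def by (rule cnorm_facts(2)[OF d])
  have "cnorm d (f x) (?D ((1 / t) *\<^sub>R u)) = 1"
    using t unfolding linear_scale[OF coord_deriv_works(2)[OF assms]] cnorm_facts(4)[OF d] t_def by simp
  then have "cnorm c x ((1 / t) *\<^sub>R u) \<in> ?X" by force
  then have "cnorm c x ((1 / t) *\<^sub>R u) \<le> lam x"
    unfolding lam_eq_Sup[OF assms] using \<open>bdd_above ?X\<close> by (rule cSup_upper)
  then have "cnorm c x u / t \<le> lam x" using t unfolding cnorm_facts(4)[OF c] by simp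
  then show ?thesis using t by (simp add: field_simps t_def)
qed

lemma lam_le:
  assumes x: "x \<in> M" and c: "c \<in> charts_at A x" and d: "d \<in> charts_at A (f x)"
    and le: "\<And>u. cnorm c x u \<le> t * cnorm d (f x) (coord_deriv c d x u)" and t: "t \<ge> 0"
  shows "lam x \<le> t"
  unfolding lam_eq_Sup[OF assms(1-3)]
proof (rule cSup_least)
  show "{cnorm c x u | u. cnorm d (f x) (coord_deriv c d x u) \<le> 1} \<noteq> {}"
    using cnorm_facts(3)[OF d] linear_0[OF coord_deriv_works(2)[OF assms(1-3)]] by (auto intro!: exI[of _ 0])
  fix r assume "r \<in> {cnorm c x u | u. cnorm d (f x) (coord_deriv c d x u) \<le> 1}"
  then obtain u where u: "r = cnorm c x u" "cnorm d (f x) (coord_deriv c d x u) \<le> 1" by blast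
  have "t * cnorm d (f x) (coord_deriv c d x u) \<le> t * 1" using u t by (intro mult_left_mono) auto
  then show "r \<le> t" using le[of u] u by simp
qed

lemma charts_exist:
  assumes "x \<in> M"
  obtains c d where "c \<in> charts_at A x" "d \<in> charts_at A (f x)"
  using chart_cover[OF assms] chart_cover[OF f_M[OF assms]] by (auto simp: charts_at_def)

lemma lam_pos:
  assumes x: "x \<in> M"
  shows "lam x > 0"
proof -
  obtain c d where c: "c \<in> charts_at A x" and d: "d \<in> charts_at A (f x)" using charts_exist[OF x] .
  have "0 < cnorm c x (axis undefined 1)" by (rule cnorm_facts(2)[OF c]) simp
  also have "\<dots> \<le> lam x * cnorm d (f x) (coord_deriv c d x (axis undefined 1))" by (rule lam_ge[OF x c d])
  finally show ?thesis using cnorm_facts(1)[OF d] by (metis mult_nonpos_nonneg not_le)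
qed

text \<open>
  Lower semicontinuity, which gives measurability. By \<open>lam_le\<close>, \<open>lam x > t\<close> is witnessed by a
  single vector \<open>u\<close>, and the strict inequality for this \<open>u\<close> persists nearby, where \<open>lam_ge\<close>
  returns \<open>lam > t\<close>.
\<close>

lemma lam_superlevel_openin:
  "openin (top_of_set M) {x\<in>M. lam x > t}"
proof (cases "t \<ge> 0")
  case False
  then have "{x\<in>M. lam x > t} = M" using lam_pos by force
  then show ?thesis by simp
next
  case t: True
  show ?thesis
    unfolding openin_subopen[of _ "{x\<in>M. lam x > t}"]
  proof clarify
    fix x0 assume x0: "x0 \<in> M" "lam x0 > t"
    obtain c d where c: "c \<in> charts_at A x0" and d: "d \<in> charts_at A (f x0)" using charts_exist[OF x0(1)] .
    obtain u where u: "cnorm c x0 u > t * cnorm d (f x0) (coord_deriv c d x0 u)"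
      using lam_le[OF x0(1) c d _ t] x0(2) by (meson not_le)
    obtain W S \<Psi> where W: "openin (top_of_set M) W" "x0 \<in> W" "W \<subseteq> fst c" "f ` W \<subseteq> fst d"
      "Ck_on 2 (snd c ` W) (local_rep f c d)" using local_inverse[OF x0(1) c d] by metis
    have cA: "c \<in> A" and dA: "d \<in> A" using c d by (auto simp: charts_at_def)
    have WM: "W \<subseteq> M" using W(1) by (rule openin_imp_subset)
    have chW: "c \<in> charts_at A x" "d \<in> charts_at A (f x)" if "x \<in> W" for x
      using that W cA dA by (auto simp: charts_at_def)
    have cc: "continuous_on W (snd c)" "continuous_on W f" "continuous_on W (snd d \<circ> f)"
    proof -
      show "continuous_on W (snd c)" using chart_facts(4)[OF cA] W(3) continuous_on_subset by blast
      show "continuous_on W f" using continuous_f WM continuous_on_subset by blast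
      then show "continuous_on W (snd d \<circ> f)"
        using chart_facts(4)[OF dA] W(4) by (intro continuous_on_compose) (auto intro: continuous_on_subset)
    qed
    have "Ck_on (Suc 0) (snd c ` W) (\<lambda>y. frechet_derivative (local_rep f c d) (at y) u)"
      using W(5) by (simp add: numeral_2_eq_2)
    then have "continuous_on (snd c ` W) (\<lambda>y. frechet_derivative (local_rep f c d) (at y) u)"
      by (intro differentiable_imp_continuous_on) (auto simp: differentiable_on_def differentiable_at_withinI)
    then have cD: "continuous_on W (\<lambda>x. coord_deriv c d x u)"
      unfolding coord_deriv_def by (rule continuous_on_compose2[OF _ cc(1)]) auto
    have "continuous_on W (\<lambda>x. sqrt ((\<lambda>(y, u). form c (chart_inv c y) u u) (snd c x, u)))"
      by (intro continuous_on_real_sqrt continuous_on_compose2[OF form_continuous[OF cA], where f = "\<lambda>x. (snd c x, u)"]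
           continuous_intros cc) (use W in auto)
    then have c1: "continuous_on W (\<lambda>x. cnorm c x u)"
      by (rule continuous_on_eq) (use W(3) cA in \<open>auto simp: cnorm_eq subset_iff\<close>)
    have "continuous_on W (\<lambda>x. sqrt ((\<lambda>(y, u). form d (chart_inv d y) u u) ((snd d \<circ> f) x, coord_deriv c d x u)))"
      by (intro continuous_on_real_sqrt continuous_on_compose2[OF form_continuous[OF dA], where f = "\<lambda>x. ((snd d \<circ> f) x, coord_deriv c d x u)"]
           continuous_on_Pair cc cD) (use W in auto)
    then have c2: "continuous_on W (\<lambda>x. cnorm d (f x) (coord_deriv c d x u))"
      by (rule continuous_on_eq) (use W(4) dA in \<open>auto simp: cnorm_eq subset_iff\<close>)
    let ?h = "\<lambda>x. cnorm c x u - t * cnorm d (f x) (coord_deriv c d x u)"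
    have "continuous_on W ?h" using c1 c2 by (intro continuous_intros)
    then have "openin (top_of_set W) (W \<inter> ?h -` {0<..})" by (rule continuous_openin_preimage_gen) simp
    then have op: "openin (top_of_set M) (W \<inter> ?h -` {0<..})" using W(1) openin_trans by blast
    have "lam x > t" if x: "x \<in> W" "?h x > 0" for x
    proof (rule ccontr)
      assume "\<not> lam x > t"
      then have "lam x * cnorm d (f x) (coord_deriv c d x u) \<le> t * cnorm d (f x) (coord_deriv c d x u)"
        using cnorm_facts(1)[OF chW(2)[OF x(1)]] by (intro mult_right_mono) auto
      moreover have "cnorm c x u \<le> lam x * cnorm d (f x) (coord_deriv c d x u)"
        using x WM by (intro lam_ge chW) auto
      ultimately show False using x(2) by linarith
    qed
    then have "W \<inter> ?h -` {0<..} \<subseteq> {x\<in>M. lam x > t}" using WM by auto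
    moreover have "x0 \<in> W \<inter> ?h -` {0<..}" using u W(2) by auto
    ultimately show "\<exists>T. openin (top_of_set M) T \<and> x0 \<in> T \<and> T \<subseteq> {x\<in>M. lam x > t}" using op by blast
  qed
qed

end

section \<open>Estimates for twice differentiable maps\<close>

lemma norm_linear_le_sum_Basis:
  fixes L :: "'b::euclidean_space \<Rightarrow> 'c::real_normed_vector"
  assumes "linear L"
  shows "norm (L w) \<le> (\<Sum>b\<in>Basis. norm (L b)) * norm w"
proof -
  have "L w = L (\<Sum>b\<in>Basis. (w \<bullet> b) *\<^sub>R b)" by (simp add: euclidean_representation)
  also have "\<dots> = (\<Sum>b\<in>Basis. (w \<bullet> b) *\<^sub>R L b)"
    using assms by (simp add: linear_sum linear_scale)
  finally have "norm (L w) \<le> (\<Sum>b\<in>Basis. norm ((w \<bullet> b) *\<^sub>R L b))" by (simp only: norm_sum)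
  also have "\<dots> \<le> (\<Sum>b\<in>Basis. norm (L b) * norm w)"
    by (rule sum_mono) (simp add: Basis_le_norm mult.commute[of "norm (L _)"] mult_right_mono)
  finally show ?thesis by (simp add: sum_distrib_right)
qed

lemma C1_bounded_derivative:
  fixes h :: "'b::euclidean_space \<Rightarrow> 'c::real_normed_vector"
  assumes h: "Ck_on (Suc 0) S h" and X: "compact X" "X \<subseteq> S"
  shows "\<exists>B\<ge>0. \<forall>v\<in>X. \<forall>w. norm (frechet_derivative h (at v) w) \<le> B * norm w"
proof -
  have lin: "linear (frechet_derivative h (at v))" if "v \<in> X" for v
    using h that X by (intro linear_frechet_derivative) auto
  have "\<exists>B. \<forall>v\<in>X. norm (frechet_derivative h (at v) b) \<le> B" for b
  proof -
    have "continuous_on X (\<lambda>v. frechet_derivative h (at v) b)"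
      using h X by (auto intro: continuous_on_subset)
    then have "bounded ((\<lambda>v. frechet_derivative h (at v) b) ` X)"
      using X compact_continuous_image compact_imp_bounded by blast
    then show ?thesis by (auto simp: bounded_iff)
  qed
  then obtain B where B: "\<And>b v. v \<in> X \<Longrightarrow> norm (frechet_derivative h (at v) b) \<le> B b" by metis
  let ?B = "\<Sum>b\<in>Basis. \<bar>B b\<bar>"
  have "norm (frechet_derivative h (at v) w) \<le> ?B * norm w" if v: "v \<in> X" for v w
  proof -
    have "norm (frechet_derivative h (at v) w) \<le> (\<Sum>b\<in>Basis. norm (frechet_derivative h (at v) b)) * norm w"
      by (rule norm_linear_le_sum_Basis[OF lin[OF v]])
    also have "\<dots> \<le> ?B * norm w"
      by (intro mult_right_mono sum_mono) (auto intro: order_trans[OF B[OF v] abs_ge_self])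
    finally show ?thesis .
  qed
  then show ?thesis by (intro exI[of _ ?B]) (auto intro: sum_nonneg)
qed

lemma C2_imp_C1:
  assumes "Ck_on 2 S h"
  shows "Ck_on (Suc 0) S h"
proof -
  have h: "Ck_on (Suc (Suc 0)) S h" using assms by (simp add: numeral_2_eq_2)
  then have "continuous_on S (\<lambda>x. frechet_derivative h (at x) v)" for v
    by (intro differentiable_imp_continuous_on) (auto simp: differentiable_on_def differentiable_at_withinI)
  then show ?thesis using h by auto
qed

lemma C1_lipschitz:
  fixes h :: "'b::euclidean_space \<Rightarrow> 'c::real_normed_vector"
  assumes h: "Ck_on (Suc 0) S h" and X: "compact X" "convex X" "X \<subseteq> S"
  shows "\<exists>B\<ge>0. \<forall>v\<in>X. \<forall>y\<in>X. norm (h v - h y) \<le> B * norm (v - y)"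
proof -
  obtain B where B: "B \<ge> 0" "\<And>v w. v \<in> X \<Longrightarrow> norm (frechet_derivative h (at v) w) \<le> B * norm w"
    using C1_bounded_derivative[OF h X(1,3)] by blast
  have "norm (h v - h y) \<le> B * norm (v - y)" if "v \<in> X" "y \<in> X" for v y
  proof (rule differentiable_bound[OF X(2) _ _ that])
    fix v assume v: "v \<in> X"
    then have "h differentiable (at v)" using h X by auto
    then show "(h has_derivative frechet_derivative h (at v)) (at v within X)"
      by (simp add: frechet_derivative_works has_derivative_at_withinI)
    show "onorm (frechet_derivative h (at v)) \<le> B"
      using B v by (intro onorm_bound) auto
  qed
  then show ?thesis using B(1) by blast
qed

text \<open>
  Unlike Lipschitz functions alone, bounded ones are closed under products, and so under
  determinants.
\<close>

definition bounded_lipschitz :: "'b::real_normed_vector set \<Rightarrow> ('b \<Rightarrow> real) \<Rightarrow> bool" where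
  "bounded_lipschitz X h \<longleftrightarrow>
     (\<exists>B. \<forall>v\<in>X. \<bar>h v\<bar> \<le> B \<and> (\<forall>y\<in>X. \<bar>h v - h y\<bar> \<le> B * norm (v - y)))"

lemma bounded_lipschitz_const: "bounded_lipschitz X (\<lambda>_. k)"
  unfolding bounded_lipschitz_def by (intro exI[of _ "\<bar>k\<bar>"]) auto

lemma bounded_lipschitz_add:
  assumes "bounded_lipschitz X h" "bounded_lipschitz X k"
  shows "bounded_lipschitz X (\<lambda>v. h v + k v)"
proof -
  obtain B where B: "\<And>v. v \<in> X \<Longrightarrow> \<bar>h v\<bar> \<le> B" "\<And>v y. v \<in> X \<Longrightarrow> y \<in> X \<Longrightarrow> \<bar>h v - h y\<bar> \<le> B * norm (v - y)"
    using assms(1) unfolding bounded_lipschitz_def by blast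
  obtain C where C: "\<And>v. v \<in> X \<Longrightarrow> \<bar>k v\<bar> \<le> C" "\<And>v y. v \<in> X \<Longrightarrow> y \<in> X \<Longrightarrow> \<bar>k v - k y\<bar> \<le> C * norm (v - y)"
    using assms(2) unfolding bounded_lipschitz_def by blast
  show ?thesis
    unfolding bounded_lipschitz_def
  proof (intro exI[of _ "B + C"] ballI conjI)
    fix v assume v: "v \<in> X"
    show "\<bar>h v + k v\<bar> \<le> B + C" using B(1)[OF v] C(1)[OF v] by linarith
    fix y assume y: "y \<in> X"
    show "\<bar>h v + k v - (h y + k y)\<bar> \<le> (B + C) * norm (v - y)"
      using B(2)[OF v y] C(2)[OF v y] by (simp add: distrib_right)
  qed
qed

lemma bounded_lipschitz_mult:
  assumes "bounded_lipschitz X h" "bounded_lipschitz X k"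
  shows "bounded_lipschitz X (\<lambda>v. h v * k v)"
proof -
  obtain B where B: "\<And>v. v \<in> X \<Longrightarrow> \<bar>h v\<bar> \<le> B" "\<And>v y. v \<in> X \<Longrightarrow> y \<in> X \<Longrightarrow> \<bar>h v - h y\<bar> \<le> B * norm (v - y)"
    using assms(1) unfolding bounded_lipschitz_def by blast
  obtain C where C: "\<And>v. v \<in> X \<Longrightarrow> \<bar>k v\<bar> \<le> C" "\<And>v y. v \<in> X \<Longrightarrow> y \<in> X \<Longrightarrow> \<bar>k v - k y\<bar> \<le> C * norm (v - y)"
    using assms(2) unfolding bounded_lipschitz_def by blast
  show ?thesis
    unfolding bounded_lipschitz_def
  proof (intro exI[of _ "B * C + B * C"] ballI conjI)
    fix v assume v: "v \<in> X"
    have BC: "B \<ge> 0" "C \<ge> 0" using B(1)[OF v] C(1)[OF v] by linarith+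
    have "\<bar>h v * k v\<bar> \<le> B * C" unfolding abs_mult using B(1)[OF v] C(1)[OF v] BC by (intro mult_mono) auto
    also have "\<dots> \<le> B * C + B * C" using BC by simp
    finally show "\<bar>h v * k v\<bar> \<le> B * C + B * C" .
    fix y assume y: "y \<in> X"
    have "h v * k v - h y * k y = h v * (k v - k y) + (h v - h y) * k y" by (simp add: algebra_simps)
    then have "\<bar>h v * k v - h y * k y\<bar> \<le> \<bar>h v\<bar> * \<bar>k v - k y\<bar> + \<bar>h v - h y\<bar> * \<bar>k y\<bar>"
      by (metis abs_mult abs_triangle_ineq)
    also have "\<dots> \<le> B * (C * norm (v - y)) + (B * norm (v - y)) * C"
      using B C v y BC by (intro add_mono mult_mono) auto
    finally show "\<bar>h v * k v - h y * k y\<bar> \<le> (B * C + B * C) * norm (v - y)" by (simp add: algebra_simps)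
  qed
qed

lemma bounded_lipschitz_sum:
  assumes "finite I" "\<And>i. i \<in> I \<Longrightarrow> bounded_lipschitz X (h i)"
  shows "bounded_lipschitz X (\<lambda>v. \<Sum>i\<in>I. h i v)"
  using assms by (induction I) (auto intro: bounded_lipschitz_const bounded_lipschitz_add)

lemma bounded_lipschitz_prod:
  assumes "finite I" "\<And>i. i \<in> I \<Longrightarrow> bounded_lipschitz X (h i)"
  shows "bounded_lipschitz X (\<lambda>v. \<Prod>i\<in>I. h i v)"
  using assms by (induction I) (auto intro: bounded_lipschitz_const bounded_lipschitz_mult)

lemma bounded_lipschitz_det:
  fixes B :: "'b::real_normed_vector \<Rightarrow> real ^ 'n ^ 'n"
  assumes "\<And>i j. bounded_lipschitz X (\<lambda>v. B v $ i $ j)"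
  shows "bounded_lipschitz X (\<lambda>v. det (B v))"
  unfolding det_def
  by (intro bounded_lipschitz_sum bounded_lipschitz_mult bounded_lipschitz_const bounded_lipschitz_prod assms)
     (auto simp: finite_permutations)

lemma bounded_lipschitz_abs:
  assumes "bounded_lipschitz X h"
  shows "bounded_lipschitz X (\<lambda>v. \<bar>h v\<bar>)"
proof -
  obtain B where B: "\<And>v. v \<in> X \<Longrightarrow> \<bar>h v\<bar> \<le> B" "\<And>v y. v \<in> X \<Longrightarrow> y \<in> X \<Longrightarrow> \<bar>h v - h y\<bar> \<le> B * norm (v - y)"
    using assms unfolding bounded_lipschitz_def by blast
  have "\<bar>\<bar>h v\<bar> - \<bar>h y\<bar>\<bar> \<le> B * norm (v - y)" if "v \<in> X" "y \<in> X" for v y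
    using B(2)[OF that] abs_triangle_ineq3[of "h v" "h y"] by linarith
  then show ?thesis unfolding bounded_lipschitz_def using B(1) by (intro exI[of _ B]) auto
qed

lemma jac_pos:
  assumes "linear L" "inj L"
  shows "jac L > 0"
proof -
  have lin: "linear (to_wo_vec \<circ> L \<circ> of_wo_vec)"
    using assms by (auto intro!: linear_compose linear_wo_vec)
  have "inj (to_wo_vec \<circ> L \<circ> of_wo_vec)"
  proof (rule injI)
    fix u w assume "(to_wo_vec \<circ> L \<circ> of_wo_vec) u = (to_wo_vec \<circ> L \<circ> of_wo_vec) w"
    then have "of_wo_vec (to_wo_vec (L (of_wo_vec u))) = of_wo_vec (to_wo_vec (L (of_wo_vec w)))" by simp
    then have "of_wo_vec u = of_wo_vec w" using assms(2) by (simp add: inj_eq)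
    then have "to_wo_vec (of_wo_vec u) = to_wo_vec (of_wo_vec w)" by simp
    then show "u = w" by simp
  qed
  then have "det (matrix (to_wo_vec \<circ> L \<circ> of_wo_vec)) \<noteq> 0"
    using lin by (simp add: det_nz_iff_inj)
  then show ?thesis by (simp add: jac_def)
qed

text \<open>
  This is where \<open>C\<^sup>2\<close> enters. The derivative \<open>P\<close> is Lipschitz on a compact convex set, hence so
  is its Jacobian, which is bounded away from 0; a Lipschitz function bounded away from 0 has a
  Lipschitz logarithm.
\<close>

lemma C2_estimates:
  fixes \<Psi> :: "real ^ 'n::finite \<Rightarrow> real ^ 'n"
  defines "P \<equiv> \<lambda>y. frechet_derivative \<Psi> (at y)"
  assumes \<Psi>: "Ck_on 2 S \<Psi>" and X: "compact X" "convex X" "X \<subseteq> S"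
    and inj: "\<And>y. y \<in> X \<Longrightarrow> inj (P y)"
  shows "\<exists>C\<ge>0. \<forall>y\<in>X. \<forall>v\<in>X. norm (\<Psi> v - \<Psi> y - P y (v - y)) \<le> C * (norm (v - y))\<^sup>2 \<and>
      jac (P v) > 0 \<and> jac (P v) \<le> exp (C * norm (v - y)) * jac (P y) \<and>
      (\<forall>w. norm w \<le> C * norm (P y w) \<and> norm (P y w) \<le> C * norm w)"
proof (cases "X = {}")
  case True
  then show ?thesis by auto
next
  case False
  have C2: "Ck_on (Suc (Suc 0)) S \<Psi>" using \<Psi> by (simp add: numeral_2_eq_2)
  have dP: "(\<Psi> has_derivative P v) (at v)" if "v \<in> X" for v
    using C2 X that unfolding P_def by (auto simp: frechet_derivative_works[symmetric])
  have lin: "linear (P v)" if "v \<in> X" for v using dP[OF that] by (rule has_derivative_linear)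
  have C1: "Ck_on (Suc 0) S (\<lambda>v. P v w)" for w
    using C2 unfolding P_def by simp
  obtain L where L: "\<And>w. L w \<ge> 0" "\<And>w v y. v \<in> X \<Longrightarrow> y \<in> X \<Longrightarrow> norm (P v w - P y w) \<le> L w * norm (v - y)"
    using C1_lipschitz[OF C1 X] by metis
  define L1 where "L1 = (\<Sum>b\<in>Basis. L b)"
  have L1: "norm (P v w - P y w) \<le> L1 * norm (v - y) * norm w" if "v \<in> X" "y \<in> X" for v y w
  proof -
    have "linear (\<lambda>w. P v w - P y w)" using lin that by (intro linear_compose_sub) auto
    then have "norm (P v w - P y w) \<le> (\<Sum>b\<in>Basis. norm (P v b - P y b)) * norm w"
      by (rule norm_linear_le_sum_Basis)
    also have "\<dots> \<le> (\<Sum>b\<in>Basis. L b * norm (v - y)) * norm w"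
      using L that by (intro mult_right_mono sum_mono) auto
    finally show ?thesis by (simp add: L1_def sum_distrib_right)
  qed
  have L1nn: "L1 \<ge> 0" unfolding L1_def using L(1) by (intro sum_nonneg) auto
  have taylor: "norm (\<Psi> v - \<Psi> y - P y (v - y)) \<le> L1 * (norm (v - y))\<^sup>2" if v: "v \<in> X" and y: "y \<in> X" for v y
  proof -
    let ?X = "closed_segment y v"
    have sub: "?X \<subseteq> X" using X(2) v y by (simp add: closed_segment_subset)
    have "norm ((\<Psi> v - P y v) - (\<Psi> y - P y y)) \<le> (L1 * norm (v - y)) * norm (v - y)"
    proof (rule differentiable_bound[where f' = "\<lambda>z w. P z w - P y w" and S = ?X])
      fix z assume z: "z \<in> ?X"
      then have zX: "z \<in> X" using sub by auto
      have "bounded_linear (P y)" using lin[OF y] linear_conv_bounded_linear by blast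
      then show "((\<lambda>z. \<Psi> z - P y z) has_derivative (\<lambda>w. P z w - P y w)) (at z within ?X)"
        by (intro has_derivative_diff has_derivative_at_withinI[OF dP[OF zX]] bounded_linear_imp_has_derivative)
      have zy: "norm (z - y) \<le> norm (v - y)" using segment_bound(1)[OF z] by (simp add: norm_minus_commute)
      show "onorm (\<lambda>w. P z w - P y w) \<le> L1 * norm (v - y)"
      proof (rule onorm_bound)
        fix w
        have "norm (P z w - P y w) \<le> L1 * norm (z - y) * norm w" by (rule L1[OF zX y])
        also have "\<dots> \<le> L1 * norm (v - y) * norm w" using zy L1nn by (intro mult_right_mono mult_left_mono) auto
        finally show "norm (P z w - P y w) \<le> L1 * norm (v - y) * norm w" .
      qed (use L1nn in auto)
    qed auto
    then show ?thesis by (simp add: linear_diff[OF lin[OF y]] power2_eq_square algebra_simps)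
  qed
  obtain B where B: "B \<ge> 0" "\<And>v w. v \<in> X \<Longrightarrow> norm (P v w) \<le> B * norm w"
    using C1_bounded_derivative[OF C2_imp_C1[OF \<Psi>] X(1,3)] unfolding P_def by blast
  have entry: "bounded_lipschitz X (\<lambda>v. P v w $ k)" for w k
    unfolding bounded_lipschitz_def
  proof (intro exI[of _ "B * norm w + L w"] ballI conjI)
    fix v assume v: "v \<in> X"
    have "\<bar>P v w $ k\<bar> \<le> norm (P v w)" by (rule component_le_norm_cart)
    then show "\<bar>P v w $ k\<bar> \<le> B * norm w + L w" using B(2)[OF v, of w] L(1)[of w] by linarith
    fix y assume y: "y \<in> X"
    have "\<bar>P v w $ k - P y w $ k\<bar> \<le> norm (P v w - P y w)"
      using component_le_norm_cart[of "P v w - P y w" k] by simp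
    also have "\<dots> \<le> L w * norm (v - y)" by (rule L(2)[OF v y])
    also have "\<dots> \<le> (B * norm w + L w) * norm (v - y)" using B(1) by (intro mult_right_mono) auto
    finally show "\<bar>P v w $ k - P y w $ k\<bar> \<le> (B * norm w + L w) * norm (v - y)" .
  qed
  have "bounded_lipschitz X (\<lambda>v. jac (P v))"
    unfolding jac_def
    by (intro bounded_lipschitz_abs bounded_lipschitz_det) (simp add: matrix_def to_wo_vec_def entry)
  then obtain Q where Q: "\<And>v. v \<in> X \<Longrightarrow> \<bar>jac (P v)\<bar> \<le> Q"
      "\<And>v y. v \<in> X \<Longrightarrow> y \<in> X \<Longrightarrow> \<bar>jac (P v) - jac (P y)\<bar> \<le> Q * norm (v - y)"
    unfolding bounded_lipschitz_def by blast
  have Qnn: "Q \<ge> 0" using False Q(1) by fastforce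
  have "Q-lipschitz_on X (\<lambda>v. jac (P v))"
    by (rule lipschitz_onI) (use Q(2) Qnn in \<open>auto simp: dist_norm\<close>)
  then have "continuous_on X (\<lambda>v. jac (P v))" by (rule lipschitz_on_continuous_on)
  then obtain y0 where y0: "y0 \<in> X" "\<And>v. v \<in> X \<Longrightarrow> jac (P y0) \<le> jac (P v)"
    using continuous_attains_inf[OF X(1) False] by blast
  define m where "m = jac (P y0)"
  have m: "m > 0" unfolding m_def using jac_pos[OF lin inj] y0(1) by blast
  have ratio: "jac (P v) \<le> exp (Q / m * norm (v - y)) * jac (P y)" if v: "v \<in> X" and y: "y \<in> X" for v y
  proof -
    have my: "m \<le> jac (P y)" unfolding m_def by (rule y0(2)[OF y])
    have "jac (P v) \<le> jac (P y) + Q * norm (v - y)" using Q(2)[OF v y] by linarith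
    also have "Q * norm (v - y) = (Q / m * norm (v - y)) * m" using m by simp
    also have "\<dots> \<le> (Q / m * norm (v - y)) * jac (P y)" using my Qnn m by (intro mult_left_mono) auto
    also have "jac (P y) + (Q / m * norm (v - y)) * jac (P y) = (1 + Q / m * norm (v - y)) * jac (P y)"
      by (simp add: algebra_simps)
    also have "\<dots> \<le> exp (Q / m * norm (v - y)) * jac (P y)"
      using my m by (intro mult_right_mono exp_ge_add_one_self) auto
    finally show ?thesis by simp
  qed
  let ?S = "X \<times> sphere 0 1 :: ((real ^ 'n) \<times> (real ^ 'n)) set"
  have "axis undefined 1 \<in> sphere (0 :: real ^ 'n) 1" by simp
  then have Sne: "?S \<noteq> {}" using False by blast
  have contP: "continuous_on X (\<lambda>v. P v b)" for b
    using C2_imp_C1[OF \<Psi>] X(3) unfolding P_def by (auto intro: continuous_on_subset)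
  have "continuous_on ?S (\<lambda>p. \<Sum>b\<in>Basis. (snd p \<bullet> b) *\<^sub>R P (fst p) b)"
    by (intro continuous_intros continuous_on_compose2[OF contP]) auto
  moreover have "(\<Sum>b\<in>Basis. (w \<bullet> b) *\<^sub>R P y b) = P y w" if "y \<in> X" for y w
  proof -
    have "P y (\<Sum>b\<in>Basis. (w \<bullet> b) *\<^sub>R b) = (\<Sum>b\<in>Basis. (w \<bullet> b) *\<^sub>R P y b)"
      using lin[OF that] by (simp add: linear_sum linear_scale)
    then show ?thesis by (simp add: euclidean_representation)
  qed
  ultimately have "continuous_on ?S (\<lambda>p. P (fst p) (snd p))"
    by (rule continuous_on_eq) auto
  then have "continuous_on ?S (\<lambda>p. norm (P (fst p) (snd p)))" by (rule continuous_on_norm)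
  moreover have "compact ?S" using X by (intro compact_Times) auto
  ultimately obtain p where p: "p \<in> ?S" "\<And>q. q \<in> ?S \<Longrightarrow> norm (P (fst p) (snd p)) \<le> norm (P (fst q) (snd q))"
    using continuous_attains_inf[OF _ Sne] by blast
  define k where "k = norm (P (fst p) (snd p))"
  have k: "k > 0"
  proof -
    have "snd p \<noteq> 0" using p(1) by auto
    then have "P (fst p) (snd p) \<noteq> P (fst p) 0" using inj[of "fst p"] p(1) by (auto simp: inj_eq)
    then show ?thesis using linear_0[OF lin, of "fst p"] p(1) by (auto simp: k_def)
  qed
  have lower: "norm w \<le> 1 / k * norm (P y w)" if y: "y \<in> X" for y w
  proof (cases "w = 0")
    case False
    let ?w = "(1 / norm w) *\<^sub>R w"
    have "k \<le> norm (P y ?w)" using p(2)[of "(y, ?w)"] y False by (simp add: k_def)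
    also have "\<dots> = norm (P y w) / norm w" by (simp add: linear_scale[OF lin[OF y]])
    finally show ?thesis using False k by (simp add: field_simps)
  next
    case True
    have "0 \<le> 1 / k * norm (P y w)" using k by (intro mult_nonneg_nonneg) auto
    then show ?thesis using True by simp
  qed
  define C where "C = L1 + B + Q / m + 1 / k"
  have C: "L1 \<le> C" "B \<le> C" "Q / m \<le> C" "1 / k \<le> C" "C \<ge> 0"
    using L1nn B(1) Qnn m k by (auto simp: C_def)
  show ?thesis
  proof (intro exI[of _ C] conjI ballI allI C)
    fix y v assume y: "y \<in> X" and v: "v \<in> X"
    show "norm (\<Psi> v - \<Psi> y - P y (v - y)) \<le> C * (norm (v - y))\<^sup>2"
      using taylor[OF v y] C(1) by (meson mult_right_mono order_trans zero_le_power2)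
    show "jac (P v) > 0" using jac_pos[OF lin inj] v by blast
    have "exp (Q / m * norm (v - y)) * jac (P y) \<le> exp (C * norm (v - y)) * jac (P y)"
      using C(3) jac_pos[OF lin inj, OF y y]
      by (intro mult_right_mono exp_le_cancel_iff[THEN iffD2]) auto
    then show "jac (P v) \<le> exp (C * norm (v - y)) * jac (P y)" using ratio[OF v y] by linarith
    fix w
    show "norm w \<le> C * norm (P y w)" using lower[OF y, of w] C(4) by (meson mult_right_mono norm_ge_zero order_trans)
    show "norm (P y w) \<le> C * norm w" using B(2)[OF y, of w] C(2) by (meson mult_right_mono norm_ge_zero order_trans)
  qed
qed

section \<open>Uniform inverse branches\<close>

context riemannian_local_diffeo
begin

text \<open>
  The map \<open>\<Psi>\<close> is the inverse branch of \<open>f\<close> at \<open>f x\<close> that returns to \<open>x\<close>, in coordinates. One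
  number \<open>e\<close> controls everything: it is the radius of the domain, and \<open>1 / e\<close> bounds the Taylor
  remainder, the distortion and the derivative. The condition weakens as \<open>e\<close> decreases, so that
  finitely many scales can be replaced by their minimum.
\<close>

definition inverse_branch ::
  "('a, 'n) chart \<Rightarrow> ('a, 'n) chart \<Rightarrow> real \<Rightarrow> 'a \<Rightarrow> (real ^ 'n \<Rightarrow> real ^ 'n) \<Rightarrow> (real ^ 'n \<Rightarrow> real ^ 'n \<Rightarrow> real ^ 'n) \<Rightarrow> bool"
where
  "inverse_branch c d e x \<Psi> P \<longleftrightarrow>
     (let y = snd d (f x) in
      \<Psi> y = snd c x \<and>
      (\<forall>v\<in>ball y e. v \<in> snd d ` fst d \<and> \<Psi> v \<in> snd c ` fst c \<and> f (chart_inv c (\<Psi> v)) = chart_inv d v \<and>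
         (\<Psi> has_derivative P v) (at v) \<and>
         norm (\<Psi> v - \<Psi> y - P y (v - y)) \<le> 1 / e * (norm (v - y))\<^sup>2 \<and>
         jac (P v) > 0 \<and>
         jac (P v) \<le> exp (1 / e * norm (v - y)) * jac (P y) \<and>
         jac (P y) \<le> exp (1 / e * norm (v - y)) * jac (P v)) \<and>
      (\<forall>w. coord_deriv c d x (P y w) = w \<and> norm w \<le> 1 / e * norm (P y w) \<and> norm (P y w) \<le> 1 / e * norm w))"

lemma inverse_branch_mono:
  assumes b: "inverse_branch c d e x \<Psi> P" and e: "0 < e'" "e' \<le> e"
  shows "inverse_branch c d e' x \<Psi> P"
proof -
  have inv: "1 / e \<le> 1 / e'" using e by (simp add: frac_le)
  have k: "r \<le> 1 / e * t \<Longrightarrow> t \<ge> 0 \<Longrightarrow> r \<le> 1 / e' * t" for r t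
    using inv by (meson mult_right_mono order_trans)
  have kk: "1 / e * t \<le> 1 / e' * t" if "t \<ge> 0" for t using inv that by (intro mult_right_mono)
  have ex: "r \<le> exp (1 / e * t) * s \<Longrightarrow> t \<ge> 0 \<Longrightarrow> s > 0 \<Longrightarrow> r \<le> exp (1 / e' * t) * s" for r s t
    using kk[of t] by (meson exp_le_cancel_iff less_imp_le mult_right_mono order_trans)
  let ?y = "snd d (f x)"
  have y: "?y \<in> ball ?y e" using e by simp
  show ?thesis
    unfolding inverse_branch_def Let_def
  proof (intro conjI ballI allI)
    fix v assume "v \<in> ball ?y e'"
    then have v: "v \<in> ball ?y e" using e by auto
    note B = b[unfolded inverse_branch_def Let_def, THEN conjunct2, THEN conjunct1, rule_format]
    note Bv = B[OF v] and By = B[OF y]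
    show "v \<in> snd d ` fst d" "\<Psi> v \<in> snd c ` fst c" "f (chart_inv c (\<Psi> v)) = chart_inv d v"
      "(\<Psi> has_derivative P v) (at v)" "jac (P v) > 0" using Bv by blast+
    show "norm (\<Psi> v - \<Psi> ?y - P ?y (v - ?y)) \<le> 1 / e' * (norm (v - ?y))\<^sup>2"
      using Bv by (intro k) auto
    show "jac (P v) \<le> exp (1 / e' * norm (v - ?y)) * jac (P ?y)" using Bv By by (intro ex) auto
    show "jac (P ?y) \<le> exp (1 / e' * norm (v - ?y)) * jac (P v)" using Bv By by (intro ex) auto
  next
    fix w
    note B = b[unfolded inverse_branch_def Let_def, THEN conjunct2, THEN conjunct2, rule_format, of w]
    show "coord_deriv c d x (P ?y w) = w" using B by blast
    show "norm w \<le> 1 / e' * norm (P ?y w)" "norm (P ?y w) \<le> 1 / e' * norm w"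
      by (rule k[OF _ norm_ge_zero], use B in blast)+
  qed (use b in \<open>auto simp: inverse_branch_def Let_def\<close>)
qed

lemma local_inverse_branch:
  assumes x0: "x0 \<in> M" and c: "c \<in> charts_at A x0" and d: "d \<in> charts_at A (f x0)"
  shows "\<exists>N e. openin (top_of_set M) N \<and> x0 \<in> N \<and> 0 < e \<and> (\<forall>x\<in>N. \<exists>\<Psi> P. inverse_branch c d e x \<Psi> P)"
proof -
  obtain W S \<Psi> where W: "openin (top_of_set M) W" "x0 \<in> W" "W \<subseteq> fst c" "f ` W \<subseteq> fst d"
    "open S" "S = snd d ` f ` W" "Ck_on 2 (snd c ` W) (local_rep f c d)" "Ck_on 2 S \<Psi>"
    "\<And>x. x \<in> W \<Longrightarrow> \<Psi> (snd d (f x)) = snd c x"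
    using local_inverse[OF assms] by metis
  have cA: "c \<in> A" and dA: "d \<in> A" using c d by (auto simp: charts_at_def)
  have WM: "W \<subseteq> M" using W(1) by (rule openin_imp_subset)
  have chW: "c \<in> charts_at A x" "d \<in> charts_at A (f x)" if "x \<in> W" for x
    using that W cA dA by (auto simp: charts_at_def)
  define P where "P = (\<lambda>y. frechet_derivative \<Psi> (at y))"
  have dP: "(\<Psi> has_derivative P v) (at v)" if "v \<in> S" for v
    using W(8) that unfolding P_def by (simp add: numeral_2_eq_2 frechet_derivative_works[symmetric])
  have DP: "coord_deriv c d x (P (snd d (f x)) w) = w" if x: "x \<in> W" for x w
  proof -
    have xS: "snd d (f x) \<in> S" using x W(6) by auto
    have eq: "(local_rep f c d \<circ> \<Psi>) v = v" if v: "v \<in> S" for v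
      using v W(3,4,9) cA unfolding W(6) by (auto simp: local_rep_def)
    have "(local_rep f c d \<circ> \<Psi> has_derivative coord_deriv c d x \<circ> P (snd d (f x))) (at (snd d (f x)))"
      using coord_deriv_works(1)[OF _ chW[OF x]] W(9)[OF x] x WM by (intro diff_chain_at dP[OF xS]) auto
    then have "((\<lambda>v. v) has_derivative coord_deriv c d x \<circ> P (snd d (f x))) (at (snd d (f x)))"
      by (rule has_derivative_transform_within_open[OF _ W(5) xS]) (rule eq)
    then have "coord_deriv c d x \<circ> P (snd d (f x)) = (\<lambda>w. w)"
      using has_derivative_unique has_derivative_ident by blast
    then show ?thesis by (metis comp_apply)
  qed
  have inj: "inj (P v)" if v: "v \<in> S" for v
  proof -
    obtain x where "x \<in> W" "v = snd d (f x)" using v unfolding W(6) by blast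
    then show ?thesis using DP by (metis injI)
  qed
  define y0 where "y0 = snd d (f x0)"
  have "y0 \<in> S" using W(2,6) by (auto simp: y0_def)
  then obtain s' where s': "s' > 0" "cball y0 s' \<subseteq> S" using W(5) open_contains_cball by blast
  define s where "s = s' / 2"
  have s: "s > 0" "cball y0 (2 * s) \<subseteq> S" using s' by (auto simp: s_def)
  let ?X = "cball y0 (2 * s)"
  have "\<exists>C\<ge>0. \<forall>y\<in>?X. \<forall>v\<in>?X. norm (\<Psi> v - \<Psi> y - P y (v - y)) \<le> C * (norm (v - y))\<^sup>2 \<and>
      jac (P v) > 0 \<and> jac (P v) \<le> exp (C * norm (v - y)) * jac (P y) \<and>
      (\<forall>w. norm w \<le> C * norm (P y w) \<and> norm (P y w) \<le> C * norm w)"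
    unfolding P_def by (rule C2_estimates[OF W(8)]) (use s inj in \<open>auto simp: P_def\<close>)
  then obtain C where C: "C \<ge> 0" and est: "\<And>y v. y \<in> ?X \<Longrightarrow> v \<in> ?X \<Longrightarrow> norm (\<Psi> v - \<Psi> y - P y (v - y)) \<le> C * (norm (v - y))\<^sup>2 \<and>
      jac (P v) > 0 \<and> jac (P v) \<le> exp (C * norm (v - y)) * jac (P y) \<and>
      (\<forall>w. norm w \<le> C * norm (P y w) \<and> norm (P y w) \<le> C * norm w)"
    by blast
  define e where "e = min s (1 / (C + 1))"
  have e: "e > 0" "e \<le> s" "C \<le> 1 / e"
  proof -
    show "e > 0" "e \<le> s" using s C by (auto simp: e_def)
    have "1 / (1 / (C + 1)) \<le> 1 / e" using C \<open>e > 0\<close> by (intro divide_left_mono) (auto simp: e_def)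
    then show "C \<le> 1 / e" by simp
  qed
  define N where "N = W \<inter> (snd d \<circ> f) -` ball y0 s"
  have "continuous_on W f" using continuous_f WM continuous_on_subset by blast
  then have "continuous_on W (snd d \<circ> f)"
    using chart_facts(4)[OF dA] W(4) by (intro continuous_on_compose) (auto intro: continuous_on_subset)
  then have "openin (top_of_set W) N" unfolding N_def by (rule continuous_openin_preimage_gen) simp
  then have N: "openin (top_of_set M) N" using W(1) openin_trans by blast
  have "inverse_branch c d e x \<Psi> P" if x: "x \<in> N" for x
  proof -
    have xW: "x \<in> W" using x by (auto simp: N_def)
    let ?y = "snd d (f x)"
    have y: "?y \<in> ?X" "dist y0 ?y < s" using x s by (auto simp: N_def)
    have k: "r \<le> C * t \<Longrightarrow> t \<ge> 0 \<Longrightarrow> r \<le> 1 / e * t" for r t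
      using e(3) by (meson mult_right_mono order_trans)
    have kk: "C * t \<le> 1 / e * t" if "t \<ge> 0" for t using e(3) that by (intro mult_right_mono)
    have ex: "r \<le> exp (C * t) * q \<Longrightarrow> t \<ge> 0 \<Longrightarrow> q > 0 \<Longrightarrow> r \<le> exp (1 / e * t) * q" for r q t
      using kk[of t] by (meson exp_le_cancel_iff less_imp_le mult_right_mono order_trans)
    show ?thesis
      unfolding inverse_branch_def Let_def
    proof (intro conjI ballI allI)
      show "\<Psi> ?y = snd c x" by (rule W(9)[OF xW])
      fix v assume "v \<in> ball ?y e"
      then have "dist y0 v \<le> 2 * s" using y(2) e(2) dist_triangle[of y0 v ?y] by (auto simp: dist_commute)
      then have v: "v \<in> ?X" by simp
      then have vS: "v \<in> S" using s by blast
      then obtain x' where x': "x' \<in> W" "v = snd d (f x')" unfolding W(6) by blast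
      show "v \<in> snd d ` fst d" using x' W(4) by auto
      show "\<Psi> v \<in> snd c ` fst c" using x' W(3,9) by auto
      show "f (chart_inv c (\<Psi> v)) = chart_inv d v" using x' W(3,4,9) cA dA by (auto simp: subset_iff)
      show "(\<Psi> has_derivative P v) (at v)" by (rule dP[OF vS])
      show "jac (P v) > 0" using est[OF y(1) v] by blast
      show "norm (\<Psi> v - \<Psi> ?y - P ?y (v - ?y)) \<le> 1 / e * (norm (v - ?y))\<^sup>2"
        using est[OF y(1) v] by (intro k) auto
      show "jac (P v) \<le> exp (1 / e * norm (v - ?y)) * jac (P ?y)"
        using est[OF y(1) v] est[OF y(1) y(1)] by (intro ex) auto
      show "jac (P ?y) \<le> exp (1 / e * norm (v - ?y)) * jac (P v)"
        using est[OF v y(1)] est[OF v v] by (intro ex) (auto simp: norm_minus_commute)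
    next
      fix w
      show "coord_deriv c d x (P ?y w) = w" by (rule DP[OF xW])
      show "norm w \<le> 1 / e * norm (P ?y w)" "norm (P ?y w) \<le> 1 / e * norm w"
        by (rule k[OF _ norm_ge_zero], use est[OF y(1) y(1)] in blast)+
    qed
  qed
  moreover have "x0 \<in> N" using W(2) s(1) by (simp add: N_def y0_def)
  ultimately show ?thesis using N e(1) by blast
qed

lemma compact_chart_piece:
  assumes c: "c \<in> A" and K: "compact K" "K \<subseteq> snd c ` fst c"
  shows "compact (chart_inv c ` K)" "chart_inv c ` K \<subseteq> M"
    and "x \<in> chart_inv c ` K \<longleftrightarrow> x \<in> fst c \<and> snd c x \<in> K"
proof -
  show "compact (chart_inv c ` K)"
    using chart_facts(5)[OF c] K by (intro compact_continuous_image) (auto intro: continuous_on_subset)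
  have "chart_inv c ` K \<subseteq> fst c" using K(2) chart_facts(6)[OF c] by blast
  then show "chart_inv c ` K \<subseteq> M" using chart_facts(2)[OF c] by blast
  show "x \<in> chart_inv c ` K \<longleftrightarrow> x \<in> fst c \<and> snd c x \<in> K"
    using K(2) c snd_chart_inv[OF c] by (auto simp: image_iff) (metis chart_inv_snd subsetD)
qed

text \<open>
  The points of one piece with image in another piece form a compact set, and
  \<open>local_inverse_branch\<close> holds near each of them with one scale.
\<close>

lemma uniform_inverse_branch_pair:
  assumes c: "c \<in> A" and K: "compact K" "K \<subseteq> snd c ` fst c"
    and d: "d \<in> A" and K': "compact K'" "K' \<subseteq> snd d ` fst d"
  shows "\<exists>e>0. \<forall>x\<in>chart_inv c ` K. f x \<in> chart_inv d ` K' \<longrightarrow> (\<exists>\<Psi> P. inverse_branch c d e x \<Psi> P)"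
proof -
  note ck = compact_chart_piece[OF c K] and dk = compact_chart_piece[OF d K']
  define Q where "Q = chart_inv c ` K \<inter> f -` (chart_inv d ` K')"
  have "closedin (top_of_set (chart_inv c ` K)) Q"
    unfolding Q_def
    by (rule continuous_closedin_preimage)
       (use continuous_f ck dk compact_imp_closed in \<open>auto intro: continuous_on_subset\<close>)
  then have Q: "compact Q" using ck(1) closedin_compact by blast
  have QM: "Q \<subseteq> M" using ck(2) by (auto simp: Q_def)
  define R where "R N e \<longleftrightarrow> openin (top_of_set M) N \<and> 0 < e \<and> (\<forall>x\<in>N. \<exists>\<Psi> P. inverse_branch c d e x \<Psi> P)" for N e
  have "\<exists>N. x \<in> N \<and> (\<exists>e. R N e)" if "x \<in> Q" for x
    using local_inverse_branch[of x c d] that QM ck(3)[of x] dk(3)[of "f x"] c d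
    unfolding R_def Q_def charts_at_def by blast
  then obtain N where N: "\<And>x. x \<in> Q \<Longrightarrow> x \<in> N x" "\<And>x. x \<in> Q \<Longrightarrow> \<exists>e. R (N x) e" by metis
  then obtain e where e: "\<And>x. x \<in> Q \<Longrightarrow> R (N x) (e x)" by metis
  have "\<exists>O'. open O' \<and> N x = M \<inter> O'" if "x \<in> Q" for x
    using e[OF that] unfolding R_def openin_open by blast
  then obtain O' where O': "\<And>x. x \<in> Q \<Longrightarrow> open (O' x)" "\<And>x. x \<in> Q \<Longrightarrow> N x = M \<inter> O' x" by metis
  have "Q \<subseteq> (\<Union>x\<in>Q. O' x)" using N(1) O'(2) by blast
  then obtain F where F: "F \<subseteq> Q" "finite F" "Q \<subseteq> (\<Union>x\<in>F. O' x)"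
    using compactE_image[OF Q, of Q O'] O'(1) by blast
  define E where "E = Min (insert 1 (e ` F))"
  have E: "E > 0" "\<And>x. x \<in> F \<Longrightarrow> E \<le> e x"
    using F e by (auto simp: E_def R_def)
  have "\<exists>\<Psi> P. inverse_branch c d E x \<Psi> P" if x: "x \<in> Q" for x
  proof -
    obtain z where z: "z \<in> F" "x \<in> O' z" using F x by blast
    then have zQ: "z \<in> Q" "x \<in> N z" using F(1) O'(2) x QM by auto
    then obtain \<Psi> P where "inverse_branch c d (e z) x \<Psi> P" using e[OF zQ(1)] unfolding R_def by blast
    then show ?thesis using inverse_branch_mono E z(1) by blast
  qed
  then show ?thesis using E(1) unfolding Q_def by blast
qed

text \<open>
  Finitely many closed coordinate balls cover the manifold, and the balls of twice the radius
  still lie in their charts. The doubled balls leave room for neighbourhoods of uniform size.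
\<close>

lemma finite_pieces:
  "\<exists>J. finite J \<and> (\<forall>(c, z, r)\<in>J. c \<in> A \<and> 0 < r \<and> cball z (2 * r) \<subseteq> snd c ` fst c) \<and>
     M \<subseteq> (\<Union>(c, z, r)\<in>J. chart_inv c ` cball z r)"
proof -
  define G where "G = {(c, z, r). c \<in> A \<and> 0 < r \<and> cball z (2 * r) \<subseteq> snd c ` fst c}"
  have "\<exists>p\<in>G. x \<in> (case p of (c, z, r) \<Rightarrow> chart_inv c ` ball z r)" if x: "x \<in> M" for x
  proof -
    obtain c where c: "c \<in> A" "x \<in> fst c" using chart_cover[OF x] by blast
    then obtain r where r: "r > 0" "cball (snd c x) r \<subseteq> snd c ` fst c"
      using chart_facts(3)[OF c(1)] open_contains_cball by blast
    show ?thesis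
      using c r by (intro bexI[of _ "(c, snd c x, r / 2)"]) (auto simp: G_def image_iff intro!: bexI[of _ "snd c x"])
  qed
  then obtain p where p: "\<And>x. x \<in> M \<Longrightarrow> p x \<in> G" "\<And>x. x \<in> M \<Longrightarrow> x \<in> (case p x of (c, z, r) \<Rightarrow> chart_inv c ` ball z r)"
    by metis
  have "\<exists>O'. open O' \<and> (case q of (c, z, r) \<Rightarrow> chart_inv c ` ball z r) = M \<inter> O'" if "q \<in> G" for q
  proof -
    obtain c z r where q: "q = (c, z, r)" by (cases q)
    have "ball z r \<subseteq> cball z (2 * r)" using that q by (auto simp: G_def)
    then have "ball z r \<subseteq> snd c ` fst c" using that q unfolding G_def by blast
    then have "openin (top_of_set M) (chart_inv c ` ball z r)"
      using that q by (intro chart_inv_image_openin) (auto simp: G_def)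
    then show ?thesis unfolding q openin_open by auto
  qed
  then obtain O' where O': "\<And>q. q \<in> G \<Longrightarrow> open (O' q)"
     "\<And>q. q \<in> G \<Longrightarrow> (case q of (c, z, r) \<Rightarrow> chart_inv c ` ball z r) = M \<inter> O' q" by metis
  have "M \<subseteq> (\<Union>q\<in>p ` M. O' q)"
  proof
    fix x assume x: "x \<in> M"
    have "x \<in> M \<inter> O' (p x)" using p(2)[OF x] O'(2)[OF p(1)[OF x]] by simp
    then show "x \<in> (\<Union>q\<in>p ` M. O' q)" using x by blast
  qed
  moreover have "open (O' q)" if "q \<in> p ` M" for q using that O'(1) p(1) by blast
  ultimately obtain J where J: "J \<subseteq> p ` M" "finite J" "M \<subseteq> (\<Union>q\<in>J. O' q)"
    using compactE_image[OF compact_M, of "p ` M" O'] by blast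
  have JG: "J \<subseteq> G" using J(1) p(1) by auto
  have "M \<subseteq> (\<Union>(c, z, r)\<in>J. chart_inv c ` cball z r)"
  proof
    fix x assume x: "x \<in> M"
    then obtain q where q: "q \<in> J" "x \<in> O' q" using J(3) by blast
    obtain c z r where cz: "q = (c, z, r)" by (cases q)
    have "x \<in> (case q of (c, z, r) \<Rightarrow> chart_inv c ` ball z r)" using O'(2)[of q] JG q x by blast
    then have "x \<in> chart_inv c ` cball z r" using ball_subset_cball unfolding cz by auto
    then show "x \<in> (\<Union>(c, z, r)\<in>J. chart_inv c ` cball z r)"
      using q(1) cz by (intro UN_I[of q]) auto
  qed
  then show ?thesis using J(2) JG by (intro exI[of _ J]) (auto simp: G_def)
qed

end

text \<open>
  A triple in \<open>J\<close> is a chart together with the centre and the radius of a closed ball in it.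
\<close>

locale covered_local_diffeo = riemannian_local_diffeo M A g f
  for M :: "'a::t2_space set" and A :: "('a, 'n::finite) chart set" and g :: "('a, 'n) metric" and f :: "'a \<Rightarrow> 'a" +
  fixes J :: "(('a, 'n) chart \<times> (real ^ 'n) \<times> real) set"
  assumes finite_J: "finite J"
    and J_charts: "\<And>c z r. (c, z, r) \<in> J \<Longrightarrow> c \<in> A \<and> 0 < r \<and> cball z (2 * r) \<subseteq> snd c ` fst c"
    and J_cover: "M \<subseteq> (\<Union>(c, z, r)\<in>J. chart_inv c ` cball z r)"
begin

definition piece :: "('a, 'n) chart \<times> (real ^ 'n) \<times> real \<Rightarrow> (real ^ 'n) set" where
  "piece p = cball (fst (snd p)) (snd (snd p))"

definition big_piece :: "('a, 'n) chart \<times> (real ^ 'n) \<times> real \<Rightarrow> (real ^ 'n) set" where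
  "big_piece p = cball (fst (snd p)) (2 * snd (snd p))"

definition in_piece :: "('a, 'n) chart \<times> (real ^ 'n) \<times> real \<Rightarrow> 'a \<Rightarrow> bool" where
  "in_piece p x \<longleftrightarrow> x \<in> chart_inv (fst p) ` piece p"

lemma piece_facts:
  assumes "p \<in> J"
  shows "fst p \<in> A" "snd (snd p) > 0" "compact (piece p)" "compact (big_piece p)" "piece p \<subseteq> big_piece p"
    "big_piece p \<subseteq> snd (fst p) ` fst (fst p)" "piece p \<subseteq> snd (fst p) ` fst (fst p)"
proof -
  obtain c z r where p: "p = (c, z, r)" by (cases p)
  show *: "fst p \<in> A" "snd (snd p) > 0" "big_piece p \<subseteq> snd (fst p) ` fst (fst p)"
    using J_charts[of c z r] assms by (auto simp: p big_piece_def)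
  show "compact (piece p)" "compact (big_piece p)" by (auto simp: piece_def big_piece_def)
  show "piece p \<subseteq> big_piece p" using * by (auto simp: piece_def big_piece_def)
  then show "piece p \<subseteq> snd (fst p) ` fst (fst p)" using * by blast
qed

lemma in_pieceD:
  assumes "p \<in> J" "in_piece p x"
  shows "x \<in> M" "fst p \<in> charts_at A x" "snd (fst p) x \<in> piece p"
proof -
  note pf = piece_facts[OF assms(1)]
  note cp = compact_chart_piece[OF pf(1,3,7)]
  show "x \<in> M" using assms(2) cp(2) by (auto simp: in_piece_def)
  show "fst p \<in> charts_at A x" "snd (fst p) x \<in> piece p"
    using assms(2) cp(3)[of x] pf(1) unfolding in_piece_def charts_at_def by blast+
qed

lemma piece_exists:
  assumes "x \<in> M"
  obtains p where "p \<in> J" "in_piece p x"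
proof -
  obtain c z r where "(c, z, r) \<in> J" "x \<in> chart_inv c ` cball z r" using J_cover assms by blast
  then show thesis by (intro that[of "(c, z, r)"]) (auto simp: in_piece_def piece_def)
qed

lemma uniform_inverse_branch:
  "\<exists>e>0. \<forall>p\<in>J. \<forall>q\<in>J. \<forall>x. in_piece p x \<longrightarrow> in_piece q (f x) \<longrightarrow>
     (\<exists>\<Psi> P. inverse_branch (fst p) (fst q) e x \<Psi> P)"
proof -
  have "\<exists>e>0. \<forall>x. in_piece p x \<longrightarrow> in_piece q (f x) \<longrightarrow> (\<exists>\<Psi> P. inverse_branch (fst p) (fst q) e x \<Psi> P)"
    if "p \<in> J" "q \<in> J" for p q
    using uniform_inverse_branch_pair[OF piece_facts(1,3,7)[OF that(1)] piece_facts(1,3,7)[OF that(2)]]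
    unfolding in_piece_def by blast
  then obtain e where e: "\<And>p q. p \<in> J \<Longrightarrow> q \<in> J \<Longrightarrow> e p q > 0"
    "\<And>p q x. p \<in> J \<Longrightarrow> q \<in> J \<Longrightarrow> in_piece p x \<Longrightarrow> in_piece q (f x) \<Longrightarrow> \<exists>\<Psi> P. inverse_branch (fst p) (fst q) (e p q) x \<Psi> P"
    by metis
  define E where "E = Min (insert 1 ((\<lambda>(p, q). e p q) ` (J \<times> J)))"
  have fin: "finite (insert 1 ((\<lambda>(p, q). e p q) ` (J \<times> J)))" using finite_J by auto
  have E: "E > 0" unfolding E_def using fin e(1) by (subst Min_gr_iff) auto
  have "E \<le> e p q" if "p \<in> J" "q \<in> J" for p q
    unfolding E_def using fin that by (intro Min_le) auto
  then show ?thesis using E e(2) inverse_branch_mono by (intro exI[of _ E]) meson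
qed

lemma uniform_cnorm:
  "\<exists>a b. 0 < a \<and> 0 < b \<and> (\<forall>p\<in>J. \<forall>x. in_piece p x \<longrightarrow>
     (\<forall>u. a * norm u \<le> cnorm (fst p) x u \<and> cnorm (fst p) x u \<le> b * norm u))"
proof -
  have "\<exists>a b. 0 < a \<and> 0 < b \<and> (\<forall>x. in_piece p x \<longrightarrow>
     (\<forall>u. a * norm u \<le> cnorm (fst p) x u \<and> cnorm (fst p) x u \<le> b * norm u))" if "p \<in> J" for p
    using cnorm_equivalent[OF piece_facts(1,3,7)[OF that]] unfolding in_piece_def by blast
  then obtain a b where ab: "\<And>p. p \<in> J \<Longrightarrow> 0 < a p" "\<And>p. p \<in> J \<Longrightarrow> 0 < b p"
    "\<And>p x u. p \<in> J \<Longrightarrow> in_piece p x \<Longrightarrow> a p * norm u \<le> cnorm (fst p) x u"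
    "\<And>p x u. p \<in> J \<Longrightarrow> in_piece p x \<Longrightarrow> cnorm (fst p) x u \<le> b p * norm u"
    by metis
  define a' where "a' = Min (insert 1 (a ` J))"
  define b' where "b' = Max (insert 1 (b ` J))"
  have "0 < a'" unfolding a'_def using finite_J ab(1) by (subst Min_gr_iff) auto
  moreover have "0 < b'" unfolding b'_def using finite_J ab(2) by (subst Max_gr_iff) auto
  moreover have "a' \<le> a p" "b p \<le> b'" if "p \<in> J" for p
    unfolding a'_def b'_def using finite_J that by auto
  ultimately show ?thesis
    using ab(3,4) by (intro exI[of _ a'] exI[of _ b']) (meson mult_right_mono norm_ge_zero order_trans)
qed

text \<open>
  A scale for the inverse branches that serves all pairs of pieces.
\<close>

definition e0 :: real where
  "e0 = (SOME e. e > 0 \<and> (\<forall>p\<in>J. \<forall>q\<in>J. \<forall>x. in_piece p x \<longrightarrow> in_piece q (f x) \<longrightarrow>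
     (\<exists>\<Psi> P. inverse_branch (fst p) (fst q) e x \<Psi> P)))"

lemma e0:
  "e0 > 0" "p \<in> J \<Longrightarrow> q \<in> J \<Longrightarrow> in_piece p x \<Longrightarrow> in_piece q (f x) \<Longrightarrow> \<exists>\<Psi> P. inverse_branch (fst p) (fst q) e0 x \<Psi> P"
  using someI_ex[OF uniform_inverse_branch] unfolding e0_def by blast+

text \<open>
  Constants of comparison between the metric and the Euclidean norm that serve all pieces.
\<close>

definition norm_ratio :: "real \<times> real" where
  "norm_ratio = (SOME (a, b). 0 < a \<and> 0 < b \<and> (\<forall>p\<in>J. \<forall>x. in_piece p x \<longrightarrow>
     (\<forall>u. a * norm u \<le> cnorm (fst p) x u \<and> cnorm (fst p) x u \<le> b * norm u)))"

abbreviation a0 :: real where "a0 \<equiv> fst norm_ratio"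
abbreviation b0 :: real where "b0 \<equiv> snd norm_ratio"

lemma ab0:
  "a0 > 0" "b0 > 0" "p \<in> J \<Longrightarrow> in_piece p x \<Longrightarrow> a0 * norm u \<le> cnorm (fst p) x u"
  "p \<in> J \<Longrightarrow> in_piece p x \<Longrightarrow> cnorm (fst p) x u \<le> b0 * norm u"
proof -
  have "\<exists>w. case w of (a, b) \<Rightarrow> 0 < a \<and> 0 < b \<and> (\<forall>p\<in>J. \<forall>x. in_piece p x \<longrightarrow>
     (\<forall>u. a * norm u \<le> cnorm (fst p) x u \<and> cnorm (fst p) x u \<le> b * norm u))"
    using uniform_cnorm by auto
  from someI_ex[OF this] have *: "case norm_ratio of (a, b) \<Rightarrow> 0 < a \<and> 0 < b \<and> (\<forall>p\<in>J. \<forall>x. in_piece p x \<longrightarrow>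
     (\<forall>u. a * norm u \<le> cnorm (fst p) x u \<and> cnorm (fst p) x u \<le> b * norm u))"
    unfolding norm_ratio_def .
  show "a0 > 0" "b0 > 0" "p \<in> J \<Longrightarrow> in_piece p x \<Longrightarrow> a0 * norm u \<le> cnorm (fst p) x u"
    "p \<in> J \<Longrightarrow> in_piece p x \<Longrightarrow> cnorm (fst p) x u \<le> b0 * norm u"
    using * by (auto simp: case_prod_beta)
qed

lemma lam_bounds:
  assumes x: "x \<in> M"
  shows "a0 * e0 / b0 \<le> lam x" "lam x \<le> b0 / (a0 * e0)"
proof -
  obtain p where p: "p \<in> J" "in_piece p x" using piece_exists[OF x] .
  obtain q where q: "q \<in> J" "in_piece q (f x)" using piece_exists[OF f_M[OF x]] .
  note cp = in_pieceD(2)[OF p] and cq = in_pieceD(2)[OF q]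
  obtain \<Psi> P where "inverse_branch (fst p) (fst q) e0 x \<Psi> P" using e0(2)[OF p(1) q(1) p(2) q(2)] by blast
  then have P: "coord_deriv (fst p) (fst q) x (P (snd (fst q) (f x)) w) = w"
      "norm w \<le> 1 / e0 * norm (P (snd (fst q) (f x)) w)" "norm (P (snd (fst q) (f x)) w) \<le> 1 / e0 * norm w" for w
    by (auto simp: inverse_branch_def Let_def)
  let ?P = "P (snd (fst q) (f x))" and ?D = "coord_deriv (fst p) (fst q) x"
  have lp: "lam x > 0" by (rule lam_pos[OF x])
  let ?w = "axis undefined 1 :: real ^ 'n"
  have "a0 * e0 \<le> a0 * norm (?P ?w)" using P(2)[of ?w] e0(1) ab0(1) by (simp add: field_simps)
  also have "\<dots> \<le> cnorm (fst p) x (?P ?w)" by (rule ab0(3)[OF p])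
  also have "\<dots> \<le> lam x * cnorm (fst q) (f x) (?D (?P ?w))" by (rule lam_ge[OF x cp cq])
  also have "\<dots> \<le> lam x * (b0 * norm ?w)" unfolding P(1) by (rule mult_left_mono[OF ab0(4)[OF q] less_imp_le[OF lp]])
  finally show "a0 * e0 / b0 \<le> lam x" using ab0(2) by (simp add: field_simps)
  show "lam x \<le> b0 / (a0 * e0)"
  proof (rule lam_le[OF x cp cq])
    fix u
    have "?D (?P (?D u)) = ?D u" by (rule P(1))
    then have Pu: "?P (?D u) = u" using coord_deriv_works(3)[OF x cp cq] by (auto simp: bij_def inj_eq)
    have "cnorm (fst p) x u \<le> b0 * norm u" by (rule ab0(4)[OF p])
    also have "\<dots> \<le> b0 * (1 / e0 * norm (?D u))" using P(3)[of "?D u"] ab0(2) unfolding Pu by (intro mult_left_mono) auto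
    also have "\<dots> = b0 / (a0 * e0) * (a0 * norm (?D u))" using ab0(1) by simp
    also have "\<dots> \<le> b0 / (a0 * e0) * cnorm (fst q) (f x) (?D u)"
      using ab0(1,2) e0(1) ab0(3)[OF q] by (intro mult_left_mono) auto
    finally show "cnorm (fst p) x u \<le> b0 / (a0 * e0) * cnorm (fst q) (f x) (?D u)" .
  qed (use ab0(1,2) e0(1) in auto)
qed

section \<open>Inverse branches of iterates at hyperbolic times\<close>

text \<open>
  An ellipsoid of this radius stays in the domain of an inverse branch and in the doubled piece.
  The entry with \<open>\<kappa> - 1\<close> makes the Taylor remainder of the branch at \<open>x\<close> at most \<open>(\<kappa> - 1) * lam x\<close>
  times the distance to the centre; \<open>a0 * e0 / b0\<close> in it is the lower bound of \<open>lam\<close>.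
\<close>

definition radius :: "real \<Rightarrow> real" where
  "radius \<kappa> = Min ({a0 * e0, (\<kappa> - 1) * (a0 * e0 / b0) * e0 * a0\<^sup>2 / b0} \<union> (\<lambda>p. a0 * snd (snd p)) ` J)"

lemma radius_facts:
  assumes "\<kappa> > 1"
  shows "radius \<kappa> > 0" "radius \<kappa> \<le> a0 * e0" "radius \<kappa> \<le> (\<kappa> - 1) * (a0 * e0 / b0) * e0 * a0\<^sup>2 / b0"
    "p \<in> J \<Longrightarrow> radius \<kappa> \<le> a0 * snd (snd p)"
proof -
  have fin: "finite ({a0 * e0, (\<kappa> - 1) * (a0 * e0 / b0) * e0 * a0\<^sup>2 / b0} \<union> (\<lambda>p. a0 * snd (snd p)) ` J)"
    using finite_J by auto
  show "radius \<kappa> > 0" unfolding radius_def using fin assms ab0(1,2) e0(1) piece_facts(2)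
    by (subst Min_gr_iff) auto
  show "radius \<kappa> \<le> a0 * e0" "radius \<kappa> \<le> (\<kappa> - 1) * (a0 * e0 / b0) * e0 * a0\<^sup>2 / b0"
    unfolding radius_def by (rule Min_le[OF fin], simp)+
  show "p \<in> J \<Longrightarrow> radius \<kappa> \<le> a0 * snd (snd p)"
    unfolding radius_def by (rule Min_le[OF fin]) (intro UnI2 imageI)
qed

lemma small_cnorm_imp:
  assumes q: "q \<in> J" "in_piece q x" and \<kappa>: "\<kappa> > 1"
    and v: "cnorm (fst q) x (v - snd (fst q) x) < radius \<kappa>"
  shows "v \<in> big_piece q" "norm (v - snd (fst q) x) < e0"
proof -
  have n: "a0 * norm (v - snd (fst q) x) < radius \<kappa>" using ab0(3)[OF q, of "v - snd (fst q) x"] v by linarith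
  then have "a0 * norm (v - snd (fst q) x) < a0 * e0" using radius_facts(2)[OF \<kappa>] by linarith
  then show "norm (v - snd (fst q) x) < e0" using ab0(1) by simp
  have "a0 * norm (v - snd (fst q) x) < a0 * snd (snd q)" using n radius_facts(4)[OF \<kappa> q(1)] by linarith
  then have "dist v (snd (fst q) x) < snd (snd q)" using ab0(1) by (simp add: dist_norm)
  moreover have "dist (fst (snd q)) (snd (fst q) x) \<le> snd (snd q)" using in_pieceD(3)[OF q] by (simp add: piece_def)
  ultimately show "v \<in> big_piece q" unfolding big_piece_def using dist_triangle2[of "fst (snd q)" v "snd (fst q) x"] by simp
qed

text \<open>
  The linear part contracts by \<open>lam x\<close> in the norms at the two points, and the remainder is
  quadratic in the distance.
\<close>

lemma inverse_branch_contracts: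
  assumes p: "p \<in> J" "in_piece p x" and q: "q \<in> J" "in_piece q (f x)"
    and b: "inverse_branch (fst p) (fst q) e0 x \<Psi> P" and \<kappa>: "\<kappa> > 1"
    and v: "cnorm (fst q) (f x) (v - snd (fst q) (f x)) < radius \<kappa>"
  shows "cnorm (fst p) x (\<Psi> v - snd (fst p) x) \<le> \<kappa> * lam x * cnorm (fst q) (f x) (v - snd (fst q) (f x))"
proof -
  have x: "x \<in> M" by (rule in_pieceD(1)[OF p])
  note cp = in_pieceD(2)[OF p] and cq = in_pieceD(2)[OF q]
  let ?y = "snd (fst q) (f x)"
  let ?h = "v - ?y"
  let ?N = "cnorm (fst q) (f x) ?h"
  have vb: "v \<in> ball ?y e0" using small_cnorm_imp(2)[OF q \<kappa> v] by (simp add: dist_norm norm_minus_commute)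
  have y: "\<Psi> ?y = snd (fst p) x" and R: "norm (\<Psi> v - \<Psi> ?y - P ?y ?h) \<le> 1 / e0 * (norm ?h)\<^sup>2"
    and DP: "coord_deriv (fst p) (fst q) x (P ?y ?h) = ?h"
    using b vb unfolding inverse_branch_def Let_def by blast+
  have hN: "norm ?h \<le> ?N / a0" using ab0(3)[OF q, of ?h] ab0(1) by (simp add: field_simps)
  have N0: "?N \<ge> 0" by (rule cnorm_facts(1)[OF cq])
  have "cnorm (fst p) x (\<Psi> v - \<Psi> ?y - P ?y ?h) \<le> b0 * (1 / e0 * (norm ?h)\<^sup>2)"
    using ab0(4)[OF p, of "\<Psi> v - \<Psi> ?y - P ?y ?h"] R ab0(2) by (meson mult_left_mono less_imp_le order_trans)
  also have "\<dots> \<le> b0 * (1 / e0 * (?N / a0)\<^sup>2)"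
    using hN ab0(2) e0(1) by (intro mult_left_mono power_mono) auto
  also have "\<dots> = (b0 / (e0 * a0\<^sup>2) * ?N) * ?N" by (simp add: power2_eq_square)
  also have "\<dots> \<le> ((\<kappa> - 1) * (a0 * e0 / b0)) * ?N"
  proof (rule mult_right_mono[OF _ N0])
    have "?N \<le> (\<kappa> - 1) * (a0 * e0 / b0) * e0 * a0\<^sup>2 / b0" using v radius_facts(3)[OF \<kappa>] by linarith
    then have "b0 / (e0 * a0\<^sup>2) * ?N \<le> b0 / (e0 * a0\<^sup>2) * ((\<kappa> - 1) * (a0 * e0 / b0) * e0 * a0\<^sup>2 / b0)"
      using ab0(1,2) e0(1) by (intro mult_left_mono) auto
    also have "\<dots> = (\<kappa> - 1) * (a0 * e0 / b0)" using ab0(1,2) e0(1) by (simp add: field_simps)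
    finally show "b0 / (e0 * a0\<^sup>2) * ?N \<le> (\<kappa> - 1) * (a0 * e0 / b0)" .
  qed
  also have "\<dots> \<le> ((\<kappa> - 1) * lam x) * ?N"
    using lam_bounds(1)[OF x] \<kappa> N0 by (intro mult_right_mono mult_left_mono) auto
  finally have 1: "cnorm (fst p) x (\<Psi> v - \<Psi> ?y - P ?y ?h) \<le> ((\<kappa> - 1) * lam x) * ?N" .
  have 2: "cnorm (fst p) x (P ?y ?h) \<le> lam x * ?N" using lam_ge[OF x cp cq, of "P ?y ?h"] DP by simp
  have "cnorm (fst p) x (\<Psi> v - snd (fst p) x) \<le> cnorm (fst p) x (\<Psi> v - \<Psi> ?y - P ?y ?h) + cnorm (fst p) x (P ?y ?h)"
    using cnorm_triangle[OF cp, of "\<Psi> v - \<Psi> ?y - P ?y ?h" "P ?y ?h"] y by simp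
  also have "\<dots> \<le> ((\<kappa> - 1) * lam x) * ?N + lam x * ?N" using 1 2 by linarith
  finally show ?thesis by (simp add: algebra_simps)
qed

text \<open>
  The map \<open>\<Phi>\<close> is the inverse branch of \<open>f ^^ n\<close> that returns to \<open>x\<close>, read in the charts of the
  pieces \<open>p\<close> and \<open>q\<close> and defined on the ellipsoid of radius \<open>\<rho>\<close>. Its Jacobian varies by a factor
  of at most \<open>exp G\<close> from the value at the centre.
\<close>

abbreviation iterated_branch where
  "iterated_branch \<kappa> p q n x \<rho> G \<Phi> \<Phi>' \<equiv>
     \<Phi> (snd (fst q) ((f ^^ n) x)) = snd (fst p) x \<and>
     (\<forall>v. cnorm (fst q) ((f ^^ n) x) (v - snd (fst q) ((f ^^ n) x)) < \<rho> \<longrightarrow>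
       (f ^^ n) (chart_inv (fst p) (\<Phi> v)) = chart_inv (fst q) v \<and>
       (\<Phi> has_derivative \<Phi>' v) (at v) \<and>
       cnorm (fst p) x (\<Phi> v - snd (fst p) x) \<le>
         \<kappa> ^ n * (\<Prod>j<n. lam ((f ^^ j) x)) * cnorm (fst q) ((f ^^ n) x) (v - snd (fst q) ((f ^^ n) x)) \<and>
       jac (\<Phi>' v) > 0 \<and>
       jac (\<Phi>' v) \<le> exp G * jac (\<Phi>' (snd (fst q) ((f ^^ n) x))) \<and>
       jac (\<Phi>' (snd (fst q) ((f ^^ n) x))) \<le> exp G * jac (\<Phi>' v))"

text \<open>
  Induction by one inverse branch \<open>\<Psi>\<close> in front: the last \<open>n\<close> steps start at \<open>f x\<close>, for which \<open>n\<close>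
  is a hyperbolic time. Hence their branch maps the ellipsoid into one whose radius is smaller by
  the factor \<open>(\<kappa> * \<sigma>) ^ n\<close>. This lies in the domain of \<open>\<Psi>\<close>, and on it \<open>\<Psi>\<close> contributes an exponent
  proportional to that factor to the distortion. The exponents add up to a geometric sum that is
  bounded independently of \<open>n\<close>. The pieces may be chosen afresh at each point of the orbit; only
  for \<open>n = 0\<close> must the two pieces agree, as the branch is then the identity.
\<close>

lemma iterated_inverse_branch:
  assumes \<kappa>: "\<kappa> > 1" and \<sigma>: "\<sigma> > 0" and \<tau>: "\<kappa> * \<sigma> \<le> 1"
    and p: "p \<in> J" "in_piece p x" and q: "q \<in> J" "in_piece q ((f ^^ n) x)" and pq: "n = 0 \<longrightarrow> p = q"
    and hyp: "hyp \<sigma> x n"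
  shows "\<exists>\<Phi> \<Phi>'. iterated_branch \<kappa> p q n x (radius \<kappa>)
    (radius \<kappa> / (a0 * e0) * (\<Sum>k<n. (\<kappa> * \<sigma>) ^ k)) \<Phi> \<Phi>'"
  using p q pq hyp
proof (induction n arbitrary: x p)
  case 0
  then show ?case
    by (intro exI[of _ "\<lambda>v. v"] exI[of _ "\<lambda>_ v. v"]) (auto simp: jac_id intro: has_derivative_ident)
next
  case (Suc n)
  have x: "x \<in> M" using in_pieceD(1) Suc.prems(1,2) by blast
  obtain s where s: "s \<in> J" "in_piece s (f x)" "n = 0 \<longrightarrow> s = q"
  proof (cases "n = 0")
    case True
    then show thesis using that[of q] Suc.prems by auto
  next
    case False
    then show thesis using piece_exists[OF f_M[OF x]] that by metis
  qed
  have fn: "(f ^^ n) (f x) = (f ^^ Suc n) x" for x by (simp add: funpow_swap1)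
  have tail: "hyp \<sigma> (f x) n"
    using hyp_seq_tail[of \<sigma> "\<lambda>j. lam ((f ^^ j) x)" 1 n] Suc.prems(6) by (simp add: funpow_swap1)
  let ?y = "snd (fst q) ((f ^^ Suc n) x)" and ?N = "cnorm (fst q) ((f ^^ Suc n) x)"
  let ?\<rho> = "radius \<kappa>"
  let ?G = "\<lambda>n. ?\<rho> / (a0 * e0) * (\<Sum>k<n. (\<kappa> * \<sigma>) ^ k)"
  let ?L = "\<lambda>n x. \<Prod>j<n. lam ((f ^^ j) x)"
  let ?z = "snd (fst s) (f x)"
  have "in_piece q ((f ^^ n) (f x))" using Suc.prems(4) unfolding fn .
  from Suc.IH[OF s(1,2) Suc.prems(3) this s(3) tail]
  obtain \<Phi> \<Phi>' where H: "iterated_branch \<kappa> s q n (f x) ?\<rho> (?G n) \<Phi> \<Phi>'" by blast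
  note H = H[unfolded fn]
  have \<Phi>: "\<Phi> ?y = ?z"
    "\<And>v. ?N (v - ?y) < ?\<rho> \<Longrightarrow> (f ^^ n) (chart_inv (fst s) (\<Phi> v)) = chart_inv (fst q) v"
    "\<And>v. ?N (v - ?y) < ?\<rho> \<Longrightarrow> (\<Phi> has_derivative \<Phi>' v) (at v)"
    "\<And>v. ?N (v - ?y) < ?\<rho> \<Longrightarrow> cnorm (fst s) (f x) (\<Phi> v - ?z) \<le> \<kappa> ^ n * ?L n (f x) * ?N (v - ?y)"
    "\<And>v. ?N (v - ?y) < ?\<rho> \<Longrightarrow> jac (\<Phi>' v) > 0"
    "\<And>v. ?N (v - ?y) < ?\<rho> \<Longrightarrow> jac (\<Phi>' v) \<le> exp (?G n) * jac (\<Phi>' ?y)"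
    "\<And>v. ?N (v - ?y) < ?\<rho> \<Longrightarrow> jac (\<Phi>' ?y) \<le> exp (?G n) * jac (\<Phi>' v)"
    using H by blast+
  obtain \<Psi> P where b: "inverse_branch (fst p) (fst s) e0 x \<Psi> P"
    using e0(2)[OF Suc.prems(1) s(1) Suc.prems(2) s(2)] by blast
  have cq: "fst q \<in> charts_at A ((f ^^ Suc n) x)" using in_pieceD(2)[OF Suc.prems(3,4)] .
  have Lpos: "?L n (f x) \<ge> 0"
  proof (intro prod_nonneg)
    fix j
    have "(f ^^ j) (f x) \<in> M" using f_M x by (induction j) auto
    then show "0 \<le> lam ((f ^^ j) (f x))" using lam_pos by (simp add: less_imp_le)
  qed
  have Ln: "\<kappa> ^ n * ?L n (f x) \<le> (\<kappa> * \<sigma>) ^ n"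
  proof -
    have "?L n (f x) \<le> \<sigma> ^ n" using tail by (rule hyp_seq_prod)
    then show ?thesis using \<kappa> by (simp add: power_mult_distrib mult_left_mono)
  qed
  have t01: "(\<kappa> * \<sigma>) ^ n \<le> 1" "(\<kappa> * \<sigma>) ^ n \<ge> 0" using \<tau> \<kappa> \<sigma> by (auto intro: power_le_one)
  have inner: "cnorm (fst s) (f x) (\<Phi> v - ?z) \<le> (\<kappa> * \<sigma>) ^ n * ?\<rho>" "cnorm (fst s) (f x) (\<Phi> v - ?z) < ?\<rho>"
    if v: "?N (v - ?y) < ?\<rho>" for v
  proof -
    have N0: "?N (v - ?y) \<ge> 0" by (rule cnorm_facts(1)[OF cq])
    have *: "cnorm (fst s) (f x) (\<Phi> v - ?z) \<le> (\<kappa> * \<sigma>) ^ n * ?N (v - ?y)"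
      using \<Phi>(4)[OF v] Ln N0 by (meson mult_right_mono order_trans)
    also have "\<dots> \<le> (\<kappa> * \<sigma>) ^ n * ?\<rho>" using v t01 by (intro mult_left_mono) auto
    finally show "cnorm (fst s) (f x) (\<Phi> v - ?z) \<le> (\<kappa> * \<sigma>) ^ n * ?\<rho>" .
    have "(\<kappa> * \<sigma>) ^ n * ?N (v - ?y) \<le> 1 * ?N (v - ?y)" using t01 N0 by (intro mult_right_mono) auto
    then show "cnorm (fst s) (f x) (\<Phi> v - ?z) < ?\<rho>" using * v by linarith
  qed
  have y0: "?N (?y - ?y) < ?\<rho>" using cnorm_facts(3)[OF cq] radius_facts(1)[OF \<kappa>] by simp
  have inball: "\<Phi> v \<in> ball ?z e0" if v: "?N (v - ?y) < ?\<rho>" for v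
    using small_cnorm_imp(2)[OF s(1,2) \<kappa> inner(2)[OF v]] by (simp add: dist_norm norm_minus_commute)
  note B = b[unfolded inverse_branch_def Let_def]
  note Bz = B[THEN conjunct1] and Bv = B[THEN conjunct2, THEN conjunct1, rule_format, OF inball]
  have lin: "linear (\<Phi>' v)" "linear (P (\<Phi> v))" if v: "?N (v - ?y) < ?\<rho>" for v
    using has_derivative_linear \<Phi>(3)[OF v] Bv[OF v] by blast+
  have jacc: "jac (P (\<Phi> v) \<circ> \<Phi>' v) = jac (P (\<Phi> v)) * jac (\<Phi>' v)" if v: "?N (v - ?y) < ?\<rho>" for v
    by (rule jac_compose[OF lin(2,1)[OF v]])
  have Gs: "?G (Suc n) = 1 / e0 * (?\<rho> / a0 * (\<kappa> * \<sigma>) ^ n) + ?G n"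
    by (simp add: algebra_simps add_divide_distrib)
  have small: "1 / e0 * norm (\<Phi> v - ?z) \<le> 1 / e0 * (?\<rho> / a0 * (\<kappa> * \<sigma>) ^ n)" if v: "?N (v - ?y) < ?\<rho>" for v
  proof -
    have "a0 * norm (\<Phi> v - ?z) \<le> (\<kappa> * \<sigma>) ^ n * ?\<rho>" using ab0(3)[OF s(1,2), of "\<Phi> v - ?z"] inner(1)[OF v] by linarith
    then have "norm (\<Phi> v - ?z) \<le> ?\<rho> / a0 * (\<kappa> * \<sigma>) ^ n" using ab0(1) by (simp add: field_simps)
    then show ?thesis using e0(1) by (intro mult_left_mono) auto
  qed
  show ?case
  proof (intro exI[of _ "\<Psi> \<circ> \<Phi>"] exI[of _ "\<lambda>v. P (\<Phi> v) \<circ> \<Phi>' v"] conjI allI impI)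
    show "(\<Psi> \<circ> \<Phi>) ?y = snd (fst p) x" using \<Phi>(1) Bz by simp
    fix v assume v: "?N (v - ?y) < ?\<rho>"
    have ps: "fst s \<in> A" "fst p \<in> A" using piece_facts(1) s(1) Suc.prems(1) by auto
    have "(f ^^ Suc n) (chart_inv (fst p) (\<Psi> (\<Phi> v))) = (f ^^ n) (f (chart_inv (fst p) (\<Psi> (\<Phi> v))))" by (simp add: fn)
    also have "\<dots> = (f ^^ n) (chart_inv (fst s) (\<Phi> v))" using Bv[OF v] by simp
    finally show "(f ^^ Suc n) (chart_inv (fst p) ((\<Psi> \<circ> \<Phi>) v)) = chart_inv (fst q) v" using \<Phi>(2)[OF v] by simp
    show "(\<Psi> \<circ> \<Phi> has_derivative P (\<Phi> v) \<circ> \<Phi>' v) (at v)"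
      using \<Phi>(3)[OF v] Bv[OF v] by (intro diff_chain_at) auto
    have "cnorm (fst p) x (\<Psi> (\<Phi> v) - snd (fst p) x) \<le> \<kappa> * lam x * cnorm (fst s) (f x) (\<Phi> v - ?z)"
      by (rule inverse_branch_contracts[OF Suc.prems(1,2) s(1,2) b \<kappa> inner(2)[OF v]])
    also have "\<dots> \<le> \<kappa> * lam x * (\<kappa> ^ n * ?L n (f x) * ?N (v - ?y))"
      using \<Phi>(4)[OF v] \<kappa> lam_pos[OF x] by (intro mult_left_mono) auto
    also have "\<dots> = \<kappa> ^ Suc n * ?L (Suc n) x * ?N (v - ?y)"
      by (simp add: prod.lessThan_Suc_shift funpow_swap1 del: prod.lessThan_Suc)
    finally show "cnorm (fst p) x ((\<Psi> \<circ> \<Phi>) v - snd (fst p) x) \<le> \<kappa> ^ Suc n * ?L (Suc n) x * ?N (v - ?y)" by simp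
    have pos: "jac (P (\<Phi> v)) > 0" "jac (P (\<Phi> ?y)) > 0" "jac (\<Phi>' v) > 0" "jac (\<Phi>' ?y) > 0"
      using Bv[OF v] Bv[OF y0] \<Phi>(5)[OF v] \<Phi>(5)[OF y0] by blast+
    then show "jac (P (\<Phi> v) \<circ> \<Phi>' v) > 0" unfolding jacc[OF v] by simp
    have ex: "exp (1 / e0 * norm (\<Phi> v - ?z)) \<le> exp (1 / e0 * (?\<rho> / a0 * (\<kappa> * \<sigma>) ^ n))"
      using small[OF v] by simp
    have "jac (P (\<Phi> v)) \<le> exp (1 / e0 * norm (\<Phi> v - ?z)) * jac (P (\<Phi> ?y))" using Bv[OF v] \<Phi>(1) by simp
    also have "\<dots> \<le> exp (1 / e0 * (?\<rho> / a0 * (\<kappa> * \<sigma>) ^ n)) * jac (P (\<Phi> ?y))"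
      using ex pos by (intro mult_right_mono) auto
    finally have "jac (P (\<Phi> v)) * jac (\<Phi>' v) \<le> (exp (1 / e0 * (?\<rho> / a0 * (\<kappa> * \<sigma>) ^ n)) * jac (P (\<Phi> ?y))) * (exp (?G n) * jac (\<Phi>' ?y))"
      using \<Phi>(6)[OF v] pos by (intro mult_mono) auto
    then show "jac (P (\<Phi> v) \<circ> \<Phi>' v) \<le> exp (?G (Suc n)) * jac (P (\<Phi> ?y) \<circ> \<Phi>' ?y)"
      unfolding jacc[OF v] jacc[OF y0] Gs exp_add by (simp add: mult_ac)
    have "jac (P (\<Phi> ?y)) \<le> exp (1 / e0 * norm (\<Phi> v - ?z)) * jac (P (\<Phi> v))" using Bv[OF v] \<Phi>(1) by simp
    also have "\<dots> \<le> exp (1 / e0 * (?\<rho> / a0 * (\<kappa> * \<sigma>) ^ n)) * jac (P (\<Phi> v))"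
      using ex pos by (intro mult_right_mono) auto
    finally have "jac (P (\<Phi> ?y)) * jac (\<Phi>' ?y) \<le> (exp (1 / e0 * (?\<rho> / a0 * (\<kappa> * \<sigma>) ^ n)) * jac (P (\<Phi> v))) * (exp (?G n) * jac (\<Phi>' v))"
      using \<Phi>(7)[OF v] pos by (intro mult_mono) auto
    then show "jac (P (\<Phi> ?y) \<circ> \<Phi>' ?y) \<le> exp (?G (Suc n)) * jac (P (\<Phi> v) \<circ> \<Phi>' v)"
      unfolding jacc[OF v] jacc[OF y0] Gs exp_add by (simp add: mult_ac)
  qed
qed

end

section \<open>Lifts through a locally injective map\<close>

text \<open>
  The set where the two lifts agree is open because \<open>F\<close> is locally injective, and closed because
  the space is Hausdorff.
\<close>

lemma lift_unique:
  fixes \<xi> \<xi>' :: "'b::topological_space \<Rightarrow> 'a::t2_space"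
  assumes B: "open B" "connected B" and cont: "continuous_on B \<xi>" "continuous_on B \<xi>'"
    and M: "\<xi> ` B \<subseteq> M" "\<xi>' ` B \<subseteq> M"
    and loc: "\<And>x. x \<in> M \<Longrightarrow> \<exists>U. openin (top_of_set M) U \<and> x \<in> U \<and> inj_on F U"
    and same: "\<And>v. v \<in> B \<Longrightarrow> F (\<xi> v) = F (\<xi>' v)"
    and v0: "v0 \<in> B" "\<xi> v0 = \<xi>' v0" and v: "v \<in> B"
  shows "\<xi> v = \<xi>' v"
proof -
  let ?P = "{v\<in>B. \<xi> v = \<xi>' v}" and ?Q = "{v\<in>B. \<xi> v \<noteq> \<xi>' v}"
  have "open ?P"
  proof (subst open_subopen, clarify)
    fix v assume v: "v \<in> B" "\<xi> v = \<xi>' v"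
    then obtain U where U: "openin (top_of_set M) U" "\<xi> v \<in> U" "inj_on F U" using loc M by blast
    then obtain O' where O': "open O'" "U = M \<inter> O'" by (meson openin_open)
    let ?V = "(B \<inter> \<xi> -` O') \<inter> (B \<inter> \<xi>' -` O')"
    have "open ?V"
      by (intro open_Int continuous_open_preimage[OF cont(1) B(1) O'(1)] continuous_open_preimage[OF cont(2) B(1) O'(1)])
    moreover have "v \<in> ?V" using v U(2) O'(2) by auto
    moreover have "?V \<subseteq> ?P"
    proof
      fix w assume w: "w \<in> ?V"
      then have "\<xi> w \<in> U" "\<xi>' w \<in> U" using O'(2) M by auto
      then have "\<xi> w = \<xi>' w" using U(3) same w by (meson IntD1 inj_onD)
      then show "w \<in> ?P" using w by auto
    qed
    ultimately show "\<exists>T. open T \<and> v \<in> T \<and> T \<subseteq> ?P" by blast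
  qed
  moreover have "open ?Q"
  proof (subst open_subopen, clarify)
    fix v assume v: "v \<in> B" "\<xi> v \<noteq> \<xi>' v"
    then obtain U V where UV: "open U" "open V" "\<xi> v \<in> U" "\<xi>' v \<in> V" "U \<inter> V = {}" by (meson hausdorff)
    let ?V = "(B \<inter> \<xi> -` U) \<inter> (B \<inter> \<xi>' -` V)"
    have "open ?V"
      by (intro open_Int continuous_open_preimage[OF cont(1) B(1) UV(1)] continuous_open_preimage[OF cont(2) B(1) UV(2)])
    moreover have "v \<in> ?V" using v UV by auto
    moreover have "?V \<subseteq> ?Q" using UV(5) by auto
    ultimately show "\<exists>T. open T \<and> v \<in> T \<and> T \<subseteq> ?Q" by blast
  qed
  moreover have "?P \<inter> ?Q \<inter> B = {}" "B \<subseteq> ?P \<union> ?Q" by auto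
  ultimately have "?P \<inter> B = {} \<or> ?Q \<inter> B = {}" using B(2) connectedD by blast
  then show ?thesis using v0 v by auto
qed

text \<open>
  Finitely many sets on which \<open>F\<close> is injective cover \<open>M\<close>, and each meets the fibre at most once.
\<close>

lemma finite_fibre:
  assumes M: "compact M" and loc: "\<And>x. x \<in> M \<Longrightarrow> \<exists>U. openin (top_of_set M) U \<and> x \<in> U \<and> inj_on F U"
  shows "finite {x\<in>M. F x = y}"
proof -
  obtain U where U: "\<And>x. x \<in> M \<Longrightarrow> openin (top_of_set M) (U x)" "\<And>x. x \<in> M \<Longrightarrow> x \<in> U x" "\<And>x. x \<in> M \<Longrightarrow> inj_on F (U x)"
    using loc by metis
  have "\<exists>O'. open O' \<and> U x = M \<inter> O'" if "x \<in> M" for x using U(1)[OF that] by (simp add: openin_open)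
  then obtain O' where O': "\<And>x. x \<in> M \<Longrightarrow> open (O' x)" "\<And>x. x \<in> M \<Longrightarrow> U x = M \<inter> O' x" by metis
  have "M \<subseteq> (\<Union>x\<in>M. O' x)" using U(2) O'(2) by blast
  then obtain J where J: "J \<subseteq> M" "finite J" "M \<subseteq> (\<Union>x\<in>J. O' x)"
    using compactE_image[OF M, of M O'] O'(1) by blast
  have "finite {x \<in> U z. F x = y}" if z: "z \<in> M" for z
  proof (cases "{x \<in> U z. F x = y} = {}")
    case False
    then obtain x where x: "x \<in> U z" "F x = y" by blast
    then have "{x \<in> U z. F x = y} \<subseteq> {x}" using U(3)[OF z] by (auto dest: inj_onD)
    then show ?thesis using finite_subset by blast
  qed (simp only: finite.emptyI)
  then have "finite (\<Union>z\<in>J. {x \<in> U z. F x = y})" using J by blast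
  moreover have "{x\<in>M. F x = y} \<subseteq> (\<Union>z\<in>J. {x \<in> U z. F x = y})" 
  proof clarify
    fix x assume x: "x \<in> M" "y = F x"
    then obtain z where z: "z \<in> J" "x \<in> O' z" using J(3) by blast
    then have "x \<in> U z" using O'(2)[of z] J(1) x(1) by blast
    then show "x \<in> (\<Union>z\<in>J. {x' \<in> U z. F x' = F x})" using z(1) by blast
  qed
  ultimately show ?thesis using finite_subset by blast
qed

section \<open>Domination of the images of volume at hyperbolic times\<close>

context riemannian_local_diffeo
begin

lemma iterate_M: "x \<in> M \<Longrightarrow> (f ^^ n) x \<in> M"
  by (induction n) (auto simp: f_M)

lemma continuous_iterate: "continuous_on M (f ^^ n)"
proof (induction n)
  case (Suc n)
  have "continuous_on M (\<lambda>x. f ((f ^^ n) x))"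
    by (rule continuous_on_compose2[OF continuous_f Suc]) (use iterate_M in auto)
  then show ?case by (simp add: o_def)
qed simp

lemma iterate_locally_injective:
  assumes "x \<in> M"
  shows "\<exists>U. openin (top_of_set M) U \<and> x \<in> U \<and> inj_on (f ^^ n) U"
proof (induction n)
  case 0
  then show ?case using assms by (intro exI[of _ M]) auto
next
  case (Suc n)
  then obtain U where U: "openin (top_of_set M) U" "x \<in> U" "inj_on (f ^^ n) U" by blast
  obtain V where V: "(f ^^ n) x \<in> V" "openin (top_of_set M) V" "inj_on f V"
    using diffeo iterate_M[OF assms] unfolding C2_local_diffeomorphism_def by metis
  let ?W = "U \<inter> (M \<inter> (f ^^ n) -` V)"
  have "openin (top_of_set M) (M \<inter> (f ^^ n) -` V)"
    by (rule continuous_openin_preimage[OF continuous_iterate _ V(2)]) (use iterate_M in auto)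
  then have "openin (top_of_set M) ?W" using U(1) by blast
  moreover have "x \<in> ?W" using assms U V by auto
  moreover have "inj_on (f ^^ Suc n) ?W"
    using U(3) V(3) by (auto simp: inj_on_def)
  ultimately show ?case by blast
qed

definition borel_M :: "'a measure" where "borel_M = restrict_space borel M"

lemma closed_M: "closed M" using compact_M by (rule compact_imp_closed)

lemma space_borel_M: "space borel_M = M" by (simp add: borel_M_def space_restrict_space)

lemma sets_borel_M: "S \<in> sets borel_M \<longleftrightarrow> S \<subseteq> M \<and> S \<in> sets borel"
  unfolding borel_M_def by (subst sets_restrict_space_iff) (use closed_M in auto)

lemma openin_sets_borel_M: "openin (top_of_set M) U \<Longrightarrow> U \<in> sets borel_M"
  unfolding sets_borel_M openin_open using closed_M by auto

lemma iterate_measurable: "(f ^^ n) \<in> measurable borel_M borel_M"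
proof -
  have "(f ^^ n) \<in> measurable borel_M borel"
    unfolding borel_M_def by (rule borel_measurable_continuous_on_restrict[OF continuous_iterate])
  then show ?thesis
    unfolding borel_M_def by (intro measurable_restrict_space2) (use iterate_M in \<open>auto simp: space_restrict_space\<close>)
qed

lemma lam_measurable: "lam \<in> borel_measurable borel_M"
proof (rule borel_measurableI_greater)
  fix t
  have "{x\<in>space borel_M. t < lam x} = {x\<in>M. lam x > t}" by (simp add: space_borel_M)
  then show "{x\<in>space borel_M. t < lam x} \<in> sets borel_M" using openin_sets_borel_M[OF lam_superlevel_openin] by simp
qed

lemma chart_image_borel:
  assumes c: "c \<in> A" and S: "S \<in> sets borel_M" "S \<subseteq> fst c"
  shows "snd c ` S \<in> sets borel"
proof -
  have U: "snd c ` fst c \<in> sets borel" using chart_facts(3)[OF c] by auto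
  have "chart_inv c \<in> measurable (restrict_space borel (snd c ` fst c)) borel"
    by (rule borel_measurable_continuous_on_restrict[OF chart_facts(5)[OF c]])
  then have "chart_inv c -` S \<inter> space (restrict_space borel (snd c ` fst c)) \<in> sets (restrict_space borel (snd c ` fst c))"
    using S by (intro measurable_sets) (auto simp: sets_borel_M)
  then have "chart_inv c -` S \<inter> snd c ` fst c \<in> sets borel"
    using U by (simp add: sets_restrict_space_iff space_restrict_space)
  moreover have "chart_inv c -` S \<inter> snd c ` fst c = snd c ` S"
  proof
    show "chart_inv c -` S \<inter> snd c ` fst c \<subseteq> snd c ` S"
      using c by auto
    show "snd c ` S \<subseteq> chart_inv c -` S \<inter> snd c ` fst c"
      using c S(2) by (auto simp: subset_iff)
  qed
  ultimately show ?thesis by simp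
qed

lemma chart_inv_image_sets:
  assumes c: "c \<in> A" and S: "S \<in> sets borel" "S \<subseteq> snd c ` fst c"
  shows "chart_inv c ` S \<in> sets borel_M"
proof -
  have Ub: "fst c \<in> sets borel_M" using openin_sets_borel_M chart_facts(1)[OF c] by blast
  have "snd c \<in> measurable (restrict_space borel (fst c)) borel"
    by (rule borel_measurable_continuous_on_restrict[OF chart_facts(4)[OF c]])
  then have "snd c -` S \<inter> space (restrict_space borel (fst c)) \<in> sets (restrict_space borel (fst c))"
    using S(1) by (rule measurable_sets)
  then have "snd c -` S \<inter> fst c \<in> sets borel"
    using Ub by (simp add: sets_restrict_space_iff space_restrict_space sets_borel_M)
  moreover have "snd c -` S \<inter> fst c = chart_inv c ` S"
  proof
    show "chart_inv c ` S \<subseteq> snd c -` S \<inter> fst c" using snd_chart_inv[OF c] S(2) by (auto simp: subset_iff)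
    show "snd c -` S \<inter> fst c \<subseteq> chart_inv c ` S"
    proof
      fix x assume "x \<in> snd c -` S \<inter> fst c"
      then show "x \<in> chart_inv c ` S" using chart_inv_snd[OF c, of x] by (intro image_eqI[of _ _ "snd c x"]) auto
    qed
  qed
  ultimately show ?thesis using chart_facts(2)[OF c] by (auto simp: sets_borel_M)
qed

end

context covered_local_diffeo
begin

text \<open>
  In the charts of all pieces \<open>\<mu>\<close> lies between two multiples of Lebesgue measure. This is the
  property of Riemannian volume on which the domination rests.
\<close>

definition comparable :: "'a measure \<Rightarrow> real \<Rightarrow> real \<Rightarrow> bool" where
  "comparable \<mu> \<alpha> \<beta> \<longleftrightarrow> finite_measure \<mu> \<and> sets \<mu> = sets borel_M \<and> 0 < \<alpha> \<and> 0 < \<beta> \<and>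
     (\<forall>p\<in>J. \<forall>S\<in>sets borel. S \<subseteq> big_piece p \<longrightarrow>
        \<alpha> * measure lborel S \<le> measure \<mu> (chart_inv (fst p) ` S) \<and>
        measure \<mu> (chart_inv (fst p) ` S) \<le> \<beta> * measure lborel S)"

text \<open>
  The map \<open>\<xi>\<close> lifts a coordinate ball around the \<open>n\<close>-th image of \<open>x\<close> to a neighbourhood of \<open>x\<close>.
  In the last clause, bounded distortion: the part of the lifted ball above \<open>S\<close> has, up to the
  factor \<open>Q\<close>, at most the share of the lifted ball that \<open>S\<close> has in the ball.
\<close>

abbreviation ball_lift where
  "ball_lift \<mu> Q q n x z s \<xi> \<equiv>
     continuous_on (ball z s) \<xi> \<and> \<xi> ` ball z s \<subseteq> M \<and>
     (\<forall>v\<in>ball z s. (f ^^ n) (\<xi> v) = chart_inv (fst q) v) \<and>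
     \<xi> (snd (fst q) ((f ^^ n) x)) = x \<and>
     (\<forall>S\<in>sets borel. S \<subseteq> ball z s \<longrightarrow> \<xi> ` S \<in> sets borel_M \<and>
        measure \<mu> (\<xi> ` S) * measure lborel (ball z s) \<le> Q * measure lborel S * measure \<mu> (\<xi> ` ball z s))"

text \<open>
  A ball of radius \<open>s\<close> that contains the \<open>n\<close>-th image of \<open>x\<close> lies in the ellipsoid around that
  image, so the iterated branch is defined on it. The centre \<open>z\<close> is independent of \<open>x\<close>, so that
  lifts for different points have a common domain. The unknown size of the Jacobian cancels in the
  quotient.
\<close>

lemma lift_of_ball:
  assumes \<mu>: "comparable \<mu> \<alpha> \<beta>" and \<kappa>: "\<kappa> > 1" and \<sigma>: "\<sigma> > 0" and \<tau>: "\<kappa> * \<sigma> < 1" and n: "n \<ge> 1"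
    and x: "x \<in> M" and q: "q \<in> J" "in_piece q ((f ^^ n) x)"
    and hyp: "hyp \<sigma> x n"
    and s: "2 * b0 * s \<le> radius \<kappa>" and z: "snd (fst q) ((f ^^ n) x) \<in> ball z s"
  defines "G \<equiv> radius \<kappa> / (a0 * e0) / (1 - \<kappa> * \<sigma>)"
  shows "ball z s \<subseteq> big_piece q" "\<exists>\<xi>. ball_lift \<mu> (\<beta> / \<alpha> * exp (2 * G)) q n x z s \<xi>"
proof -
  obtain p where p: "p \<in> J" "in_piece p x" using piece_exists[OF x] .
  let ?y = "snd (fst q) ((f ^^ n) x)" and ?N = "cnorm (fst q) ((f ^^ n) x)"
  let ?B = "ball z s"
  note cp = in_pieceD(2)[OF p] and cq = in_pieceD(2)[OF q]
  have pA: "fst p \<in> A" "fst q \<in> A" using piece_facts(1) p q by auto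
  define Gn where "Gn = radius \<kappa> / (a0 * e0) * (\<Sum>k<n. (\<kappa> * \<sigma>) ^ k)"
  have GnG: "Gn \<le> G"
  proof -
    have t: "\<kappa> * \<sigma> \<ge> 0" "\<kappa> * \<sigma> \<noteq> 1" using \<kappa> \<sigma> \<tau> by auto
    have "(\<Sum>k<n. (\<kappa> * \<sigma>) ^ k) = (1 - (\<kappa> * \<sigma>) ^ n) / (1 - \<kappa> * \<sigma>)" using t(2) by (simp add: sum_gp_strict)
    also have "\<dots> \<le> 1 / (1 - \<kappa> * \<sigma>)" using t \<tau> by (intro divide_right_mono) auto
    finally have "Gn \<le> radius \<kappa> / (a0 * e0) * (1 / (1 - \<kappa> * \<sigma>))"
      unfolding Gn_def using radius_facts(1)[OF \<kappa>] ab0(1) e0(1) by (intro mult_left_mono) auto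
    then show ?thesis by (simp add: G_def)
  qed
  have "\<kappa> * \<sigma> \<le> 1" "n = 0 \<longrightarrow> p = q" using \<tau> n by auto
  from iterated_inverse_branch[OF \<kappa> \<sigma> this(1) p q this(2) hyp]
  obtain \<Phi> \<Phi>' where \<Phi>: "iterated_branch \<kappa> p q n x (radius \<kappa>) Gn \<Phi> \<Phi>'"
    unfolding Gn_def by blast
  have near: "?N (v - ?y) < radius \<kappa>" if v: "v \<in> ?B" for v
  proof -
    have "norm (v - ?y) \<le> dist z v + dist z ?y" by (metis dist_norm dist_triangle3)
    then have "norm (v - ?y) < 2 * s" using v z by auto
    then have "b0 * norm (v - ?y) < b0 * (2 * s)" using ab0(2) by (intro mult_strict_left_mono)
    then show ?thesis using ab0(4)[OF q, of "v - ?y"] s by (simp add: mult.left_commute mult.assoc)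
  qed
  have bigp: "big_piece p \<subseteq> snd (fst p) ` fst (fst p)" by (rule piece_facts(6)[OF p(1)])
  have \<Phi>big: "\<Phi> v \<in> big_piece p" if v: "v \<in> ?B" for v
  proof (rule small_cnorm_imp(1)[OF p \<kappa>])
    let ?h = "?N (v - ?y)"
    have h: "?h \<ge> 0" by (rule cnorm_facts(1)[OF cq])
    have "\<kappa> ^ n * (\<Prod>j<n. lam ((f ^^ j) x)) \<le> \<kappa> ^ n * \<sigma> ^ n"
      using hyp_seq_prod[OF hyp] \<kappa> by (intro mult_left_mono) auto
    also have "\<dots> \<le> 1" using \<tau> \<kappa> \<sigma> by (auto simp: power_mult_distrib[symmetric] intro: power_le_one)
    finally have "\<kappa> ^ n * (\<Prod>j<n. lam ((f ^^ j) x)) * ?h \<le> 1 * ?h" using h by (rule mult_right_mono)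
    moreover have "cnorm (fst p) x (\<Phi> v - snd (fst p) x) \<le> \<kappa> ^ n * (\<Prod>j<n. lam ((f ^^ j) x)) * ?h"
      using \<Phi> near[OF v] by blast
    ultimately show "cnorm (fst p) x (\<Phi> v - snd (fst p) x) < radius \<kappa>" using near[OF v] by linarith
  qed
  have bigq: "?B \<subseteq> snd (fst q) ` fst (fst q)"
    using small_cnorm_imp(1)[OF q \<kappa> near] piece_facts(6)[OF q(1)] by blast
  have d\<Phi>: "(\<Phi> has_derivative \<Phi>' v) (at v)" if "v \<in> ?B" for v using \<Phi> near[OF that] by blast
  have cont\<Phi>: "continuous_on ?B \<Phi>"
    using d\<Phi> has_derivative_at_withinI has_derivative_continuous_on by blast
  define \<xi> where "\<xi> = (\<lambda>v. chart_inv (fst p) (\<Phi> v))"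
  have cont: "continuous_on ?B \<xi>" unfolding \<xi>_def
    by (rule continuous_on_compose2[OF chart_facts(5)[OF pA(1)] cont\<Phi>]) (use \<Phi>big bigp in blast)
  have \<xi>M: "\<xi> ` ?B \<subseteq> M" unfolding \<xi>_def using \<Phi>big bigp snd_chart_inv(2)[OF pA(1)] chart_facts(2)[OF pA(1)] by blast
  have fn: "(f ^^ n) (\<xi> v) = chart_inv (fst q) v" if "v \<in> ?B" for v using \<Phi> near[OF that] unfolding \<xi>_def by blast
  have \<xi>y: "\<xi> ?y = x" using \<Phi> cp by (simp add: \<xi>_def charts_at_def)
  have sci: "snd (fst q) (chart_inv (fst q) v) = v" if "v \<in> ?B" for v
    using that bigq by (intro snd_chart_inv(1)[OF pA(2)]) blast
  have inj\<Phi>: "inj_on \<Phi> ?B"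
  proof
    fix v w assume v: "v \<in> ?B" "w \<in> ?B" "\<Phi> v = \<Phi> w"
    have "chart_inv (fst q) v = chart_inv (fst q) w"
      unfolding fn[OF v(1), symmetric] fn[OF v(2), symmetric] \<xi>_def v(3) ..
    then have "snd (fst q) (chart_inv (fst q) v) = snd (fst q) (chart_inv (fst q) w)" by (rule arg_cong)
    then show "v = w" unfolding sci[OF v(1)] sci[OF v(2)] .
  qed
  have img: "\<Phi> ` S \<in> sets borel \<and> \<Phi> ` S \<subseteq> big_piece p \<and> bounded (\<Phi> ` S)" if S: "S \<in> sets borel" "S \<subseteq> ?B" for S
  proof -
    have sub: "\<Phi> ` S \<subseteq> big_piece p" using \<Phi>big S(2) by blast
    have "\<xi> ` S = (\<xi> ` ?B) \<inter> (M \<inter> (f ^^ n) -` (chart_inv (fst q) ` S))"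
    proof
      show "\<xi> ` S \<subseteq> (\<xi> ` ?B) \<inter> (M \<inter> (f ^^ n) -` (chart_inv (fst q) ` S))" using S(2) \<xi>M fn by auto
      show "(\<xi> ` ?B) \<inter> (M \<inter> (f ^^ n) -` (chart_inv (fst q) ` S)) \<subseteq> \<xi> ` S"
      proof clarify
        fix v w assume v: "v \<in> ?B" and w: "w \<in> S" "(f ^^ n) (\<xi> v) = chart_inv (fst q) w"
        have wB: "w \<in> ?B" using w(1) S(2) by blast
        have "chart_inv (fst q) v = chart_inv (fst q) w" using fn[OF v] w(2) by (rule trans[OF sym])
        then have "snd (fst q) (chart_inv (fst q) v) = snd (fst q) (chart_inv (fst q) w)" by (rule arg_cong)
        then have "v = w" unfolding sci[OF v] sci[OF wB] .
        then show "\<xi> v \<in> \<xi> ` S" using w by simp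
      qed
    qed
    \<comment> \<open>The lifted ball is open by invariance of domain; a measurable part of it is cut out by
      a condition on the \<open>n\<close>-th image.\<close>
    moreover have "\<xi> ` ?B \<in> sets borel_M"
    proof -
      have "open (\<Phi> ` ?B)" by (rule invariance_of_domain[OF cont\<Phi> _ inj\<Phi>]) simp
      moreover have "\<Phi> ` ?B \<subseteq> snd (fst p) ` fst (fst p)" using \<Phi>big bigp by blast
      ultimately have "openin (top_of_set M) (chart_inv (fst p) ` \<Phi> ` ?B)" by (rule chart_inv_image_openin[OF pA(1)])
      then show ?thesis by (simp add: \<xi>_def image_image openin_sets_borel_M)
    qed
    moreover have "M \<inter> (f ^^ n) -` (chart_inv (fst q) ` S) \<in> sets borel_M"
      using measurable_sets[OF iterate_measurable chart_inv_image_sets[OF pA(2) S(1)], of n] S(2) bigq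
      by (auto simp: space_borel_M Int_commute)
    ultimately have "\<xi> ` S \<in> sets borel_M" by simp
    moreover have "\<xi> ` S \<subseteq> fst (fst p)" unfolding \<xi>_def using sub bigp snd_chart_inv(2)[OF pA(1)] by blast
    ultimately have "snd (fst p) ` \<xi> ` S \<in> sets borel" by (rule chart_image_borel[OF pA(1)])
    moreover have "snd (fst p) ` \<xi> ` S = \<Phi> ` S"
      unfolding \<xi>_def image_image using sub bigp snd_chart_inv(1)[OF pA(1)] by (intro image_cong) auto
    moreover have "bounded (\<Phi> ` S)" using sub by (rule bounded_subset[rotated]) (simp add: big_piece_def)
    ultimately show ?thesis using sub by simp
  qed
  let ?j = "jac (\<Phi>' ?y)"
  have jpos: "?j > 0" using \<Phi> near[OF z] by blast
  have jb: "exp (- Gn) * ?j \<le> jac (\<Phi>' v)" "jac (\<Phi>' v) \<le> exp Gn * ?j" if "v \<in> ?B" for v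
    using \<Phi> near[OF that] by (auto simp: exp_minus field_simps)
  have leb: "exp (- Gn) * ?j * measure lborel S \<le> measure lborel (\<Phi> ` S)"
     "measure lborel (\<Phi> ` S) \<le> exp Gn * ?j * measure lborel S" if S: "S \<in> sets borel" "S \<subseteq> ?B" for S
  proof -
    have bS: "bounded S" using S(2) bounded_ball bounded_subset by blast
    note bounds = measure_image_jac_bounds[OF S(1) bS, of \<Phi> \<Phi>' "exp (- Gn) * ?j" "exp Gn * ?j"]
    show "exp (- Gn) * ?j * measure lborel S \<le> measure lborel (\<Phi> ` S)"
      by (rule bounds(1)) (use img[OF S] inj_on_subset[OF inj\<Phi> S(2)] d\<Phi> jb S(2) in blast)+
    show "measure lborel (\<Phi> ` S) \<le> exp Gn * ?j * measure lborel S"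
      by (rule bounds(2)) (use img[OF S] inj_on_subset[OF inj\<Phi> S(2)] d\<Phi> jb S(2) in blast)+
  qed
  have ab: "\<alpha> > 0" "\<beta> > 0" and cmp: "\<And>S. S \<in> sets borel \<Longrightarrow> S \<subseteq> big_piece p \<Longrightarrow>
        \<alpha> * measure lborel S \<le> measure \<mu> (chart_inv (fst p) ` S) \<and> measure \<mu> (chart_inv (fst p) ` S) \<le> \<beta> * measure lborel S"
    using \<mu> p(1) unfolding comparable_def by blast+
  have main: "\<xi> ` S \<in> sets borel_M \<and>
        measure \<mu> (\<xi> ` S) * measure lborel ?B \<le> \<beta> / \<alpha> * exp (2 * G) * measure lborel S * measure \<mu> (\<xi> ` ?B)"
    if S: "S \<in> sets borel" "S \<subseteq> ?B" for S
  proof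
    have eq: "chart_inv (fst p) ` \<Phi> ` T = \<xi> ` T" for T by (simp add: \<xi>_def image_image)
    show "\<xi> ` S \<in> sets borel_M"
      using chart_inv_image_sets[OF pA(1), of "\<Phi> ` S"] img[OF S] bigp unfolding eq by blast
    have "measure \<mu> (\<xi> ` S) \<le> \<beta> * measure lborel (\<Phi> ` S)" using cmp img[OF S] unfolding eq[symmetric] by blast
    also have "\<dots> \<le> \<beta> * (exp Gn * ?j * measure lborel S)" using leb(2)[OF S] ab by (intro mult_left_mono) auto
    finally have 1: "measure \<mu> (\<xi> ` S) \<le> \<beta> * (exp Gn * ?j * measure lborel S)" .
    have "\<alpha> * (exp (- Gn) * ?j * measure lborel ?B) \<le> \<alpha> * measure lborel (\<Phi> ` ?B)"
      using leb(1)[of ?B] ab by (intro mult_left_mono) auto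
    also have "\<dots> \<le> measure \<mu> (\<xi> ` ?B)"
    proof -
      have "\<Phi> ` ?B \<in> sets borel" "\<Phi> ` ?B \<subseteq> big_piece p" using img[of ?B] by auto
      then show ?thesis using cmp[of "\<Phi> ` ?B"] unfolding eq by blast
    qed
    finally have 2: "?j * measure lborel ?B \<le> measure \<mu> (\<xi> ` ?B) * exp Gn / \<alpha>"
      using ab by (simp add: exp_minus field_simps)
    have "measure \<mu> (\<xi> ` S) * measure lborel ?B \<le> \<beta> * (exp Gn * ?j * measure lborel S) * measure lborel ?B"
      using 1 by (intro mult_right_mono) auto
    also have "\<dots> = \<beta> * exp Gn * measure lborel S * (?j * measure lborel ?B)" by (simp add: mult_ac)
    also have "\<dots> \<le> \<beta> * exp Gn * measure lborel S * (measure \<mu> (\<xi> ` ?B) * exp Gn / \<alpha>)"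
      using 2 ab by (intro mult_left_mono) auto
    also have "\<dots> = \<beta> / \<alpha> * exp (2 * Gn) * measure lborel S * measure \<mu> (\<xi> ` ?B)"
      by (simp only: mult_2 exp_add) (simp add: mult_ac)
    also have "\<dots> \<le> \<beta> / \<alpha> * exp (2 * G) * measure lborel S * measure \<mu> (\<xi> ` ?B)"
      using GnG ab by (intro mult_right_mono mult_left_mono) auto
    finally show "measure \<mu> (\<xi> ` S) * measure lborel ?B \<le> \<beta> / \<alpha> * exp (2 * G) * measure lborel S * measure \<mu> (\<xi> ` ?B)" .
  qed
  show "ball z s \<subseteq> big_piece q" using small_cnorm_imp(1)[OF q \<kappa> near] by blast
  show "\<exists>\<xi>. ball_lift \<mu> (\<beta> / \<alpha> * exp (2 * G)) q n x z s \<xi>"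
    using cont \<xi>M fn \<xi>y main by (intro exI[of _ \<xi>]) blast
qed

text \<open>
  Two lifts that meet coincide, by uniqueness of lifts. Therefore the lifts that belong to the
  points of \<open>X\<close> are finitely many disjoint sets, indexed by the values at \<open>z\<close>, which lie in one
  fibre of \<open>f ^^ n\<close>. In each of them the part above \<open>E\<close> has at most a multiple of \<open>\<mu> E\<close> as its
  share, and the measures of the disjoint sets add up to at most \<open>\<mu> M\<close>. The bound does not depend
  on \<open>n\<close>.
\<close>

lemma hyperbolic_set_over_ball:
  fixes z :: "real ^ 'n" and n :: nat and q
  assumes \<mu>: "comparable \<mu> \<alpha> \<beta>" and \<kappa>: "\<kappa> > 1" and \<sigma>: "\<sigma> > 0" and \<tau>: "\<kappa> * \<sigma> < 1" and n: "n \<ge> 1"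
    and q: "q \<in> J" and s: "0 < s" "2 * b0 * s \<le> radius \<kappa>" and E: "E \<in> sets borel_M"
  defines "G \<equiv> radius \<kappa> / (a0 * e0) / (1 - \<kappa> * \<sigma>)"
    and "X \<equiv> {x\<in>M. hyp \<sigma> x n \<and> in_piece q ((f ^^ n) x) \<and> snd (fst q) ((f ^^ n) x) \<in> ball z s}"
  shows "\<exists>Y\<in>sets borel_M. {x\<in>X. (f ^^ n) x \<in> E} \<subseteq> Y \<and>
    measure \<mu> Y \<le> \<beta> / \<alpha> * exp (2 * G) * measure \<mu> M / (\<alpha> * measure lborel (ball z s)) * measure \<mu> E"
proof (cases "X = {}")
  case True
  have "\<alpha> > 0" "\<beta> > 0" using \<mu> by (auto simp: comparable_def)
  then show ?thesis using True by (intro bexI[of _ "{}"]) auto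
next
  case False
  let ?B = "ball z s"
  have qA: "fst q \<in> A" by (rule piece_facts(1)[OF q])
  have fin: "finite_measure \<mu>" and sets: "sets \<mu> = sets borel_M" and ab: "\<alpha> > 0" "\<beta> > 0"
    using \<mu> by (auto simp: comparable_def)
  interpret finite_measure \<mu> by fact
  have big: "?B \<subseteq> big_piece q"
    using False lift_of_ball(1)[OF \<mu> \<kappa> \<sigma> \<tau> n _ q _ _ s(2)] unfolding X_def by blast
  then have BU: "?B \<subseteq> snd (fst q) ` fst (fst q)" using piece_facts(6)[OF q] by blast
  have "\<forall>x\<in>X. \<exists>\<xi>. ball_lift \<mu> (\<beta> / \<alpha> * exp (2 * G)) q n x z s \<xi>"
    using lift_of_ball(2)[OF \<mu> \<kappa> \<sigma> \<tau> n _ q _ _ s(2)] unfolding X_def G_def by blast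
  from bchoice[OF this] obtain \<xi> where \<xi>: "\<forall>x\<in>X. ball_lift \<mu> (\<beta> / \<alpha> * exp (2 * G)) q n x z s (\<xi> x)" ..
  have zB: "z \<in> ?B" using s by simp
  have same: "\<xi> x v = \<xi> x' v" if x: "x \<in> X" "x' \<in> X" and v0: "v0 \<in> ?B" "\<xi> x v0 = \<xi> x' v0" and v: "v \<in> ?B" for x x' v0 v
    by (rule lift_unique[of ?B "\<xi> x" "\<xi> x'" M "f ^^ n" v0 v])
       (use \<xi> x v0 v iterate_locally_injective in auto)
  define F where "F = (\<lambda>x. \<xi> x z) ` X"
  have "F \<subseteq> {x\<in>M. (f ^^ n) x = chart_inv (fst q) z}" using \<xi> zB unfolding F_def by blast
  moreover have "finite {x\<in>M. (f ^^ n) x = chart_inv (fst q) z}"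
    by (rule finite_fibre[OF compact_M iterate_locally_injective])
  ultimately have finF: "finite F" by (rule finite_subset)
  define r where "r w = (SOME x. x \<in> X \<and> \<xi> x z = w)" for w
  have r: "r w \<in> X" "\<xi> (r w) z = w" if "w \<in> F" for w
  proof -
    have "\<exists>x. x \<in> X \<and> \<xi> x z = w" using that unfolding F_def by blast
    from someI_ex[OF this] show "r w \<in> X" "\<xi> (r w) z = w" unfolding r_def by auto
  qed
  define S where "S = ?B \<inter> snd (fst q) ` (E \<inter> fst (fst q))"
  have "E \<inter> fst (fst q) \<in> sets borel_M" using E openin_sets_borel_M[OF chart_facts(1)[OF qA]] by blast
  then have Sb: "S \<in> sets borel" "S \<subseteq> ?B" unfolding S_def using chart_image_borel[OF qA] by auto
  define Y where "Y = (\<Union>w\<in>F. \<xi> (r w) ` S)"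
  have imgS: "\<xi> (r w) ` S \<in> sets borel_M" "\<xi> (r w) ` ?B \<in> sets borel_M" if "w \<in> F" for w
    using \<xi> r(1)[OF that] Sb by auto
  have Y: "Y \<in> sets borel_M" unfolding Y_def using finF imgS by auto
  have sub: "{x\<in>X. (f ^^ n) x \<in> E} \<subseteq> Y"
  proof clarify
    fix x assume x: "x \<in> X" "(f ^^ n) x \<in> E"
    let ?v = "snd (fst q) ((f ^^ n) x)"
    have v: "?v \<in> ?B" "in_piece q ((f ^^ n) x)" using x(1) by (auto simp: X_def)
    have "(f ^^ n) x \<in> fst (fst q)" using in_pieceD(2)[OF q v(2)] by (auto simp: charts_at_def)
    then have vS: "?v \<in> S" using v(1) x(2) by (auto simp: S_def)
    let ?w = "\<xi> x z"
    have w: "?w \<in> F" using x(1) by (auto simp: F_def)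
    have "\<xi> (r ?w) ?v = \<xi> x ?v" by (rule same[OF r(1)[OF w] x(1) zB r(2)[OF w] v(1)])
    also have "\<dots> = x" using \<xi> x(1) by blast
    finally show "x \<in> Y" unfolding Y_def using w vS by (metis UN_I imageI)
  qed
  have disj: "disjoint_family_on (\<lambda>w. \<xi> (r w) ` ?B) F"
    unfolding disjoint_family_on_def
  proof (intro ballI impI)
    fix w w' assume w: "w \<in> F" "w' \<in> F" "w \<noteq> w'"
    show "\<xi> (r w) ` ?B \<inter> \<xi> (r w') ` ?B = {}"
    proof (rule ccontr)
      assume "\<not> ?thesis"
      then obtain v v' where v: "v \<in> ?B" "v' \<in> ?B" "\<xi> (r w) v = \<xi> (r w') v'" by blast
      have "(f ^^ n) (\<xi> (r w) v) = chart_inv (fst q) v" "(f ^^ n) (\<xi> (r w') v') = chart_inv (fst q) v'"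
        using \<xi> r(1)[OF w(1)] r(1)[OF w(2)] v by blast+
      then have "chart_inv (fst q) v = chart_inv (fst q) v'" using v(3) by simp
      then have "snd (fst q) (chart_inv (fst q) v) = snd (fst q) (chart_inv (fst q) v')" by (rule arg_cong)
      moreover have "v \<in> snd (fst q) ` fst (fst q)" "v' \<in> snd (fst q) ` fst (fst q)" using BU v(1,2) by blast+
      ultimately have "v = v'" by (simp only: snd_chart_inv(1)[OF qA])
      then have "\<xi> (r w) z = \<xi> (r w') z" using same[OF r(1)[OF w(1)] r(1)[OF w(2)] v(1) _ zB] v(3) by simp
      then show False using r(2) w by simp
    qed
  qed
  have LB: "measure lborel ?B > 0" using s(1) by (simp add: content_ball_pos)
  define Q where "Q = \<beta> / \<alpha> * exp (2 * G)"
  have Q: "Q > 0" using ab by (simp add: Q_def)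
  have cE: "\<alpha> * measure lborel S \<le> measure \<mu> E"
  proof -
    have "\<alpha> * measure lborel S \<le> measure \<mu> (chart_inv (fst q) ` S)"
      using \<mu> q Sb big unfolding comparable_def by blast
    also have "chart_inv (fst q) ` S \<subseteq> E" using qA by (auto simp: S_def)
    then have "measure \<mu> (chart_inv (fst q) ` S) \<le> measure \<mu> E"
      using E sets by (intro finite_measure_mono) auto
    finally show ?thesis .
  qed
  have "measure \<mu> Y \<le> (\<Sum>w\<in>F. measure \<mu> (\<xi> (r w) ` S))"
    unfolding Y_def using finF imgS sets by (intro measure_UNION_le) auto
  also have "\<dots> \<le> (\<Sum>w\<in>F. Q * measure lborel S / measure lborel ?B * measure \<mu> (\<xi> (r w) ` ?B))"
  proof (rule sum_mono)
    fix w assume w: "w \<in> F"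
    have "measure \<mu> (\<xi> (r w) ` S) * measure lborel ?B \<le> Q * measure lborel S * measure \<mu> (\<xi> (r w) ` ?B)"
      unfolding Q_def using \<xi> r(1)[OF w] Sb by blast
    then show "measure \<mu> (\<xi> (r w) ` S) \<le> Q * measure lborel S / measure lborel ?B * measure \<mu> (\<xi> (r w) ` ?B)"
      using LB by (simp add: field_simps)
  qed
  also have "\<dots> = Q * measure lborel S / measure lborel ?B * (\<Sum>w\<in>F. measure \<mu> (\<xi> (r w) ` ?B))"
    by (simp add: sum_distrib_left)
  also have "(\<Sum>w\<in>F. measure \<mu> (\<xi> (r w) ` ?B)) = measure \<mu> (\<Union>w\<in>F. \<xi> (r w) ` ?B)"
    using finF imgS sets disj by (intro finite_measure_finite_Union[symmetric]) auto
  also have "Q * measure lborel S / measure lborel ?B * measure \<mu> (\<Union>w\<in>F. \<xi> (r w) ` ?B)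
      \<le> Q * measure lborel S / measure lborel ?B * measure \<mu> M"
  proof (intro mult_left_mono finite_measure_mono)
    show "(\<Union>w\<in>F. \<xi> (r w) ` ?B) \<subseteq> M" using \<xi> r(1) by blast
    show "M \<in> sets \<mu>" unfolding sets using space_borel_M sets.top[of borel_M] by simp
  qed (use Q LB in auto)
  also have "\<dots> \<le> Q * (measure \<mu> E / \<alpha>) / measure lborel ?B * measure \<mu> M"
    using cE Q LB ab by (intro mult_right_mono divide_right_mono mult_left_mono) (auto simp: field_simps)
  also have "\<dots> = Q * measure \<mu> M / (\<alpha> * measure lborel ?B) * measure \<mu> E" by simp
  finally show ?thesis using Y sub unfolding Q_def by blast
qed

text \<open>
  Finitely many balls of the size for which \<open>hyperbolic_set_over_ball\<close> works cover all pieces.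
  The factor \<open>\<kappa> = 1 / sqrt \<sigma>\<close> leaves the contraction rate \<open>sqrt \<sigma>\<close>.
\<close>

theorem hyperbolic_domination:
  assumes \<mu>: "comparable \<mu> \<alpha> \<beta>" and \<sigma>: "0 < \<sigma>" "\<sigma> < 1"
  shows "\<exists>C. \<forall>n\<ge>1. \<forall>E\<in>sets borel_M.
     measure \<mu> {x\<in>M. hyp \<sigma> x n \<and> (f ^^ n) x \<in> E} \<le> C * measure \<mu> E"
proof -
  have fin: "finite_measure \<mu>" and sets: "sets \<mu> = sets borel_M" using \<mu> by (auto simp: comparable_def)
  interpret finite_measure \<mu> by fact
  define \<kappa> where "\<kappa> = 1 / sqrt \<sigma>"
  have sq: "sqrt \<sigma> * sqrt \<sigma> = \<sigma>" "sqrt \<sigma> > 0" "sqrt \<sigma> < 1" using \<sigma> by auto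
  have "\<kappa> * \<sigma> = sqrt \<sigma>" using \<sigma> by (simp add: \<kappa>_def real_div_sqrt)
  then have \<kappa>: "\<kappa> > 1" "\<kappa> * \<sigma> < 1" using sq by (auto simp: \<kappa>_def)
  define s where "s = radius \<kappa> / (2 * b0)"
  have s: "0 < s" "2 * b0 * s \<le> radius \<kappa>" using radius_facts(1)[OF \<kappa>(1)] ab0(2) by (auto simp: s_def)
  have "\<exists>Z. finite Z \<and> piece q \<subseteq> (\<Union>z\<in>Z. ball z s)" for q
    using compact_cball[of "fst (snd q)" "snd (snd q)"] s(1)
    unfolding piece_def compact_eq_totally_bounded by blast
  then obtain Z where Z: "\<And>q. finite (Z q)" "\<And>q. piece q \<subseteq> (\<Union>z\<in>Z q. ball z s)" by metis
  define I where "I = (SIGMA q:J. Z q)"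
  have finI: "finite I" using finite_J Z(1) by (simp add: I_def)
  define G where "G = radius \<kappa> / (a0 * e0) / (1 - \<kappa> * \<sigma>)"
  define C where "C z = \<beta> / \<alpha> * exp (2 * G) * measure \<mu> M / (\<alpha> * measure lborel (ball z s))" for z :: "real ^ 'n"
  have "measure \<mu> {x\<in>M. hyp \<sigma> x n \<and> (f ^^ n) x \<in> E} \<le> (\<Sum>(q, z)\<in>I. C z) * measure \<mu> E"
    if n: "n \<ge> 1" and E: "E \<in> sets borel_M" for n E
  proof -
    let ?X = "\<lambda>q z. {x\<in>{x\<in>M. hyp \<sigma> x n \<and> in_piece q ((f ^^ n) x) \<and> snd (fst q) ((f ^^ n) x) \<in> ball z s}. (f ^^ n) x \<in> E}"
    have "\<exists>Y\<in>sets borel_M. ?X (fst i) (snd i) \<subseteq> Y \<and> measure \<mu> Y \<le> C (snd i) * measure \<mu> E" if "i \<in> I" for i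
      unfolding C_def G_def
      by (rule hyperbolic_set_over_ball[OF \<mu> \<kappa>(1) \<sigma>(1) \<kappa>(2) n _ s E]) (use that in \<open>auto simp: I_def\<close>)
    then have "\<forall>i\<in>I. \<exists>Y. Y \<in> sets borel_M \<and> ?X (fst i) (snd i) \<subseteq> Y \<and> measure \<mu> Y \<le> C (snd i) * measure \<mu> E"
      by blast
    from bchoice[OF this] obtain Y where
      Y': "\<forall>i\<in>I. Y i \<in> sets borel_M \<and> ?X (fst i) (snd i) \<subseteq> Y i \<and> measure \<mu> (Y i) \<le> C (snd i) * measure \<mu> E" ..
    note Y = bspec[OF Y', THEN conjunct1] bspec[OF Y', THEN conjunct2, THEN conjunct1]
      bspec[OF Y', THEN conjunct2, THEN conjunct2]
    have "{x\<in>M. hyp \<sigma> x n \<and> (f ^^ n) x \<in> E} \<subseteq> (\<Union>i\<in>I. Y i)"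
    proof clarify
      fix x assume x: "x \<in> M" "hyp \<sigma> x n" "(f ^^ n) x \<in> E"
      obtain q where q: "q \<in> J" "in_piece q ((f ^^ n) x)" using piece_exists[OF iterate_M[OF x(1)]] .
      then obtain z where z: "z \<in> Z q" "snd (fst q) ((f ^^ n) x) \<in> ball z s" using in_pieceD(3)[OF q] Z(2) by blast
      have i: "(q, z) \<in> I" using q z by (simp add: I_def)
      have "x \<in> ?X (fst (q, z)) (snd (q, z))" using x q z by simp
      then have "x \<in> Y (q, z)" using Y(2)[OF i] by blast
      then show "x \<in> (\<Union>i\<in>I. Y i)" using i by blast
    qed
    then have "measure \<mu> {x\<in>M. hyp \<sigma> x n \<and> (f ^^ n) x \<in> E} \<le> measure \<mu> (\<Union>i\<in>I. Y i)"
      using finI Y(1) sets by (intro finite_measure_mono) auto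
    also have "\<dots> \<le> (\<Sum>i\<in>I. measure \<mu> (Y i))" using finI Y(1) sets by (intro measure_UNION_le) auto
    also have "\<dots> \<le> (\<Sum>i\<in>I. C (snd i) * measure \<mu> E)" by (intro sum_mono Y(3))
    also have "\<dots> = (\<Sum>(q, z)\<in>I. C z) * measure \<mu> E" by (simp add: sum_distrib_right case_prod_beta)
    finally show ?thesis .
  qed
  then show ?thesis by blast
qed

end

section \<open>Riemannian volume in charts\<close>

context riemannian_local_diffeo
begin

abbreviation V :: "'a measure" where "V \<equiv> riemannian_volume M A g"

lemma chart_sets:
  assumes c: "c \<in> A"
  shows "B \<in> sets (restrict_space borel (fst c)) \<longleftrightarrow> B \<subseteq> fst c \<and> B \<in> sets borel_M"
proof -
  have "fst c \<in> sets borel" "fst c \<subseteq> M"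
    using openin_sets_borel_M[OF chart_facts(1)[OF c]] by (auto simp only: sets_borel_M)
  then show ?thesis
    by (subst sets_restrict_space_iff) (auto simp only: sets_borel_M space_borel Int_UNIV_right)
qed

lemma generators_subset: "(\<lambda>(c, B). B) ` {(c, B). c \<in> A \<and> B \<in> sets (restrict_space borel (fst c))} \<subseteq> {B \<in> sets borel_M. B \<subseteq> M}"
proof
  fix S assume "S \<in> (\<lambda>(c, B). B) ` {(c, B). c \<in> A \<and> B \<in> sets (restrict_space borel (fst c))}"
  then obtain i where i: "fst i \<in> A" "snd i \<in> sets (restrict_space borel (fst (fst i)))" "S = snd i"
    by (elim imageE) (auto simp only: case_prod_beta mem_Collect_eq)
  then show "S \<in> {B \<in> sets borel_M. B \<subseteq> M}" using chart_sets[OF i(1)] by (simp only: sets_borel_M mem_Collect_eq)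
qed

lemma generators_Pow: "(\<lambda>(c, B). B) ` {(c, B). c \<in> A \<and> B \<in> sets (restrict_space borel (fst c))} \<subseteq> Pow M"
  using generators_subset by blast

lemma space_volume: "space V = M"
  unfolding riemannian_volume_def by (rule space_extend_measure[OF generators_Pow])

text \<open>
  If no measure extends the values on the charts, the construction yields the zero measure, and
  for the zero measure every statement about almost all points holds. This alternative keeps the
  construction of the volume apart from the dynamics.
\<close>

lemma volume_cases:
  "(\<forall>S. emeasure V S = 0) \<or>
   (\<forall>c\<in>A. \<forall>B\<in>sets borel_M. B \<subseteq> fst c \<longrightarrow> emeasure V B = chart_volume A g c B)"
proof -
  let ?I = "{(c, B). c \<in> A \<and> B \<in> sets (restrict_space borel (fst c))}"
  let ?G = "\<lambda>(c :: ('a, 'n) chart, B :: 'a set). B"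
  let ?m = "\<lambda>(c, B). chart_volume A g c B"
  show ?thesis
  proof (cases "\<exists>\<mu>'. (\<forall>i\<in>?I. \<mu>' (?G i) = ?m i) \<and> measure_space M (sigma_sets M (?G ` ?I)) \<mu>'")
    case True
    then obtain \<mu>' where \<mu>': "\<forall>i\<in>?I. \<mu>' (?G i) = ?m i" "measure_space M (sigma_sets M (?G ` ?I)) \<mu>'" by blast
    have sets: "sets V = sigma_sets M (?G ` ?I)"
      unfolding riemannian_volume_def by (rule sets_extend_measure[OF generators_Pow])
    have em: "emeasure V (?G i) = ?m i" if "i \<in> ?I" for i
      by (rule emeasure_extend_measure[OF riemannian_volume_def _ generators_Pow _ _ that, of \<mu>'])
         (use \<mu>' sets in \<open>auto simp: measure_space_def\<close>)
    have "emeasure V B = chart_volume A g c B" if c: "c \<in> A" and B: "B \<in> sets borel_M" "B \<subseteq> fst c" for c B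
    proof -
      have "(c, B) \<in> ?I" using c B chart_sets[OF c] by simp
      from em[OF this] show ?thesis by simp
    qed
    then show ?thesis by blast
  next
    case False
    then have "V = measure_of M (?G ` ?I) (\<lambda>_. 0)"
      unfolding riemannian_volume_def extend_measure_def by (subst if_not_P) auto
    moreover have "emeasure (measure_of M (?G ` ?I) (\<lambda>_. 0)) S = 0" for S
      by (simp add: emeasure_measure_of_conv)
    ultimately show ?thesis by simp
  qed
qed

lemma density_bounds:
  assumes c: "c \<in> A" and K: "compact K" "K \<subseteq> snd c ` fst c"
  shows "\<exists>\<alpha> \<beta>. 0 < \<alpha> \<and> 0 < \<beta> \<and> (\<forall>S\<in>sets borel. S \<subseteq> K \<longrightarrow>
     ennreal \<alpha> * emeasure lborel S \<le> chart_volume A g c (chart_inv c ` S) \<and>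
     chart_volume A g c (chart_inv c ` S) \<le> ennreal \<beta> * emeasure lborel S)"
proof (cases "K = {}")
  case True
  then show ?thesis by (intro exI[of _ 1]) (auto simp: chart_volume_def)
next
  case False
  let ?h = "\<lambda>y. sqrt (det (metric_matrix A g c (chart_inv c y)))"
  have cm: "continuous_on K (\<lambda>y. metric_matrix A g c (chart_inv c y) $ i $ j)" for i j
    using metric_matrix_continuous[OF c] K(2) continuous_on_subset by blast
  then have cont: "continuous_on K ?h"
    unfolding det_def
    by (intro continuous_on_real_sqrt continuous_on_sum continuous_on_mult continuous_on_const continuous_on_prod cm)
  obtain p where p: "p \<in> K" "\<And>y. y \<in> K \<Longrightarrow> ?h p \<le> ?h y" using continuous_attains_inf[OF K(1) False cont] by blast
  obtain q where q: "q \<in> K" "\<And>y. y \<in> K \<Longrightarrow> ?h y \<le> ?h q" using continuous_attains_sup[OF K(1) False cont] by blast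
  have pos: "?h p > 0" using det_metric_pos[OF charts_at_chart_inv[OF c]] p(1) K(2) by auto
  have "ennreal (?h p) * emeasure lborel S \<le> chart_volume A g c (chart_inv c ` S) \<and>
     chart_volume A g c (chart_inv c ` S) \<le> ennreal (?h q) * emeasure lborel S"
    if S: "S \<in> sets borel" "S \<subseteq> K" for S
  proof -
    have "snd c ` chart_inv c ` S = S"
      unfolding image_image using snd_chart_inv(1)[OF c] S(2) K(2) by (simp add: subset_iff)
    then have eq: "chart_volume A g c (chart_inv c ` S) = (\<integral>\<^sup>+ y. ennreal (?h y) * indicator S y \<partial>lborel)"
      by (simp add: chart_volume_def)
    have "(\<integral>\<^sup>+ y. ennreal (?h p) * indicator S y \<partial>lborel) \<le> (\<integral>\<^sup>+ y. ennreal (?h y) * indicator S y \<partial>lborel)"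
      using p(2) S(2) by (intro nn_integral_mono) (auto split: split_indicator intro!: ennreal_leI)
    moreover have "(\<integral>\<^sup>+ y. ennreal (?h y) * indicator S y \<partial>lborel) \<le> (\<integral>\<^sup>+ y. ennreal (?h q) * indicator S y \<partial>lborel)"
      using q(2) S(2) by (intro nn_integral_mono) (auto split: split_indicator intro!: ennreal_leI)
    ultimately show ?thesis unfolding eq using S(1) by (simp add: nn_integral_cmult_indicator)
  qed
  moreover have "?h q > 0" using pos q(2)[OF p(1)] by linarith
  ultimately show ?thesis using pos by blast
qed

end

context covered_local_diffeo
begin

lemma sets_volume: "sets V = sets borel_M"
proof -
  let ?I = "{(c, B). c \<in> A \<and> B \<in> sets (restrict_space borel (fst c))}"
  let ?G = "\<lambda>(c :: ('a, 'n) chart, B :: 'a set). B"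
  have sets: "sets V = sigma_sets M (?G ` ?I)"
    unfolding riemannian_volume_def by (rule sets_extend_measure[OF generators_Pow])
  have "?G ` ?I \<subseteq> sets borel_M" using generators_subset by blast
  then have "sigma_sets (space borel_M) (?G ` ?I) \<subseteq> sets borel_M" by (rule sets.sigma_sets_subset)
  then have 1: "sets V \<subseteq> sets borel_M" unfolding sets space_borel_M .
  have "S \<in> sets V" if S: "S \<in> sets borel_M" for S
  proof -
    have "S \<inter> fst (fst p) \<in> sets V" if p: "p \<in> J" for p
    proof -
      have c: "fst p \<in> A" by (rule piece_facts(1)[OF p])
      have "S \<inter> fst (fst p) \<in> sets borel_M" using S openin_sets_borel_M[OF chart_facts(1)[OF c]] by blast
      then have "(fst p, S \<inter> fst (fst p)) \<in> ?I" using c chart_sets[OF c] by simp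
      then have "?G (fst p, S \<inter> fst (fst p)) \<in> ?G ` ?I" by (rule imageI)
      then show ?thesis unfolding sets by (simp add: sigma_sets.Basic)
    qed
    then have "(\<Union>p\<in>J. S \<inter> fst (fst p)) \<in> sets V" using finite_J by blast
    moreover have "(\<Union>p\<in>J. S \<inter> fst (fst p)) = S"
    proof -
      have "\<exists>p\<in>J. x \<in> fst (fst p)" if "x \<in> S" for x
      proof -
        have "x \<in> M" using that S by (auto simp: sets_borel_M)
        then obtain p where "p \<in> J" "in_piece p x" using piece_exists by blast
        then show ?thesis using in_pieceD(2) unfolding charts_at_def by blast
      qed
      then show ?thesis by blast
    qed
    ultimately show ?thesis by simp
  qed
  then show ?thesis using 1 by blast
qed

text \<open>
  On each doubled piece the volume density lies between positive constants, and finitely many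
  pieces of finite volume cover the manifold.
\<close>

lemma volume_comparable:
  assumes nontrivial: "emeasure V M \<noteq> 0"
  shows "\<exists>\<alpha> \<beta>. comparable (normalized_volume M A g) \<alpha> \<beta>"
proof -
  have vol: "emeasure V B = chart_volume A g c B" if "c \<in> A" "B \<in> sets borel_M" "B \<subseteq> fst c" for c B
    using volume_cases nontrivial that by blast
  have "\<exists>\<alpha> \<beta>. 0 < \<alpha> \<and> 0 < \<beta> \<and> (\<forall>S\<in>sets borel. S \<subseteq> big_piece p \<longrightarrow>
     ennreal \<alpha> * emeasure lborel S \<le> emeasure V (chart_inv (fst p) ` S) \<and>
     emeasure V (chart_inv (fst p) ` S) \<le> ennreal \<beta> * emeasure lborel S)" if p: "p \<in> J" for p
  proof -
    note pf = piece_facts[OF p]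
    have "emeasure V (chart_inv (fst p) ` S) = chart_volume A g (fst p) (chart_inv (fst p) ` S)"
      if "S \<in> sets borel" "S \<subseteq> big_piece p" for S
    proof (rule vol[OF pf(1)])
      have sub: "S \<subseteq> snd (fst p) ` fst (fst p)" using that(2) pf(6) by blast
      show "chart_inv (fst p) ` S \<in> sets borel_M" by (rule chart_inv_image_sets[OF pf(1) that(1) sub])
      show "chart_inv (fst p) ` S \<subseteq> fst (fst p)" using sub snd_chart_inv(2)[OF pf(1)] by blast
    qed
    then show ?thesis using density_bounds[OF pf(1,4,6)] by simp
  qed
  then have "\<forall>p\<in>J. \<exists>w. 0 < fst w \<and> 0 < snd w \<and> (\<forall>S\<in>sets borel. S \<subseteq> big_piece p \<longrightarrow>
     ennreal (fst w) * emeasure lborel S \<le> emeasure V (chart_inv (fst p) ` S) \<and>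
     emeasure V (chart_inv (fst p) ` S) \<le> ennreal (snd w) * emeasure lborel S)"
    by (simp only: split_paired_Ex fst_conv snd_conv) blast
  from bchoice[OF this] obtain w where w: "\<forall>p\<in>J. 0 < fst (w p) \<and> 0 < snd (w p) \<and> (\<forall>S\<in>sets borel. S \<subseteq> big_piece p \<longrightarrow>
     ennreal (fst (w p)) * emeasure lborel S \<le> emeasure V (chart_inv (fst p) ` S) \<and>
     emeasure V (chart_inv (fst p) ` S) \<le> ennreal (snd (w p)) * emeasure lborel S)" ..
  define \<alpha> \<beta> where "\<alpha> p = fst (w p)" and "\<beta> p = snd (w p)" for p
  have ab: "0 < \<alpha> p" "0 < \<beta> p" if "p \<in> J" for p using w that unfolding \<alpha>_def \<beta>_def by blast+
  have ab_le: "ennreal (\<alpha> p) * emeasure lborel S \<le> emeasure V (chart_inv (fst p) ` S)"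
    "emeasure V (chart_inv (fst p) ` S) \<le> ennreal (\<beta> p) * emeasure lborel S"
    if "p \<in> J" "S \<in> sets borel" "S \<subseteq> big_piece p" for p S
    using w that unfolding \<alpha>_def \<beta>_def by blast+
  have big_borel: "big_piece p \<in> sets borel" for p by (simp add: big_piece_def)
  have big_fin: "emeasure lborel S < \<infinity>" if "S \<subseteq> big_piece p" for S p
    using that bounded_subset[OF bounded_cball] by (intro emeasure_bounded_finite) (auto simp: big_piece_def)
  have Vfin: "emeasure V (chart_inv (fst p) ` S) < \<infinity>" if "p \<in> J" "S \<in> sets borel" "S \<subseteq> big_piece p" for p S
    using ab_le(2)[OF that] big_fin[OF that(3)] by (auto intro: le_less_trans simp: ennreal_mult_less_top)
  have cover: "M = (\<Union>p\<in>J. chart_inv (fst p) ` big_piece p)"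
  proof
    show "M \<subseteq> (\<Union>p\<in>J. chart_inv (fst p) ` big_piece p)"
    proof
      fix x assume "x \<in> M"
      then obtain p where "p \<in> J" "in_piece p x" using piece_exists by blast
      then show "x \<in> (\<Union>p\<in>J. chart_inv (fst p) ` big_piece p)" using piece_facts(5) unfolding in_piece_def by blast
    qed
    show "(\<Union>p\<in>J. chart_inv (fst p) ` big_piece p) \<subseteq> M"
      using compact_chart_piece(2)[OF piece_facts(1,4,6)] by blast
  qed
  have img: "chart_inv (fst p) ` S \<in> sets V" if "p \<in> J" "S \<in> sets borel" "S \<subseteq> big_piece p" for p S
    unfolding sets_volume using piece_facts(1,6)[OF that(1)] that(2,3) by (intro chart_inv_image_sets) auto
  have "emeasure V M = emeasure V (\<Union>p\<in>J. chart_inv (fst p) ` big_piece p)"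
    using cover by (rule arg_cong)
  also have "\<dots> \<le> (\<Sum>p\<in>J. emeasure V (chart_inv (fst p) ` big_piece p))"
    using finite_J img big_borel by (intro emeasure_subadditive_finite) blast+
  also have "\<dots> < \<infinity>" using Vfin[OF _ big_borel order_refl] finite_J by (simp add: infinity_ennreal_def)
  finally have VM: "emeasure V M < \<infinity>" .
  let ?m = "normalized_volume M A g"
  define v where "v = measure V M"
  have v: "v > 0" using nontrivial VM unfolding v_def by (simp add: measure_def enn2real_positive_iff zero_less_iff_neq_zero)
  have MV: "M \<in> sets V" using sets.top[of V] space_volume by simp
  have ms: "measure ?m B = measure V B / v" if "B \<in> sets V" for B
  proof -
    have "measure ?m B = measure V (M \<inter> B) / measure V M"
      unfolding normalized_volume_def by (rule measure_uniform_measure[OF nontrivial _ that]) (use VM in auto)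
    moreover have "M \<inter> B = B" using sets.sets_into_space[OF that] space_volume by auto
    ultimately show ?thesis by (simp add: v_def)
  qed
  have fm: "finite_measure ?m"
    by (rule finite_measureI)
       (use emeasure_uniform_measure_1[OF nontrivial] VM in \<open>simp add: normalized_volume_def space_volume\<close>)
  have sm: "sets ?m = sets borel_M" by (simp add: normalized_volume_def sets_volume)
  define \<alpha>' where "\<alpha>' = Min (insert 1 (\<alpha> ` J))"
  define \<beta>' where "\<beta>' = Max (insert 1 (\<beta> ` J))"
  have ab': "0 < \<alpha>'" "0 < \<beta>'" "\<And>p. p \<in> J \<Longrightarrow> \<alpha>' \<le> \<alpha> p" "\<And>p. p \<in> J \<Longrightarrow> \<beta> p \<le> \<beta>'"
  proof -
    show "0 < \<alpha>'" unfolding \<alpha>'_def using finite_J ab(1) by (subst Min_gr_iff) auto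
    show "0 < \<beta>'" unfolding \<beta>'_def using finite_J ab(2) by (subst Max_gr_iff) auto
    show "\<And>p. p \<in> J \<Longrightarrow> \<alpha>' \<le> \<alpha> p" "\<And>p. p \<in> J \<Longrightarrow> \<beta> p \<le> \<beta>'"
      unfolding \<alpha>'_def \<beta>'_def using finite_J by auto
  qed
  have "\<alpha>' / v * measure lborel S \<le> measure ?m (chart_inv (fst p) ` S) \<and>
        measure ?m (chart_inv (fst p) ` S) \<le> \<beta>' / v * measure lborel S"
    if p: "p \<in> J" and S: "S \<in> sets borel" "S \<subseteq> big_piece p" for p S
  proof -
    have eS: "emeasure lborel S = ennreal (measure lborel S)"
      using big_fin[OF S(2)] by (intro emeasure_eq_ennreal_measure) auto
    have eV: "emeasure V (chart_inv (fst p) ` S) = ennreal (measure V (chart_inv (fst p) ` S))"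
      using Vfin[OF p S] by (intro emeasure_eq_ennreal_measure) auto
    have "\<alpha> p * measure lborel S \<le> measure V (chart_inv (fst p) ` S)"
      using ab_le(1)[OF p S] ab(1)[OF p] unfolding eS eV by (simp add: ennreal_mult[symmetric])
    moreover have "\<alpha>' * measure lborel S \<le> \<alpha> p * measure lborel S" using ab'(3)[OF p] by (intro mult_right_mono) auto
    moreover have "measure V (chart_inv (fst p) ` S) \<le> \<beta> p * measure lborel S"
      using ab_le(2)[OF p S] ab(2)[OF p] unfolding eS eV by (simp add: ennreal_mult[symmetric])
    moreover have "\<beta> p * measure lborel S \<le> \<beta>' * measure lborel S" using ab'(4)[OF p] by (intro mult_right_mono) auto
    ultimately show ?thesis unfolding ms[OF img[OF p S]] using v by (simp add: divide_right_mono)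
  qed
  then show ?thesis
    unfolding comparable_def using fm sm ab'(1,2) v
    by (intro exI[of _ "\<alpha>' / v"] exI[of _ "\<beta>' / v"]) auto
qed

text \<open>
  The pieces are assembled: \<open>hyperbolic_domination\<close> for normalized volume is the hypothesis of
  \<open>positive_frequency_of_hyperbolic_times\<close>.
\<close>

theorem positive_frequency:
  assumes \<sigma>: "0 < \<sigma>" "\<sigma> < 1"
    and ex: "AE x in normalized_volume M A g. \<exists>n\<ge>1. hyperbolic_time A g f \<sigma> x n"
    and int: "integrable (normalized_volume M A g) (\<lambda>x. real (first_hyperbolic_time A g f \<sigma> x))"
  shows "\<exists>\<sigma>' \<theta>. 0 < \<sigma>' \<and> \<sigma>' < 1 \<and> 0 < \<theta> \<and>
           (AE x in normalized_volume M A g. hyperbolic_frequency_bigger A g f \<sigma>' \<theta> x)"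
proof (cases "emeasure V M = 0")
  case True
  have "AE x in V. P x" for P
    by (rule AE_I[of _ _ M]) (use True sets.top[of V] space_volume in auto)
  then have "AE x in normalized_volume M A g. P x" for P
    unfolding normalized_volume_def using sets.top[of V] space_volume by (intro AE_uniform_measureI) auto
  then show ?thesis by (intro exI[of _ "1/2"] exI[of _ 1]) auto
next
  case False
  let ?m = "normalized_volume M A g"
  obtain \<alpha> \<beta> where cmp: "comparable ?m \<alpha> \<beta>" using volume_comparable[OF False] by blast
  have fm: "finite_measure ?m" and sm: "sets ?m = sets borel_M" using cmp by (auto simp: comparable_def)
  have sp: "space ?m = M" using sets_eq_imp_space_eq[OF sm] space_borel_M by simp
  have hyp: "hyperbolic_time A g f s x n \<longleftrightarrow> hyp s x n" for s x n
    by (simp add: hyperbolic_time_def hyp_seq_def)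
  obtain C where C: "\<And>n E. n \<ge> 1 \<Longrightarrow> E \<in> sets borel_M \<Longrightarrow>
     measure ?m {x\<in>M. hyp \<sigma> x n \<and> (f ^^ n) x \<in> E} \<le> C * measure ?m E"
    using hyperbolic_domination[OF cmp \<sigma>] by blast
  have "\<exists>\<sigma>' \<theta>. 0 < \<sigma>' \<and> \<sigma>' < 1 \<and> 0 < \<theta> \<and>
           (AE x in ?m. \<forall>\<^sub>F n in sequentially.
              \<exists>H\<subseteq>{1..n}. (\<forall>i\<in>H. hyp \<sigma>' x i) \<and> real (card H) \<ge> \<theta> * real n)"
  proof (rule positive_frequency_of_hyperbolic_times[OF fm])
    show "f \<in> measurable ?m ?m" using iterate_measurable[of 1] by (simp add: measurable_cong_sets[OF sm sm])
    show "lam \<in> borel_measurable ?m" using lam_measurable by (simp add: measurable_cong_sets[OF sm refl])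
    show "0 < a0 * e0 / b0" using ab0(1,2) e0(1) by simp
    show "AE x in ?m. \<exists>n\<ge>1. hyp \<sigma> x n" using ex unfolding hyp .
    show "integrable ?m (\<lambda>x. real (LEAST n. 1 \<le> n \<and> hyp \<sigma> x n))"
      using int unfolding first_hyperbolic_time_def hyp .
  qed (use lam_bounds C \<sigma> sm sp in auto)
  then show ?thesis unfolding hyperbolic_frequency_bigger_def hyp .
qed

end

theorem theoremD:
  fixes M :: "'a::t2_space set"
    and A :: "('a, 'n::finite) chart set"
    and g :: "('a, 'n) metric"
    and f :: "'a \<Rightarrow> 'a"
    and \<sigma> :: real
  assumes "compact_riemannian_manifold M A g"
    and "C2_local_diffeomorphism M A f"
    and "0 < \<sigma>" and "\<sigma> < 1"
    and "AE x in normalized_volume M A g. \<exists>n\<ge>1. hyperbolic_time A g f \<sigma> x n"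
    and "integrable (normalized_volume M A g) (\<lambda>x. real (first_hyperbolic_time A g f \<sigma> x))"
  shows "\<exists>\<sigma>' \<theta>. 0 < \<sigma>' \<and> \<sigma>' < 1 \<and> 0 < \<theta> \<and>
           (AE x in normalized_volume M A g. hyperbolic_frequency_bigger A g f \<sigma>' \<theta> x)"
proof -
  interpret riemannian_local_diffeo M A g f
    using assms(1,2) by unfold_locales (auto simp: compact_riemannian_manifold_def)
  obtain J where J: "finite J" "\<forall>(c, z, r)\<in>J. c \<in> A \<and> 0 < r \<and> cball z (2 * r) \<subseteq> snd c ` fst c"
     "M \<subseteq> (\<Union>(c, z, r)\<in>J. chart_inv c ` cball z r)" using finite_pieces by blast
  interpret covered_local_diffeo M A g f J
    by unfold_locales (use J in auto)
  show ?thesis by (rule positive_frequency[OF assms(3-6)])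
qed

end
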